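(* Let $|V(x)|\lesssim(1+|x|)^{-\beta}$ on $\mathbb{R}^3$ and $H=\Delta^2+V$. (i) If $\beta>11$, then $f\in S_1L^2\setminus\{0\}$ if and only if $f=Uv\phi$ for some $\phi\in W_{3/2}$ with $H\phi=0$ in the distributional sense and $\phi=-G_0vf+c_0$, where $c_0=\|V\|_{L^1}^{-1}\langle v,Tf\rangle$. (ii) If $\beta>19$, then $f\in S_2L^2\setminus\{0\}$ if and only if $f=Uv\phi$ for some $\phi\in W_{1/2}$ with $H\phi=0$ in the distributional sense and $\phi=-G_0vf$. (iii) If $\beta>23$, then $f\in S_3L^2\setminus\{0\}$ if and only if $f=Uv\phi$ for some $\phi\in L^2$ with $H\phi=0$ in the distributional sense and $\phi=-G_0vf$.
   Context: $U=\operatorname{sign}V$ ($U=1$ where $V=0$), $v=|V|^{1/2}$. $W_\sigma(\mathbb{R}^3)=\bigcap_{s>\sigma}L^2_{-s}(\mathbb{R}^3)$ where $L^2_{-s}=\{f:\langle x\rangle^{-s}f\in L^2\}$, $\langle x\rangle=(1+|x|^2)^{1/2}$. $G_0,G_1,G_3$ are integral operators with kernels $-\frac{|x-y|}{8\pi}$, $|x-y|^2$, $|x-y|^4$. $T=U+vG_0v$, $P=\|V\|_{L^1}^{-1}v\langle v,\cdot\rangle$, $Q=I-P$. $S_1$ is the Riesz projection onto the kernel of $QTQ$ on $QL^2$; $T_1=S_1TPTS_1-\frac{\|V\|_{L^1}}{3(8\pi)^2}S_1vG_1vS_1$ on $S_1L^2$; $S_2$ is the Riesz projection onto $\ker T_1$,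 $D_1=(T_1+S_2)^{-1}$ on $S_1L^2$; $T_2=S_2vG_3vS_2+\frac{10}{3\|V\|_{L^1}}S_2(vG_1v)^2S_2-\frac{10}{3\|V\|_{L^1}}S_2vG_1vTD_1TvG_1vS_2$ on $S_2L^2$; $S_3$ is the Riesz projection onto $\ker T_2$.
   Formalization: The equivalences are stated for nonzero f in L^2 (at f=0 the right side holds with φ=0 while 0 is excluded on the left), and V is assumed not almost everywhere zero, since otherwise P is undefined; S_1 and S_2 are taken as orthogonal projections onto the kernels. *)

theory Defs
  imports "HOL-Analysis.Analysis"
begin

type_synonym fn = "real^3 \<Rightarrow> complex"

definition sq_int :: "fn \<Rightarrow> bool" where
  "sq_int f \<longleftrightarrow> f \<in> borel_measurable lborel \<and> integrable lborel (\<lambda>x. (cmod (f x))^2)"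

definition aeq :: "fn \<Rightarrow> fn \<Rightarrow> bool" where
  "aeq f g \<longleftrightarrow> (AE x in lborel. f x = g x)"

definition L2_inner :: "fn \<Rightarrow> fn \<Rightarrow> complex" where
  "L2_inner f g = (LINT x|lborel. cnj (f x) * g x)"

definition wL2 :: "real \<Rightarrow> fn \<Rightarrow> bool" where
  "wL2 s f \<longleftrightarrow> sq_int (\<lambda>x. complex_of_real ((1 + (norm x)^2) powr (- s / 2)) * f x)"

definition Wsp :: "real \<Rightarrow> fn set" where
  "Wsp \<sigma> = {f. \<forall>s>\<sigma>. wL2 s f}"

definition sgnU :: "(real^3 \<Rightarrow> real) \<Rightarrow> real^3 \<Rightarrow> real" where
  "sgnU V x = (if V x < 0 then -1 else 1)"

definition vfun :: "(real^3 \<Rightarrow> real) \<Rightarrow> real^3 \<Rightarrow> real" where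
  "vfun V x = sqrt \<bar>V x\<bar>"

definition L1norm :: "(real^3 \<Rightarrow> real) \<Rightarrow> real" where
  "L1norm V = (LINT x|lborel. \<bar>V x\<bar>)"

definition mult :: "(real^3 \<Rightarrow> real) \<Rightarrow> fn \<Rightarrow> fn" where
  "mult a f = (\<lambda>x. complex_of_real (a x) * f x)"

definition intop :: "(real^3 \<Rightarrow> real^3 \<Rightarrow> real) \<Rightarrow> fn \<Rightarrow> fn" where
  "intop K f = (\<lambda>x. LINT y|lborel. complex_of_real (K x y) * f y)"

definition G0k :: "real^3 \<Rightarrow> real^3 \<Rightarrow> real" where
  "G0k x y = - dist x y / (8 * pi)"

definition G1k :: "real^3 \<Rightarrow> real^3 \<Rightarrow> real" where
  "G1k x y = (dist x y)^2"

definition G3k :: "real^3 \<Rightarrow> real^3 \<Rightarrow> real" where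
  "G3k x y = (dist x y)^4"

definition vGv :: "(real^3 \<Rightarrow> real^3 \<Rightarrow> real) \<Rightarrow> (real^3 \<Rightarrow> real) \<Rightarrow> fn \<Rightarrow> fn" where
  "vGv K V f = mult (vfun V) (intop K (mult (vfun V) f))"

definition Top :: "(real^3 \<Rightarrow> real) \<Rightarrow> fn \<Rightarrow> fn" where
  "Top V f = (\<lambda>x. complex_of_real (sgnU V x) * f x + vGv G0k V f x)"

definition vpair :: "(real^3 \<Rightarrow> real) \<Rightarrow> fn \<Rightarrow> complex" where
  "vpair V f = (LINT x|lborel. complex_of_real (vfun V x) * f x)"

definition Pop :: "(real^3 \<Rightarrow> real) \<Rightarrow> fn \<Rightarrow> fn" where
  "Pop V f = (\<lambda>x. complex_of_real (vfun V x / L1norm V) * vpair V f)"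

definition Qop :: "(real^3 \<Rightarrow> real) \<Rightarrow> fn \<Rightarrow> fn" where
  "Qop V f = (\<lambda>x. f x - Pop V f x)"

definition QL2 :: "(real^3 \<Rightarrow> real) \<Rightarrow> fn set" where
  "QL2 V = {f. sq_int f \<and> aeq (Qop V f) f}"

text \<open>Orthogonal projection onto a (closed) subspace K of L^2 (representative chosen by SOME).\<close>
definition orth_proj :: "fn set \<Rightarrow> fn \<Rightarrow> fn" where
  "orth_proj K g = (SOME h. h \<in> K \<and> (\<forall>k\<in>K. L2_inner k (\<lambda>x. g x - h x) = 0))"

definition S1L2 :: "(real^3 \<Rightarrow> real) \<Rightarrow> fn set" where
  "S1L2 V = {f \<in> QL2 V. aeq (Qop V (Top V (Qop V f))) (\<lambda>_. 0)}"

definition S1 :: "(real^3 \<Rightarrow> real) \<Rightarrow> fn \<Rightarrow> fn" where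
  "S1 V = orth_proj (S1L2 V)"

definition T1 :: "(real^3 \<Rightarrow> real) \<Rightarrow> fn \<Rightarrow> fn" where
  "T1 V f = (\<lambda>x. S1 V (Top V (Pop V (Top V f))) x
      - complex_of_real (L1norm V / (3 * (8 * pi)^2)) * S1 V (vGv G1k V f) x)"

definition S2L2 :: "(real^3 \<Rightarrow> real) \<Rightarrow> fn set" where
  "S2L2 V = {f \<in> S1L2 V. aeq (T1 V f) (\<lambda>_. 0)}"

definition S2 :: "(real^3 \<Rightarrow> real) \<Rightarrow> fn \<Rightarrow> fn" where
  "S2 V = orth_proj (S2L2 V)"

text \<open>D_1 = (T_1 + S_2)^{-1} on S_1 L^2, applied to S_1 g.\<close>
definition D1 :: "(real^3 \<Rightarrow> real) \<Rightarrow> fn \<Rightarrow> fn" where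
  "D1 V g = (SOME h. h \<in> S1L2 V \<and> aeq (\<lambda>x. T1 V h x + S2 V h x) (S1 V g))"

definition T2 :: "(real^3 \<Rightarrow> real) \<Rightarrow> fn \<Rightarrow> fn" where
  "T2 V f = S2 V (\<lambda>x. vGv G3k V f x
      + complex_of_real (10 / (3 * L1norm V)) * vGv G1k V (vGv G1k V f) x
      - complex_of_real (10 / (3 * L1norm V)) * vGv G1k V (Top V (D1 V (Top V (vGv G1k V f)))) x)"

definition S3L2 :: "(real^3 \<Rightarrow> real) \<Rightarrow> fn set" where
  "S3L2 V = {f \<in> S2L2 V. aeq (T2 V f) (\<lambda>_. 0)}"

definition pd :: "3 \<Rightarrow> (real^3 \<Rightarrow> real) \<Rightarrow> real^3 \<Rightarrow> real" where
  "pd i \<psi> x = deriv (\<lambda>t. \<psi> (x + t *\<^sub>R axis i 1)) 0"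

definition iter_pd :: "3 list \<Rightarrow> (real^3 \<Rightarrow> real) \<Rightarrow> real^3 \<Rightarrow> real" where
  "iter_pd is \<psi> = foldr pd is \<psi>"

definition test_fun :: "(real^3 \<Rightarrow> real) \<Rightarrow> bool" where
  "test_fun \<psi> \<longleftrightarrow> (\<exists>K. compact K \<and> (\<forall>x. x \<notin> K \<longrightarrow> \<psi> x = 0))
     \<and> (\<forall>is. continuous_on UNIV (iter_pd is \<psi>))
     \<and> (\<forall>is i x. (\<lambda>t. iter_pd is \<psi> (x + t *\<^sub>R axis i 1)) differentiable at 0)"

definition lap :: "(real^3 \<Rightarrow> real) \<Rightarrow> real^3 \<Rightarrow> real" where
  "lap \<psi> = (\<lambda>x. \<Sum>i\<in>UNIV. pd i (pd i \<psi>) x)"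

definition dist_H_zero :: "(real^3 \<Rightarrow> real) \<Rightarrow> fn \<Rightarrow> bool" where
  "dist_H_zero V \<phi> \<longleftrightarrow> (\<forall>\<psi>. test_fun \<psi> \<longrightarrow>
      (LINT x|lborel. \<phi> x * complex_of_real (lap (lap \<psi>) x))
      + (LINT x|lborel. complex_of_real (V x * \<psi> x) * \<phi> x) = 0)"

end

theory Submission
  imports Defs "HOL-Real_Asymp.Real_Asymp"
begin

text \<open>
  If \<open>f = U v \<phi>\<close>, the equation \<open>\<phi> = - G\<^sub>0 v f + c\<close> says exactly that \<open>T f = c v\<close>, and such a \<open>\<phi>\<close> solves
  \<open>H \<phi> = 0\<close> because \<open>- \<bar>x\<bar> / (8 \<pi>)\<close> is a fundamental solution of the bilaplacian. The weighted
  spaces measure how many moments of \<open>v f\<close> vanish: the expansion of \<open>\<bar>x - y\<bar>\<close> for large \<open>x\<close> has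
  leading terms \<open>\<bar>x\<bar>\<close>, \<open>x \<bullet> y / \<bar>x\<bar>\<close> and \<open>(\<bar>y\<bar>\<^sup>2 - (x \<bullet> y)\<^sup>2 / \<bar>x\<bar>\<^sup>2) / (2 \<bar>x\<bar>)\<close>, none of which is
  admissible unless its coefficient is zero, so \<open>\<phi>\<close> lies in \<open>W\<^sub>3\<^sub>/\<^sub>2\<close>, \<open>W\<^sub>1\<^sub>/\<^sub>2\<close> or \<open>L\<^sup>2\<close> iff the moments
  of order at most 0, 1 or 2 vanish. On the other side \<open>T\<^sub>1\<close> and \<open>T\<^sub>2\<close> are non-negative quadratic forms in
  these moments (and in \<open>\<langle>v, T f\<rangle>\<close>), so their kernels are cut out by the same conditions.
  Orthogonal projections and \<open>D\<^sub>1\<close> exist because \<open>S\<^sub>1 L\<^sup>2\<close> is finite-dimensional, being fixed by an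
  integral operator with square-integrable kernel.
\<close>

section \<open>Square-integrable functions\<close>

text \<open>Elements are functions, not classes, and \<open>orth_proj\<close> and \<open>D1\<close>
  choose representatives, so the operators built from them are linear only modulo null sets. They
  are therefore studied through inner products with members of a subspace, where the choice is
  invisible, and \<open>aeq\<close> is recovered at the end by testing a difference against itself.
  A leading term of size |x|^k is excluded by testing with weight s = k + 1 for k = 1, 0, -1. This
  is 2, 1, 0: admissible for the three spaces in question, yet below k + 3/2, above which |x|^k
  would become square-integrable. The one sign that is not visible from the formulas is that of the
  subtracted term of \<open>T2\<close>. It is controlled because the form of \<open>T1 + S2\<close>
  dominates the rank-one form \<open>|\<tau>|^2 / L1norm V\<close>, so that its inverse is bounded
  by \<open>L1norm V\<close> in the only direction that matters. The threshold 11 = 8 + 3 makes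
  \<open>(1 + |x|)^4 v\<close> square-integrable in dimension 3, the exponent 4 being the degree of
  the fastest growing kernel \<open>G3k\<close>.\<close>

lemma borel_measurable_cnj [measurable (raw)]:
  "f \<in> borel_measurable M \<Longrightarrow> (\<lambda>x. cnj (f x)) \<in> borel_measurable M"
  by (rule borel_measurable_continuous_on[OF continuous_on_cnj[OF continuous_on_id]])

lemma sq_intD:
  assumes "sq_int f"
  shows "f \<in> borel_measurable borel" "integrable lborel (\<lambda>x. (cmod (f x))\<^sup>2)"
  using assms unfolding sq_int_def by auto

lemma sq_int_bound:
  assumes "f \<in> borel_measurable borel" "integrable lborel h"
    "AE x in lborel. (cmod (f x))\<^sup>2 \<le> h x"
  shows "sq_int f"
  unfolding sq_int_def
proof
  show "f \<in> borel_measurable lborel" using assms(1) by simp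
  show "integrable lborel (\<lambda>x. (cmod (f x))\<^sup>2)"
    by (rule Bochner_Integration.integrable_bound[OF assms(2)])
      (use assms(1,3) in auto)
qed

lemma sq_int_add:
  assumes "sq_int f" "sq_int g"
  shows "sq_int (\<lambda>x. f x + g x)"
proof -
  note [measurable] = sq_intD(1)[OF assms(1)] sq_intD(1)[OF assms(2)]
  have *: "(cmod (a + b))\<^sup>2 \<le> 2 * (cmod a)\<^sup>2 + 2 * (cmod b)\<^sup>2" for a b
  proof -
    have "(cmod (a + b))\<^sup>2 \<le> (cmod a + cmod b)\<^sup>2"
      by (intro power_mono norm_triangle_ineq) auto
    also have "\<dots> \<le> 2 * (cmod a)\<^sup>2 + 2 * (cmod b)\<^sup>2"
      using sum_squares_bound[of "cmod a" "cmod b"] by (simp add: power2_sum)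
    finally show ?thesis .
  qed
  show ?thesis
    by (rule sq_int_bound[where h="\<lambda>x. 2 * (cmod (f x))\<^sup>2 + 2 * (cmod (g x))\<^sup>2"])
      (use * sq_intD(2)[OF assms(1)] sq_intD(2)[OF assms(2)] in auto)
qed

lemma sq_int_cmult: "sq_int f \<Longrightarrow> sq_int (\<lambda>x. c * f x)"
  unfolding sq_int_def by (auto simp: norm_mult power_mult_distrib)

lemma sq_int_mult_const: "sq_int f \<Longrightarrow> sq_int (\<lambda>x. f x * c)"
  using sq_int_cmult[of f c] by (simp add: mult.commute)

lemma sq_int_diff: "sq_int f \<Longrightarrow> sq_int g \<Longrightarrow> sq_int (\<lambda>x. f x - g x)"
  using sq_int_add[of f "\<lambda>x. (-1) * g x"] sq_int_cmult[of g "-1"] by simp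

lemma sq_int_zero: "sq_int (\<lambda>_. 0)"
  unfolding sq_int_def by simp

lemma sq_int_sum:
  "finite I \<Longrightarrow> (\<And>i. i \<in> I \<Longrightarrow> sq_int (f i)) \<Longrightarrow> sq_int (\<lambda>x. \<Sum>i\<in>I. f i x)"
  by (induction I rule: finite_induct) (auto intro: sq_int_zero sq_int_add)

lemma sq_int_aeq:
  assumes "sq_int f" "aeq f g" "g \<in> borel_measurable borel"
  shows "sq_int g"
  by (rule sq_int_bound[OF assms(3) sq_intD(2)[OF assms(1)]])
    (use assms(2) in \<open>auto simp: aeq_def\<close>)

lemma sq_int_domin:
  assumes "f \<in> borel_measurable borel" "sq_int g" "\<And>x. cmod (f x) \<le> c * cmod (g x)"
  shows "sq_int f"
proof (rule sq_int_bound[OF assms(1)])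
  show "integrable lborel (\<lambda>x. c\<^sup>2 * (cmod (g x))\<^sup>2)"
    using sq_intD(2)[OF assms(2)] by simp
  show "AE x in lborel. (cmod (f x))\<^sup>2 \<le> c\<^sup>2 * (cmod (g x))\<^sup>2"
    using power_mono[OF assms(3), where n=2] by (simp add: power_mult_distrib)
qed

lemma integrable_sq_int_mult:
  assumes "sq_int f" "sq_int g"
  shows "integrable lborel (\<lambda>x. f x * g x)"
proof (rule Bochner_Integration.integrable_bound)
  note [measurable] = sq_intD(1)[OF assms(1)] sq_intD(1)[OF assms(2)]
  show "integrable lborel (\<lambda>x. (cmod (f x))\<^sup>2 + (cmod (g x))\<^sup>2)"
    using sq_intD(2)[OF assms(1)] sq_intD(2)[OF assms(2)] by auto
  show "(\<lambda>x. f x * g x) \<in> borel_measurable lborel" by measurable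
  have "cmod (f x) * cmod (g x) \<le> (cmod (f x))\<^sup>2 + (cmod (g x))\<^sup>2" for x
    using sum_squares_bound[of "cmod (f x)" "cmod (g x)"]
      mult_nonneg_nonneg[of "cmod (f x)" "cmod (g x)"] by (simp del: mult_nonneg_nonneg)
  then show "AE x in lborel. norm (f x * g x) \<le> norm ((cmod (f x))\<^sup>2 + (cmod (g x))\<^sup>2)"
    by (simp add: norm_mult)
qed

lemma sq_int_cnj: "sq_int f \<Longrightarrow> sq_int (\<lambda>x. cnj (f x))"
  by (rule sq_int_domin[where g=f and c=1]) (auto dest: sq_intD)

lemma integrable_L2_inner: "sq_int f \<Longrightarrow> sq_int g \<Longrightarrow> integrable lborel (\<lambda>x. cnj (f x) * g x)"
  by (rule integrable_sq_int_mult[OF sq_int_cnj])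

lemma L2_inner_add_right:
  "sq_int f \<Longrightarrow> sq_int g \<Longrightarrow> sq_int h \<Longrightarrow>
    L2_inner f (\<lambda>x. g x + h x) = L2_inner f g + L2_inner f h"
  unfolding L2_inner_def distrib_left
  by (rule Bochner_Integration.integral_add) (auto intro: integrable_L2_inner)

lemma L2_inner_diff_right:
  "sq_int f \<Longrightarrow> sq_int g \<Longrightarrow> sq_int h \<Longrightarrow>
    L2_inner f (\<lambda>x. g x - h x) = L2_inner f g - L2_inner f h"
  unfolding L2_inner_def right_diff_distrib
  by (rule Bochner_Integration.integral_diff) (auto intro: integrable_L2_inner)

lemma L2_inner_cmult_right: "L2_inner f (\<lambda>x. c * g x) = c * L2_inner f g"
  unfolding L2_inner_def by (simp add: mult.left_commute)

lemma L2_inner_cnj: "L2_inner f g = cnj (L2_inner g f)"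
  unfolding L2_inner_def
  by (subst Bochner_Integration.integral_cnj[symmetric]) (simp add: mult.commute)

lemma L2_inner_diff_left:
  "sq_int f \<Longrightarrow> sq_int g \<Longrightarrow> sq_int h \<Longrightarrow>
    L2_inner (\<lambda>x. g x - h x) f = L2_inner g f - L2_inner h f"
  using L2_inner_diff_right[of f g h] L2_inner_cnj[of f] L2_inner_cnj[of _ f]
  by (metis complex_cnj_diff)

lemma L2_inner_add_left:
  "sq_int f \<Longrightarrow> sq_int g \<Longrightarrow> sq_int h \<Longrightarrow>
    L2_inner (\<lambda>x. g x + h x) f = L2_inner g f + L2_inner h f"
  using L2_inner_add_right[of f g h] L2_inner_cnj[of f] L2_inner_cnj[of _ f]
  by (metis complex_cnj_add)

lemma L2_inner_cmult_left: "L2_inner (\<lambda>x. c * g x) f = cnj c * L2_inner g f"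
  using L2_inner_cmult_right[of f c g] L2_inner_cnj[of f] L2_inner_cnj[of _ f]
  by (metis complex_cnj_mult)

lemma L2_inner_sum_right:
  "finite I \<Longrightarrow> sq_int f \<Longrightarrow> (\<And>i. i \<in> I \<Longrightarrow> sq_int (g i)) \<Longrightarrow>
    L2_inner f (\<lambda>x. \<Sum>i\<in>I. g i x) = (\<Sum>i\<in>I. L2_inner f (g i))"
proof (induction I rule: finite_induct)
  case empty
  then show ?case by (simp add: L2_inner_def)
next
  case (insert j I)
  then show ?case using L2_inner_add_right[of f "g j" "\<lambda>x. \<Sum>i\<in>I. g i x"] sq_int_sum[of I g] by simp
qed

lemma L2_inner_zero_right [simp]: "L2_inner f (\<lambda>_. 0) = 0"
  and L2_inner_zero_left [simp]: "L2_inner (\<lambda>_. 0) f = 0"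
  by (simp_all add: L2_inner_def)

lemma L2_inner_cong:
  assumes "aeq f f'" "aeq g g'" "f \<in> borel_measurable borel" "f' \<in> borel_measurable borel"
    "g \<in> borel_measurable borel" "g' \<in> borel_measurable borel"
  shows "L2_inner f g = L2_inner f' g'"
proof -
  note [measurable] = assms(3-6)
  have "AE x in lborel. cnj (f x) * g x = cnj (f' x) * g' x"
    using assms(1,2) unfolding aeq_def by eventually_elim simp
  then show ?thesis unfolding L2_inner_def by (intro integral_cong_AE) auto
qed

lemma aeq_refl [simp]: "aeq f f" and aeq_sym: "aeq f g \<Longrightarrow> aeq g f"
  and aeq_trans: "aeq f g \<Longrightarrow> aeq g h \<Longrightarrow> aeq f h"
  unfolding aeq_def by (auto elim: AE_mp)

definition L2norm :: "fn \<Rightarrow> real" where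
  "L2norm f = sqrt (LINT x|lborel. (cmod (f x))\<^sup>2)"

lemma L2norm_nonneg [simp]: "0 \<le> L2norm f"
  unfolding L2norm_def by simp

lemma L2norm_square: "(L2norm f)\<^sup>2 = (LINT x|lborel. (cmod (f x))\<^sup>2)"
  unfolding L2norm_def by simp

lemma L2_inner_self: "L2_inner f f = complex_of_real ((L2norm f)\<^sup>2)"
  unfolding L2norm_square L2_inner_def
  by (subst integral_complex_of_real[symmetric])
    (rule Bochner_Integration.integral_cong; simp only: complex_norm_square mult.commute)

lemma L2norm_eq_0:
  assumes "sq_int f" "L2norm f = 0"
  shows "aeq f (\<lambda>_. 0)"
proof -
  have "(LINT x|lborel. (cmod (f x))\<^sup>2) = 0" using assms(2) unfolding L2norm_def by simp
  then have "AE x in lborel. (cmod (f x))\<^sup>2 = 0"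
    by (subst (asm) integral_nonneg_eq_0_iff_AE) (auto intro: sq_intD(2)[OF assms(1)])
  then show ?thesis unfolding aeq_def by simp
qed

lemma L2_inner_self_eq_0: "sq_int f \<Longrightarrow> L2_inner f f = 0 \<Longrightarrow> aeq f (\<lambda>_. 0)"
  using L2norm_eq_0 by (simp add: L2_inner_self)

lemma L2norm_cnj [simp]: "L2norm (\<lambda>x. cnj (f x)) = L2norm f"
  unfolding L2norm_def by simp

lemma L2_Cauchy_Schwarz:
  assumes "sq_int f" "sq_int g"
  shows "(LINT x|lborel. cmod (f x) * cmod (g x)) \<le> L2norm f * L2norm g"
proof -
  let ?I = "LINT x|lborel. cmod (f x) * cmod (g x)"
  note if2 = sq_intD(2)[OF assms(1)] and ig2 = sq_intD(2)[OF assms(2)]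
  have ifg: "integrable lborel (\<lambda>x. cmod (f x) * cmod (g x))"
    using integrable_norm[OF integrable_sq_int_mult[OF assms]] by (simp add: norm_mult)
  have I0: "0 \<le> ?I" by simp
  \<comment> \<open>The parameters will be the two norms crosswise, which makes both outer terms
    equal to the square of the product of the norms.\<close>
  have key: "0 \<le> s\<^sup>2 * (L2norm f)\<^sup>2 - 2 * s * t * ?I + t\<^sup>2 * (L2norm g)\<^sup>2" for s t
  proof -
    have "0 \<le> (LINT x|lborel. (s * cmod (f x) - t * cmod (g x))\<^sup>2)" by simp
    also have "\<dots> = (LINT x|lborel. s\<^sup>2 * (cmod (f x))\<^sup>2 - 2 * s * t * (cmod (f x) * cmod (g x))
        + t\<^sup>2 * (cmod (g x))\<^sup>2)"
      by (rule Bochner_Integration.integral_cong) (auto simp: power2_diff power_mult_distrib)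
    also have "\<dots> = s\<^sup>2 * (L2norm f)\<^sup>2 - 2 * s * t * ?I + t\<^sup>2 * (L2norm g)\<^sup>2"
      using if2 ig2 ifg by (simp add: L2norm_square)
    finally show ?thesis .
  qed
  show ?thesis
  proof (cases "L2norm f = 0 \<or> L2norm g = 0")
    case True
    then have "AE x in lborel. cmod (f x) * cmod (g x) = 0"
      using L2norm_eq_0[OF assms(1)] L2norm_eq_0[OF assms(2)] unfolding aeq_def by auto
    then have "?I = 0" by (rule integral_eq_zero_AE)
    then show ?thesis by simp
  next
    case False
    then have pos: "0 < L2norm f" "0 < L2norm g"
      using L2norm_nonneg[of f] L2norm_nonneg[of g] by linarith+
    have "0 \<le> 2 * (L2norm f * L2norm g) * (L2norm f * L2norm g - ?I)"
      using key[of "L2norm g" "L2norm f"] by (simp add: algebra_simps power2_eq_square)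
    moreover have "0 < L2norm f * L2norm g" using pos by simp
    ultimately show ?thesis by (simp add: zero_le_mult_iff not_le)
  qed
qed

lemma cmod_integral_mult_le:
  assumes "sq_int f" "sq_int g"
  shows "cmod (LINT x|lborel. f x * g x) \<le> L2norm f * L2norm g"
  using order_trans[OF integral_norm_bound[of lborel "\<lambda>x. f x * g x"]] L2_Cauchy_Schwarz[OF assms]
  by (simp add: norm_mult)

section \<open>Finite-dimensional subspaces and orthogonal projections\<close>

definition L2_subspace :: "fn set \<Rightarrow> bool" where
  "L2_subspace K \<longleftrightarrow> (\<forall>f\<in>K. sq_int f) \<and> (\<lambda>_. 0) \<in> K \<and>
     (\<forall>f\<in>K. \<forall>g\<in>K. (\<lambda>x. f x + g x) \<in> K) \<and> (\<forall>f\<in>K. \<forall>c. (\<lambda>x. c * f x) \<in> K)"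

definition orthonormal :: "nat \<Rightarrow> (nat \<Rightarrow> fn) \<Rightarrow> bool" where
  "orthonormal m e \<longleftrightarrow> (\<forall>i<m. \<forall>j<m. L2_inner (e i) (e j) = (if i = j then 1 else 0))"

text \<open>The spaces at hand contain all measurable null functions, so their algebraic dimension
  is infinite. Orthonormal families do not see null sets and count the dimension of the
  quotient.\<close>

definition dim_at_most :: "fn set \<Rightarrow> nat \<Rightarrow> bool" where
  "dim_at_most K N \<longleftrightarrow> (\<forall>m e. (\<forall>i<m. e i \<in> K) \<longrightarrow> orthonormal m e \<longrightarrow> m \<le> N)"

lemma dim_at_most_mono: "dim_at_most K N \<Longrightarrow> K' \<subseteq> K \<Longrightarrow> dim_at_most K' N"
  unfolding dim_at_most_def by blast

lemma L2_subspace_sq_int: "L2_subspace K \<Longrightarrow> f \<in> K \<Longrightarrow> sq_int f"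
  unfolding L2_subspace_def by blast

lemma L2_subspace_diff:
  assumes "L2_subspace K" "f \<in> K" "g \<in> K"
  shows "(\<lambda>x. f x - g x) \<in> K"
proof -
  have "(\<lambda>x. (-1) * g x) \<in> K" using assms unfolding L2_subspace_def by blast
  then have "(\<lambda>x. f x + (-1) * g x) \<in> K"
    using assms(1,2) unfolding L2_subspace_def by fast
  then show ?thesis by simp
qed

lemma L2_subspace_sum:
  "finite I \<Longrightarrow> L2_subspace K \<Longrightarrow> (\<And>i. i \<in> I \<Longrightarrow> f i \<in> K) \<Longrightarrow> (\<lambda>x. \<Sum>i\<in>I. f i x) \<in> K"
  by (induction I rule: finite_induct) (auto simp: L2_subspace_def)

text \<open>The bound \<open>N\<close> yields an orthonormal family in \<open>K\<close> of maximal
  length, and the Fourier sum over it is the projection: for \<open>k\<close> in \<open>K\<close>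
  the residue \<open>k - pr k\<close> has norm zero, since its normalisation would otherwise extend
  the family.\<close>

lemma orth_proj_exists:
  assumes K: "L2_subspace K" and N: "dim_at_most K N" and g: "sq_int g"
  shows "\<exists>h. h \<in> K \<and> (\<forall>k\<in>K. L2_inner k (\<lambda>x. g x - h x) = 0)"
proof -
  let ?P = "\<lambda>m. \<exists>e. (\<forall>i<m. e i \<in> K) \<and> orthonormal m e"
  have P0: "?P 0" by (auto simp: orthonormal_def)
  have bd: "\<And>m. ?P m \<Longrightarrow> m \<le> N" using N unfolding dim_at_most_def by blast
  define m where "m = (GREATEST m. ?P m)"
  have "?P m" unfolding m_def by (rule GreatestI_nat[where P="?P", OF P0 bd])
  then obtain e where e: "\<And>i. i < m \<Longrightarrow> e i \<in> K" and on: "orthonormal m e" by blast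
  have max: "\<not> ?P (Suc m)"
    using Greatest_le_nat[of ?P "Suc m", OF _ bd] unfolding m_def by auto
  have se: "\<And>i. i < m \<Longrightarrow> sq_int (e i)" using e L2_subspace_sq_int[OF K] by blast
  define pr where "pr u = (\<lambda>x. \<Sum>i<m. L2_inner (e i) u * e i x)" for u
  have prK: "pr u \<in> K" for u
    unfolding pr_def by (rule L2_subspace_sum[OF _ K]) (use e K in \<open>auto simp: L2_subspace_def\<close>)
  have spr: "sq_int (pr u)" for u using prK L2_subspace_sq_int[OF K] by blast
  have ort: "L2_inner (e j) (\<lambda>x. u x - pr u x) = 0" if "j < m" "sq_int u" for j u
  proof -
    have "L2_inner (e j) (pr u) = (\<Sum>i<m. L2_inner (e j) (\<lambda>x. L2_inner (e i) u * e i x))"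
      unfolding pr_def by (rule L2_inner_sum_right) (use that se sq_int_cmult in auto)
    also have "\<dots> = (\<Sum>i<m. if i = j then L2_inner (e i) u else 0)"
      unfolding L2_inner_cmult_right using on that
      by (intro sum.cong) (auto simp: orthonormal_def)
    also have "\<dots> = L2_inner (e j) u" using that by simp
    finally show ?thesis using that se spr by (simp add: L2_inner_diff_right)
  qed
  have "L2_inner k (\<lambda>x. g x - pr g x) = 0" if k: "k \<in> K" for k
  proof -
    define r where "r = (\<lambda>x. k x - pr k x)"
    have sk: "sq_int k" using k L2_subspace_sq_int[OF K] by blast
    have rK: "r \<in> K" unfolding r_def by (rule L2_subspace_diff[OF K k prK])
    have sr: "sq_int r" using rK L2_subspace_sq_int[OF K] by blast
    have r0: "L2norm r = 0"
    proof (rule ccontr)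
      assume nz: "L2norm r \<noteq> 0"
      define w where "w = (\<lambda>x. complex_of_real (1 / L2norm r) * r x)"
      have wK: "w \<in> K" using rK K unfolding w_def L2_subspace_def by blast
      have ww: "L2_inner w w = 1"
        unfolding w_def L2_inner_cmult_left L2_inner_cmult_right L2_inner_self
        using nz by (simp add: power2_eq_square)
      have ew: "L2_inner (e j) w = 0" if "j < m" for j
        unfolding w_def L2_inner_cmult_right using ort[OF that sk] by (simp add: r_def)
      have we: "L2_inner w (e j) = 0" if "j < m" for j
        using ew[OF that] L2_inner_cnj[of w "e j"] by simp
      have "?P (Suc m)"
      proof (intro exI[of _ "e(m := w)"] conjI)
        show "\<forall>i<Suc m. (e(m := w)) i \<in> K" using e wK by (auto simp: less_Suc_eq)
        show "orthonormal (Suc m) (e(m := w))"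
          using on ww ew we unfolding orthonormal_def by (auto simp: less_Suc_eq)
      qed
      then show False using max by blast
    qed
    have sgp: "sq_int (\<lambda>x. g x - pr g x)" by (rule sq_int_diff[OF g spr])
    have "L2_inner r (\<lambda>x. g x - pr g x) = 0"
    proof -
      have "L2_inner r (\<lambda>x. g x - pr g x) = L2_inner (\<lambda>_. 0) (\<lambda>x. g x - pr g x)"
        by (rule L2_inner_cong[OF L2norm_eq_0[OF sr r0]]) (use sr sgp in \<open>auto dest: sq_intD\<close>)
      then show ?thesis by simp
    qed
    moreover have "L2_inner (pr k) (\<lambda>x. g x - pr g x) = 0"
    proof -
      have "L2_inner (\<lambda>x. g x - pr g x) (pr k)
          = (\<Sum>i<m. L2_inner (\<lambda>x. g x - pr g x) (\<lambda>x. L2_inner (e i) k * e i x))"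
        unfolding pr_def[of k] by (rule L2_inner_sum_right) (use sgp se sq_int_cmult in auto)
      also have "\<dots> = 0"
        using ort[OF _ g] L2_inner_cnj[of "\<lambda>x. g x - pr g x"]
        by (intro sum.neutral) (auto simp: L2_inner_cmult_right)
      finally show ?thesis using L2_inner_cnj[of "pr k"] by simp
    qed
    moreover have "L2_inner r (\<lambda>x. g x - pr g x)
        = L2_inner k (\<lambda>x. g x - pr g x) - L2_inner (pr k) (\<lambda>x. g x - pr g x)"
      unfolding r_def by (rule L2_inner_diff_left[OF sgp sk spr])
    ultimately show ?thesis by simp
  qed
  then show ?thesis using prK by blast
qed

lemma orth_proj:
  assumes "L2_subspace K" "dim_at_most K N" "sq_int g"
  shows "orth_proj K g \<in> K"
    and "k \<in> K \<Longrightarrow> L2_inner k (orth_proj K g) = L2_inner k g"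
proof -
  have *: "orth_proj K g \<in> K \<and> (\<forall>k\<in>K. L2_inner k (\<lambda>x. g x - orth_proj K g x) = 0)"
    unfolding orth_proj_def by (rule someI_ex[OF orth_proj_exists[OF assms]])
  then show "orth_proj K g \<in> K" by blast
  assume "k \<in> K"
  with * have "L2_inner k (\<lambda>x. g x - orth_proj K g x) = 0" by blast
  then show "L2_inner k (orth_proj K g) = L2_inner k g"
    using * \<open>k \<in> K\<close> assms(3) L2_subspace_sq_int[OF assms(1)]
    by (simp add: L2_inner_diff_right)
qed

text \<open>Passes from weak identities to equality almost everywhere: the difference is itself an
  admissible test function.\<close>

lemma aeq_if_L2_inner_eq:
  assumes K: "L2_subspace K" and "f \<in> K" "g \<in> K"
    and eq: "\<And>k. k \<in> K \<Longrightarrow> L2_inner k f = L2_inner k g"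
  shows "aeq f g"
proof -
  have d: "(\<lambda>x. f x - g x) \<in> K" by (rule L2_subspace_diff[OF assms(1-3)])
  have "L2_inner (\<lambda>x. f x - g x) (\<lambda>x. f x - g x) = 0"
    using eq[OF d] assms L2_subspace_sq_int[OF K] by (subst L2_inner_diff_right) (auto intro: d)
  then have "aeq (\<lambda>x. f x - g x) (\<lambda>_. 0)"
    by (rule L2_inner_self_eq_0[OF L2_subspace_sq_int[OF K d]])
  then show ?thesis unfolding aeq_def by simp
qed

text \<open>On a finite-dimensional space the complement of the range of a symmetric operator is its
  kernel, so injectivity implies surjectivity. Linearity and symmetry of the operator are only
  asked for weakly, since operators built from \<^const>\<open>orth_proj\<close> are linear only up to null sets.\<close>

lemma symmetric_inj_imp_surj:
  assumes K: "L2_subspace K" and N: "dim_at_most K N" and g: "sq_int g"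
    and A: "\<And>h. h \<in> K \<Longrightarrow> A h \<in> K"
    and add: "\<And>k h h'. k \<in> K \<Longrightarrow> h \<in> K \<Longrightarrow> h' \<in> K \<Longrightarrow>
        L2_inner k (A (\<lambda>x. h x + h' x)) = L2_inner k (A h) + L2_inner k (A h')"
    and scale: "\<And>k h c. k \<in> K \<Longrightarrow> h \<in> K \<Longrightarrow>
        L2_inner k (A (\<lambda>x. c * h x)) = c * L2_inner k (A h)"
    and sym: "\<And>k h. k \<in> K \<Longrightarrow> h \<in> K \<Longrightarrow> L2_inner k (A h) = cnj (L2_inner h (A k))"
    and inj: "\<And>h. h \<in> K \<Longrightarrow> (\<And>k. k \<in> K \<Longrightarrow> L2_inner k (A h) = 0) \<Longrightarrow> aeq h (\<lambda>_. 0)"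
  shows "\<exists>h\<in>K. \<forall>k\<in>K. L2_inner k (A h) = L2_inner k g"
proof -
  \<comment> \<open>\<open>R\<close> is the range of \<open>A\<close> up to weak equality.
    Membership by inner products makes it a subspace although \<open>A\<close> need not be linear
    pointwise.\<close>
  define R where "R = {b \<in> K. \<exists>h\<in>K. \<forall>k\<in>K. L2_inner k b = L2_inner k (A h)}"
  note sK = L2_subspace_sq_int[OF K]
  have zK: "(\<lambda>_. 0) \<in> K" and addK: "\<And>f g. f \<in> K \<Longrightarrow> g \<in> K \<Longrightarrow> (\<lambda>x. f x + g x) \<in> K"
    and scK: "\<And>f c. f \<in> K \<Longrightarrow> (\<lambda>x. c * f x) \<in> K"
    using K unfolding L2_subspace_def by blast+
  have AR: "A h \<in> R" if "h \<in> K" for h unfolding R_def using A that by blast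
  have R: "L2_subspace R"
    unfolding L2_subspace_def
  proof (intro conjI ballI allI)
    show "sq_int f" if "f \<in> R" for f using that sK unfolding R_def by blast
    have "L2_inner k (A (\<lambda>_. 0)) = 0" if "k \<in> K" for k
      using scale[OF that zK, of 0] by simp
    then have "\<forall>k\<in>K. L2_inner k (\<lambda>_. 0) = L2_inner k (A (\<lambda>_. 0))" by simp
    then show "(\<lambda>_. 0) \<in> R" unfolding R_def using zK by blast
  next
    fix f g assume "f \<in> R" "g \<in> R"
    then obtain h h' where h: "f \<in> K" "g \<in> K" "h \<in> K" "h' \<in> K"
      "\<forall>k\<in>K. L2_inner k f = L2_inner k (A h)" "\<forall>k\<in>K. L2_inner k g = L2_inner k (A h')"
      unfolding R_def by blast
    have "\<forall>k\<in>K. L2_inner k (\<lambda>x. f x + g x) = L2_inner k (A (\<lambda>x. h x + h' x))"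
      using h by (simp add: L2_inner_add_right sK add)
    then show "(\<lambda>x. f x + g x) \<in> R" unfolding R_def using h addK by blast
  next
    fix f c assume "f \<in> R"
    then obtain h where h: "f \<in> K" "h \<in> K" "\<forall>k\<in>K. L2_inner k f = L2_inner k (A h)"
      unfolding R_def by blast
    have "\<forall>k\<in>K. L2_inner k (\<lambda>x. c * f x) = L2_inner k (A (\<lambda>x. c * h x))"
      using h by (simp add: L2_inner_cmult_right scale)
    then show "(\<lambda>x. c * f x) \<in> R" unfolding R_def using h scK by blast
  qed
  have RK: "R \<subseteq> K" unfolding R_def by blast
  note dR = dim_at_most_mono[OF N RK]
  define r where "r = orth_proj R g"
  define p where "p = orth_proj K g"
  define s where "s = (\<lambda>x. p x - r x)"
  have r: "r \<in> R" "\<And>b. b \<in> R \<Longrightarrow> L2_inner b r = L2_inner b g"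
    unfolding r_def by (rule orth_proj[OF R dR g]; assumption)+
  have p: "p \<in> K" "\<And>b. b \<in> K \<Longrightarrow> L2_inner b p = L2_inner b g"
    unfolding p_def by (rule orth_proj[OF K N g]; assumption)+
  have rK: "r \<in> K" using r RK by blast
  have sinK: "s \<in> K" unfolding s_def by (rule L2_subspace_diff[OF K p(1) rK])
  \<comment> \<open>\<open>p\<close> and \<open>r\<close> represent \<open>g\<close> on
    \<open>K\<close> and on \<open>R\<close>, so their difference \<open>s\<close> is orthogonal to
    every \<open>A k\<close>; symmetry then moves \<open>A\<close> onto \<open>s\<close>.\<close>
  have "L2_inner k (A s) = 0" if k: "k \<in> K" for k
  proof -
    have "L2_inner (A k) s = 0"
      unfolding s_def using r(2)[OF AR[OF k]] p(2)[OF A[OF k]]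
      by (subst L2_inner_diff_right) (use sK A k p rK in auto)
    then have "L2_inner s (A k) = 0" using L2_inner_cnj[of s] by simp
    then show ?thesis using sym[OF k sinK] by simp
  qed
  then have "aeq s (\<lambda>_. 0)" by (rule inj[OF sinK])
  then have pr: "aeq p r" unfolding s_def aeq_def by simp
  obtain h where h: "h \<in> K" "\<forall>k\<in>K. L2_inner k r = L2_inner k (A h)"
    using r(1) unfolding R_def by blast
  have "L2_inner k (A h) = L2_inner k g" if "k \<in> K" for k
  proof -
    have "L2_inner k r = L2_inner k p"
      by (rule L2_inner_cong) (use that sK p rK pr in \<open>auto dest: sq_intD intro: aeq_sym\<close>)
    then show ?thesis using h p that by auto
  qed
  then show ?thesis using h(1) by blast
qed

text \<open>Bessel's inequality at the point \<open>x\<close>, integrated over \<open>x\<close>.\<close>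

lemma dim_at_most_if_pointwise_bounded:
  assumes K: "\<And>f. f \<in> K \<Longrightarrow> sq_int f \<and> aeq f (R f)"
    and lin: "\<And>(m::nat) c e x. (\<And>i. i < m \<Longrightarrow> e i \<in> K) \<Longrightarrow>
      R (\<lambda>x. \<Sum>i<m. c i * e i x) x = (\<Sum>i<m. c i * R (e i) x)"
    and bd: "\<And>f x. sq_int f \<Longrightarrow> cmod (R f x) \<le> a x * L2norm f"
    and a: "integrable lborel (\<lambda>x. (a x)\<^sup>2)"
    and meas: "\<And>f. f \<in> K \<Longrightarrow> R f \<in> borel_measurable borel"
  shows "\<exists>N. dim_at_most K N"
proof -
  have bound: "real m \<le> (LINT x|lborel. (a x)\<^sup>2)" if e: "\<forall>i<m. e i \<in> K" and on: "orthonormal m e" for m and e :: "nat \<Rightarrow> fn"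
  proof -
    have se: "\<And>i. i < m \<Longrightarrow> sq_int (e i)" using e K by blast
    have pt: "(\<Sum>i<m. (cmod (R (e i) x))\<^sup>2) \<le> (a x)\<^sup>2" for x
    proof -
      define S where "S = (\<Sum>i<m. (cmod (R (e i) x))\<^sup>2)"
      have S0: "0 \<le> S" unfolding S_def by (intro sum_nonneg) auto
      \<comment> \<open>Conjugated values as coefficients make \<open>R F x\<close> and the squared
        norm of \<open>F\<close> both equal to \<open>S\<close>, so that the bound on
        \<open>R\<close> reads \<open>S \<le> a x * sqrt S\<close>.\<close>
      define c where "c i = cnj (R (e i) x)" for i
      define F where "F = (\<lambda>y. \<Sum>i<m. c i * e i y)"
      have sF: "sq_int F" unfolding F_def by (rule sq_int_sum) (use se sq_int_cmult in auto)
      have RF: "R F x = complex_of_real S"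
      proof -
        have "R F x = (\<Sum>i<m. c i * R (e i) x)" unfolding F_def by (rule lin) (use e in blast)
        also have "\<dots> = complex_of_real S" unfolding c_def S_def of_real_sum
          by (intro sum.cong) (auto simp only: complex_norm_square mult.commute)
        finally show ?thesis .
      qed
      have "L2_inner F F = (\<Sum>i<m. L2_inner F (\<lambda>x. c i * e i x))"
        unfolding F_def[abs_def] by (subst L2_inner_sum_right)
          (use se sq_int_cmult sF in \<open>auto simp: F_def\<close>)
      also have "\<dots> = (\<Sum>i<m. c i * cnj (L2_inner (e i) F))"
        using L2_inner_cnj[of F] by (simp add: L2_inner_cmult_right)
      also have "\<dots> = (\<Sum>i<m. c i * cnj (c i))"
      proof (intro sum.cong refl)
        fix i assume "i \<in> {..<m}"
        then have i: "i < m" by simp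
        have "L2_inner (e i) F = (\<Sum>j<m. L2_inner (e i) (\<lambda>x. c j * e j x))"
          unfolding F_def by (subst L2_inner_sum_right) (use se sq_int_cmult i in auto)
        also have "\<dots> = (\<Sum>j<m. if j = i then c j else 0)"
          unfolding L2_inner_cmult_right using on i
          by (intro sum.cong) (auto simp: orthonormal_def)
        finally show "c i * cnj (L2_inner (e i) F) = c i * cnj (c i)" using i by simp
      qed
      also have "\<dots> = complex_of_real S"
        unfolding S_def of_real_sum c_def
        by (intro sum.cong) (auto simp only: complex_norm_square mult.commute complex_cnj_cnj)
      finally have nF: "(L2norm F)\<^sup>2 = S"
        unfolding L2_inner_self of_real_eq_iff .
      have "S \<le> a x * L2norm F"
        using bd[OF sF, of x] S0 unfolding RF by simp
      then have "S\<^sup>2 \<le> (a x * L2norm F)\<^sup>2" using S0 by (rule power_mono)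
      then have "S * S \<le> (a x)\<^sup>2 * S" by (simp add: power_mult_distrib nF power2_eq_square[of S])
      then have "S \<le> (a x)\<^sup>2" using S0
        by (cases "S = 0") (auto simp: mult_le_cancel_right)
      then show ?thesis unfolding S_def .
    qed
    have int: "integrable lborel (\<lambda>x. (cmod (R (e i) x))\<^sup>2)"
      and one: "(LINT x|lborel. (cmod (R (e i) x))\<^sup>2) = 1" if i: "i < m" for i
    proof -
      have ei: "e i \<in> K" using e i by blast
      note [measurable] = meas[OF ei] sq_intD(1)[OF se[OF i]]
      have ae: "AE x in lborel. (cmod (R (e i) x))\<^sup>2 = (cmod (e i x))\<^sup>2"
        using K[OF ei] unfolding aeq_def by (auto elim: AE_mp)
      show "integrable lborel (\<lambda>x. (cmod (R (e i) x))\<^sup>2)"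
        by (subst integrable_cong_AE[OF _ _ ae]) (use sq_intD(2)[OF se[OF i]] in auto)
      have "(LINT x|lborel. (cmod (R (e i) x))\<^sup>2) = (L2norm (e i))\<^sup>2"
        unfolding L2norm_square by (rule integral_cong_AE[OF _ _ ae]) auto
      also have "\<dots> = 1" using on i L2_inner_self[of "e i"] unfolding orthonormal_def
        by (metis of_real_eq_1_iff)
      finally show "(LINT x|lborel. (cmod (R (e i) x))\<^sup>2) = 1" .
    qed
    have "real m = (\<Sum>i<m. LINT x|lborel. (cmod (R (e i) x))\<^sup>2)" using one by simp
    also have "\<dots> = (LINT x|lborel. (\<Sum>i<m. (cmod (R (e i) x))\<^sup>2))"
      using int by (subst Bochner_Integration.integral_sum) auto
    also have "\<dots> \<le> (LINT x|lborel. (a x)\<^sup>2)"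
      by (rule integral_mono) (use int a pt in auto)
    finally show ?thesis .
  qed
  have "dim_at_most K (nat \<lceil>LINT x|lborel. (a x)\<^sup>2\<rceil>)"
    unfolding dim_at_most_def
  proof (intro allI impI)
    fix m e assume "\<forall>i<m. e i \<in> K" "orthonormal m e"
    from order_trans[OF bound[OF this] real_nat_ceiling_ge]
    show "m \<le> nat \<lceil>LINT x|lborel. (a x)\<^sup>2\<rceil>" by simp
  qed
  then show ?thesis ..
qed

section \<open>Radial integrals\<close>

text \<open>Layer-cake formula: \<open>T - G (norm x)\<close> is the integral of \<open>g\<close>
  over \<open>r \<ge> norm x\<close>, and exchanging the integrals leaves the volume
  \<open>4 / 3 * pi * r ^ 3\<close> of a ball.\<close>

lemma nn_integral_radial:
  fixes g G :: "real \<Rightarrow> real"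
  assumes [measurable]: "g \<in> borel_measurable borel"
    and der: "\<And>r. 0 \<le> r \<Longrightarrow> (G has_real_derivative g r) (at r)"
    and nonneg: "\<And>r. 0 \<le> r \<Longrightarrow> 0 \<le> g r"
    and lim: "(G \<longlongrightarrow> T) at_top"
  shows "(\<integral>\<^sup>+x. ennreal (T - G (norm (x::real^3))) \<partial>lborel)
    = (\<integral>\<^sup>+r. ennreal (g r * (4 / 3 * pi * r ^ 3)) * indicator {0..} r \<partial>lborel)"
proof -
  have "(\<integral>\<^sup>+x. ennreal (T - G (norm (x::real^3))) \<partial>lborel)
      = (\<integral>\<^sup>+x. (\<integral>\<^sup>+r. ennreal (g r) * indicator {norm (x::real^3)..} r \<partial>lborel) \<partial>lborel)"
    by (intro nn_integral_cong nn_integral_FTC_atLeast[symmetric])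
      (auto intro: der nonneg lim order_trans[OF norm_ge_zero])
  also have "\<dots> = (\<integral>\<^sup>+x. (\<integral>\<^sup>+r. ennreal (g r) * (if norm (x::real^3) \<le> r then 1 else 0) \<partial>lborel) \<partial>lborel)"
    by (intro nn_integral_cong) (auto simp: indicator_def)
  also have "\<dots> = (\<integral>\<^sup>+r. (\<integral>\<^sup>+x. ennreal (g r) * (if norm (x::real^3) \<le> r then 1 else 0) \<partial>lborel) \<partial>lborel)"
    by (subst lborel_pair.Fubini') auto
  also have "\<dots> = (\<integral>\<^sup>+r. ennreal (g r * (4 / 3 * pi * r ^ 3)) * indicator {0..} r \<partial>lborel)"
  proof (intro nn_integral_cong)
    fix r :: real
    have "(\<integral>\<^sup>+x. ennreal (g r) * (if norm (x::real^3) \<le> r then 1 else 0) \<partial>lborel)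
        = (\<integral>\<^sup>+x. ennreal (g r) * indicator (cball 0 r :: (real^3) set) x \<partial>lborel)"
      by (intro nn_integral_cong) (auto simp: indicator_def)
    also have "\<dots> = ennreal (g r) * emeasure lborel (cball 0 r :: (real^3) set)"
      by (simp add: nn_integral_cmult_indicator)
    also have "\<dots> = ennreal (g r * (4 / 3 * pi * r ^ 3)) * indicator {0..} r"
    proof (cases "0 \<le> r")
      case True
      then show ?thesis
        by (simp add: emeasure_cball unit_ball_vol_3 nonneg ennreal_mult'[symmetric] mult_ac)
    qed simp
    finally show "(\<integral>\<^sup>+x. ennreal (g r) * (if norm (x::real^3) \<le> r then 1 else 0) \<partial>lborel)
        = ennreal (g r * (4 / 3 * pi * r ^ 3)) * indicator {0..} r" .
  qed
  finally show ?thesis .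
qed

lemma integrable_one_plus_norm_powr:
  assumes p: "p > 3"
  shows "integrable lborel (\<lambda>x::real^3. (1 + norm x) powr (- p))"
proof (rule integrableI_nonneg)
  let ?c = "4 / 3 * pi * p"
  have "(\<integral>\<^sup>+x. ennreal ((1 + norm (x::real^3)) powr (- p)) \<partial>lborel)
      = (\<integral>\<^sup>+x. ennreal (0 - (\<lambda>r. - ((1 + r) powr (- p))) (norm (x::real^3))) \<partial>lborel)" by simp
  also have "\<dots> = (\<integral>\<^sup>+r. ennreal ((p * (1 + r) powr (- p - 1)) * (4 / 3 * pi * r ^ 3)) * indicator {0..} r \<partial>lborel)"
  proof (rule nn_integral_radial)
    show "((\<lambda>r. - ((1 + r) powr (- p))) \<longlongrightarrow> 0) at_top" using p by real_asymp
    show "((\<lambda>r. - ((1 + r) powr - p)) has_real_derivative p * (1 + r) powr (- p - 1)) (at r)"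
      if "0 \<le> r" for r
      using that by (auto intro!: derivative_eq_intros)
  qed (use p in auto)
  also have "\<dots> \<le> (\<integral>\<^sup>+r. ennreal (?c * (1 + r) powr (2 - p)) * indicator {0..} r \<partial>lborel)"
  proof (intro nn_integral_mono)
    fix r :: real
    have "(p * (1 + r) powr (- p - 1)) * (4 / 3 * pi * r ^ 3) \<le> ?c * (1 + r) powr (2 - p)" if r: "0 \<le> r"
    proof -
      have "r ^ 3 \<le> (1 + r) ^ 3" using r by (intro power_mono) auto
      then have "(1 + r) powr (- p - 1) * r ^ 3 \<le> (1 + r) powr (- p - 1) * (1 + r) powr 3"
        using r by (intro mult_left_mono) (auto simp: powr_numeral)
      also have "\<dots> = (1 + r) powr (2 - p)" by (simp add: powr_add[symmetric])
      finally have "?c * ((1 + r) powr (- p - 1) * r ^ 3) \<le> ?c * (1 + r) powr (2 - p)"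
        using p by (intro mult_left_mono) auto
      then show ?thesis by (simp add: mult_ac)
    qed
    then show "ennreal ((p * (1 + r) powr (- p - 1)) * (4 / 3 * pi * r ^ 3)) * indicator {0..} r
        \<le> ennreal (?c * (1 + r) powr (2 - p)) * indicator {0..} r"
      by (auto simp: indicator_def ennreal_leI)
  qed
  also have "\<dots> = ennreal (0 - (\<lambda>r. ?c / (3 - p) * (1 + r) powr (3 - p)) 0)"
  proof (rule nn_integral_FTC_atLeast)
    show "((\<lambda>r. ?c / (3 - p) * (1 + r) powr (3 - p)) \<longlongrightarrow> 0) at_top"
      using p by real_asymp
    show "((\<lambda>r. ?c / (3 - p) * (1 + r) powr (3 - p)) has_real_derivative ?c * (1 + x) powr (2 - p)) (at x)"
      if "0 \<le> x" for x
    proof -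
      have "((\<lambda>r. ?c / (3 - p) * (1 + r) powr (3 - p)) has_real_derivative
          ?c / (3 - p) * ((3 - p) * (1 + x) powr (3 - p - 1))) (at x)"
        using that p by (auto intro!: derivative_eq_intros)
      moreover have "?c / (3 - p) * ((3 - p) * (1 + x) powr (3 - p - 1)) = ?c * (1 + x) powr (2 - p)"
      proof -
        have "c / d * (d * X) = c * X" if "d \<noteq> 0" for c d X :: real using that by simp
        moreover have "3 - p - 1 = 2 - p" by simp
        ultimately show ?thesis using p by (simp only:)
      qed
      ultimately show ?thesis by (simp only:)
    qed
  qed (use p in auto)
  also have "\<dots> < \<infinity>" by simp
  finally show "(\<integral>\<^sup>+x. ennreal ((1 + norm (x::real^3)) powr (- p)) \<partial>lborel) < \<infinity>" .
qed auto

text \<open>This is the mass of the approximate identity produced by the regularised bilaplacian;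
  multiplied by 15 it becomes the \<open>8 * pi\<close> of the fundamental solution.\<close>

lemma integral_norm_powr_seven_halves:
  "integrable lborel (\<lambda>x::real^3. (1 + (norm x)\<^sup>2) powr (- 7 / 2))" (is ?int)
  "(LINT x|lborel. (1 + (norm (x::real^3))\<^sup>2) powr (- 7 / 2)) = 8 * pi / 15" (is ?val)
proof -
  \<comment> \<open>With \<open>t = r / sqrt (1 + r^2)\<close> the layer-cake integrand becomes a
    multiple of \<open>t^4 - t^6\<close>, with primitive \<open>t^5 / 5 - t^7 / 7\<close>;
    \<open>t\<close> tends to 1 at infinity.\<close>
  let ?F = "\<lambda>r::real. 28 * pi / 3 * (r ^ 5 * (1 + r\<^sup>2) powr (- 5 / 2) / 5 - r ^ 7 * (1 + r\<^sup>2) powr (- 7 / 2) / 7)"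
  have W: "0 < 1 + r\<^sup>2" for r :: real by (simp add: add_pos_nonneg)
  have der: "(?F has_real_derivative 7 * r * (1 + r\<^sup>2) powr (- 9 / 2) * (4 / 3 * pi * r ^ 3)) (at r)" for r
  proof -
    define p where "p = (1 + r\<^sup>2) powr (- 9 / 2)"
    have e: "(1 + r\<^sup>2) powr (- 5 / 2) = p * (1 + r\<^sup>2)\<^sup>2" "(1 + r\<^sup>2) powr (- 7 / 2) = p * (1 + r\<^sup>2)"
      using powr_add[of "1 + r\<^sup>2" "- 9 / 2" 2] powr_add[of "1 + r\<^sup>2" "- 9 / 2" 1] W[of r]
      unfolding p_def by (simp_all add: powr_numeral)
    have "(?F has_real_derivative 28 * pi / 3 *
        ((5 * r ^ 4 * (1 + r\<^sup>2) powr (- 5 / 2) + r ^ 5 * ((- 5 / 2) * (1 + r\<^sup>2) powr (- 7 / 2) * (2 * r))) / 5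
        - (7 * r ^ 6 * (1 + r\<^sup>2) powr (- 7 / 2) + r ^ 7 * ((- 7 / 2) * (1 + r\<^sup>2) powr (- 9 / 2) * (2 * r))) / 7)) (at r)"
      using W[of r] by (auto intro!: derivative_eq_intros simp: field_simps)
    moreover have "28 * pi / 3 *
        ((5 * r ^ 4 * (1 + r\<^sup>2) powr (- 5 / 2) + r ^ 5 * ((- 5 / 2) * (1 + r\<^sup>2) powr (- 7 / 2) * (2 * r))) / 5
        - (7 * r ^ 6 * (1 + r\<^sup>2) powr (- 7 / 2) + r ^ 7 * ((- 7 / 2) * (1 + r\<^sup>2) powr (- 9 / 2) * (2 * r))) / 7)
      = 7 * r * (1 + r\<^sup>2) powr (- 9 / 2) * (4 / 3 * pi * r ^ 3)"
      unfolding e p_def[symmetric] by (simp add: field_simps) algebra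
    ultimately show ?thesis by (simp only:)
  qed
  have "(\<integral>\<^sup>+x. ennreal ((1 + (norm (x::real^3))\<^sup>2) powr (- 7 / 2)) \<partial>lborel)
      = (\<integral>\<^sup>+x. ennreal (0 - (\<lambda>r. - ((1 + r\<^sup>2) powr (- 7 / 2))) (norm (x::real^3))) \<partial>lborel)" by simp
  also have "\<dots> = (\<integral>\<^sup>+r. ennreal (7 * r * (1 + r\<^sup>2) powr (- 9 / 2) * (4 / 3 * pi * r ^ 3)) * indicator {0..} r \<partial>lborel)"
  proof (rule nn_integral_radial)
    show "((\<lambda>r::real. - ((1 + r\<^sup>2) powr (- 7 / 2))) \<longlongrightarrow> 0) at_top" by real_asymp
    show "((\<lambda>r. - ((1 + r\<^sup>2) powr (- 7 / 2))) has_real_derivative 7 * r * (1 + r\<^sup>2) powr (- 9 / 2)) (at r)" for r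
      using W[of r] by (auto intro!: derivative_eq_intros)
  qed auto
  also have "\<dots> = ennreal (28 * pi / 3 * (1 / 5 - 1 / 7) - ?F 0)"
  proof (rule nn_integral_FTC_atLeast)
    show "(?F \<longlongrightarrow> 28 * pi / 3 * (1 / 5 - 1 / 7)) at_top"
    proof (intro tendsto_intros)
      show "((\<lambda>r::real. r ^ 5 * (1 + r\<^sup>2) powr (- 5 / 2)) \<longlongrightarrow> 1) at_top" by real_asymp
      show "((\<lambda>r::real. r ^ 7 * (1 + r\<^sup>2) powr (- 7 / 2)) \<longlongrightarrow> 1) at_top" by real_asymp
    qed auto
  qed (use der in auto)
  also have "28 * pi / 3 * (1 / 5 - 1 / 7) - ?F 0 = 8 * pi / 15" by simp
  finally have nn: "(\<integral>\<^sup>+x. ennreal ((1 + (norm (x::real^3))\<^sup>2) powr (- 7 / 2)) \<partial>lborel) = ennreal (8 * pi / 15)" .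
  show ?int by (rule integrableI_nonneg) (use nn in auto)
  show ?val by (subst integral_eq_nn_integral) (use nn in auto)
qed

section \<open>Integration by parts and the fundamental solution\<close>

lemma integral_affine:
  fixes f :: "real^3 \<Rightarrow> real"
  assumes [measurable]: "f \<in> borel_measurable borel" and c: "c > 0"
  shows "(LINT x|lborel. f x) = c ^ 3 * (LINT z|lborel. f (t + c *\<^sub>R z))"
  using c by (subst lborel_affine[of c t])
    (simp_all add: integral_density integral_distr)

lemma integrable_continuous_bounded_support:
  fixes u :: "real^3 \<Rightarrow> real"
  assumes "continuous_on UNIV u" "\<And>x. norm x > B \<Longrightarrow> u x = 0"
  shows "integrable lborel u"
proof -
  have "integrable lborel (\<lambda>x. indicator (cball 0 B) x *\<^sub>R u x)"
    by (rule borel_integrable_compact) (auto intro: continuous_on_subset[OF assms(1)])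
  also have "(\<lambda>x. indicator (cball 0 B) x *\<^sub>R u x) = u"
    using assms(2) by (auto simp: indicator_def fun_eq_iff not_le)
  finally show ?thesis .
qed

text \<open>One direction at a time, because \<open>test_fun\<close> supplies derivatives along the
  axes only, together with their continuity.\<close>

definition C1_dir :: "3 \<Rightarrow> (real^3 \<Rightarrow> real) \<Rightarrow> (real^3 \<Rightarrow> real) \<Rightarrow> bool" where
  "C1_dir i u u' \<longleftrightarrow> continuous_on UNIV u \<and> continuous_on UNIV u' \<and>
     (\<forall>x. ((\<lambda>t. u (x + t *\<^sub>R axis i 1)) has_real_derivative u' x) (at 0))"

lemma C1_dir_shift:
  assumes "C1_dir i u u'"
  shows "((\<lambda>t. u (x + t *\<^sub>R axis i 1)) has_real_derivative u' (x + s *\<^sub>R axis i 1)) (at s)"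
proof -
  have "((\<lambda>t. u ((x + s *\<^sub>R axis i 1) + t *\<^sub>R axis i 1)) has_real_derivative u' (x + s *\<^sub>R axis i 1)) (at 0)"
    using assms unfolding C1_dir_def by blast
  then have "((\<lambda>t. u (x + (t + s) *\<^sub>R axis i 1)) has_real_derivative u' (x + s *\<^sub>R axis i 1)) (at 0)"
    by (simp add: scaleR_add_left add_ac)
  then show ?thesis using DERIV_shift[of "\<lambda>t. u (x + t *\<^sub>R axis i 1)" _ 0 s] by simp
qed

lemma C1_dir_mult:
  assumes "C1_dir i u u'" "C1_dir i w w'"
  shows "C1_dir i (\<lambda>x. u x * w x) (\<lambda>x. u' x * w x + u x * w' x)"
  unfolding C1_dir_def
proof (intro conjI allI)
  fix x
  show "((\<lambda>t. u (x + t *\<^sub>R axis i 1) * w (x + t *\<^sub>R axis i 1)) has_real_derivative u' x * w x + u x * w' x) (at 0)"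
    using DERIV_mult[OF C1_dir_shift[OF assms(1), of x 0] C1_dir_shift[OF assms(2), of x 0]]
    by (simp add: algebra_simps)
qed (use assms in \<open>auto simp: C1_dir_def intro!: continuous_intros\<close>)

text \<open>By translation invariance the difference quotients of \<open>u\<close> integrate to zero.\<close>

lemma integral_C1_dir_zero:
  assumes u: "C1_dir i u u'" and supp: "\<And>x. norm x > B \<Longrightarrow> u x = 0"
  shows "(LINT x|lborel. u' x) = 0"
proof -
  let ?e = "axis i 1 :: real^3"
  define h where "h n = 1 / real (Suc n)" for n
  have h: "0 < h n" "h n \<le> 1" for n unfolding h_def by auto
  have h0: "h \<longlonglongrightarrow> 0" unfolding h_def by (rule lim_1_over_n[THEN LIMSEQ_Suc])
  have ne: "norm ?e = 1" by simp
  have cu: "continuous_on UNIV u" "continuous_on UNIV u'" using u unfolding C1_dir_def by auto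
  note [measurable] = borel_measurable_continuous_onI[OF cu(1)] borel_measurable_continuous_onI[OF cu(2)]
  \<comment> \<open>Since \<open>h n \<le> 1\<close>, the difference quotients vanish for
    \<open>norm x > B + 1\<close>, and on the remaining ball the mean value point is at most one
    further unit away.\<close>
  have "compact (u' ` cball 0 (B + 2))"
    by (rule compact_continuous_image[OF continuous_on_subset[OF cu(2)]]) auto
  then have "bounded (u' ` cball 0 (B + 2))" by (rule compact_imp_bounded)
  then obtain M where "\<forall>y\<in>u' ` cball 0 (B + 2). norm y \<le> M" unfolding bounded_iff by blast
  then have M: "\<bar>u' x\<bar> \<le> M" if "norm x \<le> B + 2" for x using that by auto
  define s where "s n x = (u (h n *\<^sub>R ?e + x) - u x) / h n" for n x
  have iu: "integrable lborel u"
    by (rule integrable_continuous_bounded_support[OF cu(1) supp])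
  have s0: "(LINT x|lborel. s n x) = 0" for n
  proof -
    have "(LINT x|lborel. u x) = (LINT x|distr lborel borel ((+) (h n *\<^sub>R ?e)). u x)"
      by (subst lborel_distr_plus) simp
    also have "\<dots> = (LINT x|lborel. u (h n *\<^sub>R ?e + x))" by (subst integral_distr) auto
    finally have *: "(LINT x|lborel. u (h n *\<^sub>R ?e + x)) = (LINT x|lborel. u x)" by simp
    have "integrable (distr lborel borel ((+) (h n *\<^sub>R ?e))) u"
      by (subst lborel_distr_plus) (rule iu)
    then have "integrable lborel (\<lambda>x. u (h n *\<^sub>R ?e + x))"
      by (subst (asm) integrable_distr_eq) auto
    then show ?thesis unfolding s_def using iu * by simp
  qed
  have "(\<lambda>n. LINT x|lborel. s n x) \<longlonglongrightarrow> (LINT x|lborel. u' x)"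
  proof (rule integral_dominated_convergence)
    show "integrable lborel (\<lambda>x::real^3. indicator (cball 0 (B + 1)) x * M)"
      using borel_integrable_compact[of "cball 0 (B + 1)" "\<lambda>_::real^3. M"] by simp
    show "AE x in lborel. (\<lambda>n. s n x) \<longlonglongrightarrow> u' x"
    proof (intro AE_I2)
      fix x
      have "((\<lambda>t. u (x + t *\<^sub>R ?e)) has_real_derivative u' x) (at 0)"
        using u unfolding C1_dir_def by blast
      then have "((\<lambda>t. (u (x + t *\<^sub>R ?e) - u x) / t) \<longlongrightarrow> u' x) (at 0)"
        unfolding DERIV_def by simp
      moreover have "filterlim h (at 0) sequentially"
        using h0 h by (auto simp: filterlim_at less_imp_neq[symmetric] intro!: always_eventually)
      ultimately have "(\<lambda>n. (u (x + h n *\<^sub>R ?e) - u x) / h n) \<longlonglongrightarrow> u' x"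
        by (rule filterlim_compose)
      then show "(\<lambda>n. s n x) \<longlonglongrightarrow> u' x" unfolding s_def by (simp add: add.commute)
    qed
    show "AE x in lborel. norm (s n x) \<le> indicator (cball 0 (B + 1)) x * M" for n
    proof (intro AE_I2)
      fix x
      show "norm (s n x) \<le> indicator (cball 0 (B + 1)) x * M"
      proof (cases "norm x \<le> B + 1")
        case True
        obtain z where z: "0 < z" "z < h n"
          "u (x + h n *\<^sub>R ?e) - u (x + 0 *\<^sub>R ?e) = (h n - 0) * u' (x + z *\<^sub>R ?e)"
          using MVT2[of 0 "h n" "\<lambda>t. u (x + t *\<^sub>R ?e)" "\<lambda>t. u' (x + t *\<^sub>R ?e)"]
            C1_dir_shift[OF u] h(1)[of n] by blast
        have "s n x = u' (x + z *\<^sub>R ?e)"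
          unfolding s_def using z(3) h(1)[of n] by (simp add: add.commute)
        moreover have "norm (x + z *\<^sub>R ?e) \<le> B + 2"
          using norm_triangle_ineq[of x "z *\<^sub>R ?e"] z h(2)[of n] True by simp
        ultimately show ?thesis using M True by simp
      next
        case False
        have "norm x - h n \<le> norm (h n *\<^sub>R ?e + x)"
          using norm_triangle_ineq4[of "h n *\<^sub>R ?e + x" "h n *\<^sub>R ?e"] h(1)[of n] by simp
        then show ?thesis using False supp h(2)[of n] unfolding s_def by simp
      qed
    qed
  qed (auto simp: s_def[abs_def])
  then show ?thesis unfolding s0 using LIMSEQ_unique[OF tendsto_const] by metis
qed

lemma integral_by_parts_dir:
  assumes u: "C1_dir i u u'" and w: "C1_dir i w w'" and supp: "\<And>x. norm x > B \<Longrightarrow> w x = 0"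
    and supp': "\<And>x. norm x > B \<Longrightarrow> w' x = 0"
  shows "(LINT x|lborel. u x * w' x) = - (LINT x|lborel. u' x * w x)"
proof -
  have c: "continuous_on UNIV u" "continuous_on UNIV u'" "continuous_on UNIV w" "continuous_on UNIV w'"
    using u w unfolding C1_dir_def by auto
  have "integrable lborel (\<lambda>x. u' x * w x)" "integrable lborel (\<lambda>x. u x * w' x)"
    by (rule integrable_continuous_bounded_support[of _ B]; use c supp supp' in \<open>auto intro!: continuous_intros\<close>)+
  moreover have "(LINT x|lborel. u' x * w x + u x * w' x) = 0"
    by (rule integral_C1_dir_zero[OF C1_dir_mult[OF u w], of B]) (simp add: supp)
  ultimately show ?thesis by simp
qed

lemma vec3_norm_square: "(norm (z::real^3))\<^sup>2 = (\<Sum>i\<in>UNIV. (z $ i)\<^sup>2)"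
  unfolding power2_norm_eq_inner by (simp add: inner_vec_def power2_eq_square)

lemma norm_square_add_axis:
  "(norm ((z::real^3) + t *\<^sub>R axis i 1))\<^sup>2 = (norm z)\<^sup>2 + 2 * t * z $ i + t\<^sup>2"
  unfolding power2_norm_eq_inner
  by (simp add: inner_simps inner_axis inner_axis' power2_eq_square inner_commute[of _ "axis i 1"])
    (simp add: axis_def algebra_simps)

section \<open>The regularised distance \<open>W powr (1 / 2)\<close> and the Laplacian of powers of
  \<open>W\<close>\<close>

context
  fixes y :: "real^3" and \<epsilon> :: real and W :: "real^3 \<Rightarrow> real"
  assumes eps: "0 < \<epsilon>"
  defines "W \<equiv> \<lambda>x. (norm (x - y))\<^sup>2 + \<epsilon>\<^sup>2"
begin

lemma W_pos: "0 < W x"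
  unfolding W_def using eps by (simp add: add_nonneg_pos)

lemma W_line: "W (x + t *\<^sub>R axis i 1) = W x + 2 * t * (x - y) $ i + t\<^sup>2"
  unfolding W_def using norm_square_add_axis[of "x - y" t i] by (simp add: algebra_simps)

lemma W_cont: "continuous_on UNIV W"
  unfolding W_def by (intro continuous_intros)

lemma C1_dir_W_powr:
  "C1_dir i (\<lambda>x. W x powr b) (\<lambda>x. 2 * b * ((x - y) $ i * W x powr (b - 1)))"
  unfolding C1_dir_def
proof (intro conjI allI)
  fix x
  show "((\<lambda>t. W (x + t *\<^sub>R axis i 1) powr b) has_real_derivative 2 * b * ((x - y) $ i * W x powr (b - 1))) (at 0)"
    unfolding W_line using W_pos[of x] by (auto intro!: derivative_eq_intros)
qed (use W_cont W_pos less_imp_neq[OF W_pos] in \<open>auto intro!: continuous_intros\<close>)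

lemma C1_dir_W_powr2:
  "C1_dir i (\<lambda>x. (x - y) $ i * W x powr c)
     (\<lambda>x. W x powr c + 2 * c * (((x - y) $ i)\<^sup>2 * W x powr (c - 1)))"
  unfolding C1_dir_def
proof (intro conjI allI)
  fix x
  have "(x + t *\<^sub>R axis i 1 - y) $ i = (x - y) $ i + t" for t
    by (simp add: axis_def)
  then show "((\<lambda>t. (x + t *\<^sub>R axis i 1 - y) $ i * W (x + t *\<^sub>R axis i 1) powr c) has_real_derivative
      W x powr c + 2 * c * (((x - y) $ i)\<^sup>2 * W x powr (c - 1))) (at 0)"
    unfolding W_line using W_pos[of x]
    by (auto intro!: derivative_eq_intros simp: power2_eq_square)
qed (use W_cont W_pos less_imp_neq[OF W_pos] in \<open>auto intro!: continuous_intros\<close>)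

lemma integral_W_second_dir:
  assumes "C1_dir i u u'" "C1_dir i u' u''"
    and "\<And>x. norm x > B \<Longrightarrow> u x = 0" "\<And>x. norm x > B \<Longrightarrow> u' x = 0" "\<And>x. norm x > B \<Longrightarrow> u'' x = 0"
  shows "(LINT x|lborel. W x powr b * u'' x) =
    (LINT x|lborel. 2 * b * (W x powr (b - 1) + 2 * (b - 1) * (((x - y) $ i)\<^sup>2 * W x powr (b - 2))) * u x)"
proof -
  have "(LINT x|lborel. W x powr b * u'' x)
      = - (LINT x|lborel. 2 * b * ((x - y) $ i * W x powr (b - 1)) * u' x)"
    by (rule integral_by_parts_dir[OF C1_dir_W_powr assms(2) assms(4,5)])
  also have "\<dots> = - (2 * b * (LINT x|lborel. ((x - y) $ i * W x powr (b - 1)) * u' x))"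
    by (simp only: mult.assoc integral_mult_right_zero)
  also have "(LINT x|lborel. ((x - y) $ i * W x powr (b - 1)) * u' x)
      = - (LINT x|lborel. (W x powr (b - 1) + 2 * (b - 1) * (((x - y) $ i)\<^sup>2 * W x powr (b - 1 - 1))) * u x)"
    by (rule integral_by_parts_dir[OF C1_dir_W_powr2 assms(1) assms(3,4)])
  finally show ?thesis by (simp add: mult.assoc)
qed

text \<open>Summing the second derivatives gives
  \<open>2b (3 W^(b-1) + 2 (b-1) |z|^2 W^(b-2))\<close> with \<open>z = x - y\<close>. Replacing
  \<open>|z|^2\<close> by \<open>W - \<epsilon>\<^sup>2\<close> turns the 3 of the dimension into
  \<open>2b + 1\<close>, which vanishes at \<open>b = -1/2\<close>.\<close>

lemma integral_W_laplacian:
  assumes C: "\<And>i. C1_dir i u (u' i)" "\<And>i. C1_dir i (u' i) (u'' i)"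
    and supp: "\<And>x. norm x > B \<Longrightarrow> u x = 0" "\<And>x i. norm x > B \<Longrightarrow> u' i x = 0"
      "\<And>x i. norm x > B \<Longrightarrow> u'' i x = 0"
  shows "(\<Sum>i\<in>UNIV. LINT x|lborel. W x powr b * u'' i x) =
    2 * b * (2 * b + 1) * (LINT x|lborel. W x powr (b - 1) * u x)
    - 4 * b * (b - 1) * \<epsilon>\<^sup>2 * (LINT x|lborel. W x powr (b - 2) * u x)"
proof -
  have cu: "continuous_on UNIV u" using C(1) unfolding C1_dir_def by blast
  have int: "integrable lborel (\<lambda>x. W x powr c * u x)" for c
    by (rule integrable_continuous_bounded_support[of _ B])
      (use cu W_cont W_pos less_imp_neq[OF W_pos] supp in \<open>auto intro!: continuous_intros\<close>)
  let ?f = "\<lambda>i x. 2 * b * (W x powr (b - 1) + 2 * (b - 1) * (((x - y) $ i)\<^sup>2 * W x powr (b - 2))) * u x"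
  have intf: "integrable lborel (?f i)" for i
    by (rule integrable_continuous_bounded_support[of _ B])
      (use cu W_cont W_pos less_imp_neq[OF W_pos] supp in \<open>auto intro!: continuous_intros\<close>)
  have "(\<Sum>i\<in>UNIV. LINT x|lborel. W x powr b * u'' i x) = (\<Sum>i\<in>UNIV. LINT x|lborel. ?f i x)"
    by (intro sum.cong refl integral_W_second_dir[OF C supp])
  also have "\<dots> = (LINT x|lborel. (\<Sum>i\<in>UNIV. ?f i x))"
    by (subst Bochner_Integration.integral_sum) (use intf in auto)
  also have "\<dots> = (LINT x|lborel. 2 * b * (2 * b + 1) * (W x powr (b - 1) * u x)
      - 4 * b * (b - 1) * \<epsilon>\<^sup>2 * (W x powr (b - 2) * u x))"
  proof (intro Bochner_Integration.integral_cong refl)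
    fix x
    define p where "p = W x powr (b - 2)"
    have e: "W x powr (b - 1) = p * W x"
      using powr_add[of "W x" "b - 2" 1] W_pos[of x] unfolding p_def by simp
    have "(\<Sum>i\<in>UNIV. ?f i x) = 2 * b * (3 * (p * W x) + 2 * (b - 1) * ((\<Sum>i\<in>UNIV. ((x - y) $ i)\<^sup>2) * p)) * u x"
      unfolding e p_def[symmetric]
      by (simp add: sum_distrib_left sum_distrib_right sum.distrib sum_subtractf algebra_simps)
    also have "(\<Sum>i\<in>UNIV. ((x - y) $ i)\<^sup>2) = W x - \<epsilon>\<^sup>2"
      unfolding W_def using vec3_norm_square[of "x - y"] by simp
    finally show "(\<Sum>i\<in>UNIV. ?f i x) = 2 * b * (2 * b + 1) * (W x powr (b - 1) * u x)
      - 4 * b * (b - 1) * \<epsilon>\<^sup>2 * (W x powr (b - 2) * u x)"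
      unfolding e p_def[symmetric] by (simp add: algebra_simps)
  qed
  also have "\<dots> = 2 * b * (2 * b + 1) * (LINT x|lborel. W x powr (b - 1) * u x)
    - 4 * b * (b - 1) * \<epsilon>\<^sup>2 * (LINT x|lborel. W x powr (b - 2) * u x)"
    using int[of "b - 1"] int[of "b - 2"] by simp
  finally show ?thesis .
qed

end

section \<open>Test functions: common support and the bilaplacian as a sum of iterated axis
  derivatives\<close>

lemma test_fun_C1_dir:
  assumes "test_fun \<psi>"
  shows "C1_dir i (iter_pd js \<psi>) (iter_pd (i # js) \<psi>)"
  unfolding C1_dir_def
proof (intro conjI allI)
  fix x
  have "(\<lambda>t. iter_pd js \<psi> (x + t *\<^sub>R axis i 1)) differentiable at 0"
    using assms unfolding test_fun_def by blast
  then show "((\<lambda>t. iter_pd js \<psi> (x + t *\<^sub>R axis i 1)) has_real_derivative iter_pd (i # js) \<psi> x) (at 0)"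
    by (simp add: iter_pd_def pd_def DERIV_deriv_iff_real_differentiable)
qed (use assms in \<open>auto simp: test_fun_def\<close>)

text \<open>The set where \<open>norm x > B\<close> is open, so a function vanishing there has
  vanishing axis derivatives; by induction over the list one radius serves all derivatives.\<close>

lemma test_fun_support:
  assumes "test_fun \<psi>"
  shows "\<exists>B. \<forall>js x. norm x > B \<longrightarrow> iter_pd js \<psi> x = 0"
proof -
  obtain K where K: "compact K" "\<And>x. x \<notin> K \<Longrightarrow> \<psi> x = 0"
    using assms unfolding test_fun_def by blast
  then obtain B where B: "\<And>x. x \<in> K \<Longrightarrow> norm x \<le> B"
    using compact_imp_bounded[of K] by (auto simp: bounded_iff)
  have "norm x > B \<Longrightarrow> iter_pd js \<psi> x = 0" for js x
  proof (induction js arbitrary: x)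
    case Nil
    then show ?case using K(2)[of x] B[of x] by (auto simp: iter_pd_def)
  next
    case (Cons i js)
    let ?l = "\<lambda>t. x + t *\<^sub>R axis i (1::real)"
    have "((\<lambda>t. norm (?l t)) \<longlongrightarrow> norm (?l 0)) (at 0)" by (intro tendsto_intros)
    then have "\<forall>\<^sub>F t in at 0. norm (?l t) > B"
      using Cons.prems by (auto dest: order_tendstoD(1))
    then have "\<forall>\<^sub>F t in at 0. iter_pd js \<psi> (?l t) = 0"
      by eventually_elim (use Cons.IH in blast)
    then have ev: "\<forall>\<^sub>F t in nhds 0. iter_pd js \<psi> (?l t) = 0"
      using Cons.IH[of x] Cons.prems by (simp add: eventually_nhds_conv_at)
    have "((\<lambda>t. iter_pd js \<psi> (?l t)) has_real_derivative iter_pd (i # js) \<psi> x) (at 0)"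
      using test_fun_C1_dir[OF assms] unfolding C1_dir_def by blast
    then have "((\<lambda>t. 0) has_real_derivative iter_pd (i # js) \<psi> x) (at (0::real))"
      using DERIV_cong_ev[OF refl ev refl] by blast
    then show ?case using DERIV_unique[OF _ DERIV_const] by blast
  qed
  then show ?thesis by blast
qed

lemma lap_lap_eq:
  assumes "test_fun \<psi>"
  shows "lap (lap \<psi>) = (\<lambda>x. \<Sum>i\<in>UNIV. \<Sum>j\<in>UNIV. iter_pd [i, i, j, j] \<psi> x)"
proof -
  have pd: "pd i (\<lambda>x. \<Sum>j\<in>UNIV. iter_pd (js j) \<psi> x) = (\<lambda>x. \<Sum>j\<in>UNIV. iter_pd (i # js j) \<psi> x)"
    for i and js :: "3 \<Rightarrow> 3 list"
  proof
    fix x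
    have "((\<lambda>t. \<Sum>j\<in>UNIV. iter_pd (js j) \<psi> (x + t *\<^sub>R axis i 1)) has_real_derivative
        (\<Sum>j\<in>UNIV. iter_pd (i # js j) \<psi> x)) (at 0)"
      by (rule DERIV_sum) (use test_fun_C1_dir[OF assms] in \<open>auto simp: C1_dir_def\<close>)
    then show "pd i (\<lambda>x. \<Sum>j\<in>UNIV. iter_pd (js j) \<psi> x) x = (\<Sum>j\<in>UNIV. iter_pd (i # js j) \<psi> x)"
      unfolding pd_def by (rule DERIV_imp_deriv)
  qed
  have "lap \<psi> = (\<lambda>x. \<Sum>j\<in>UNIV. iter_pd [j, j] \<psi> x)"
    unfolding lap_def iter_pd_def by simp
  then show ?thesis unfolding lap_def[of "lap \<psi>"] by (simp only: pd)
qed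

text \<open>The vanishing integral is what later removes the additive constant from the
  distributional equation.\<close>

lemma test_fun_lap_lap:
  assumes "test_fun \<psi>"
  shows "continuous_on UNIV (lap (lap \<psi>))" "\<exists>B. \<forall>x. norm x > B \<longrightarrow> lap (lap \<psi>) x = 0"
    and "(LINT x|lborel. lap (lap \<psi>) x) = 0"
proof -
  obtain B where B: "\<And>js x. norm x > B \<Longrightarrow> iter_pd js \<psi> x = 0" using test_fun_support[OF assms] by blast
  have c: "continuous_on UNIV (iter_pd js \<psi>)" for js using assms unfolding test_fun_def by blast
  show "continuous_on UNIV (lap (lap \<psi>))" unfolding lap_lap_eq[OF assms] by (intro continuous_intros c)
  show "\<exists>B. \<forall>x. norm x > B \<longrightarrow> lap (lap \<psi>) x = 0" 
    unfolding lap_lap_eq[OF assms] by (intro exI[of _ B]) (simp add: B)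
  have "(LINT x|lborel. iter_pd [i, i, j, j] \<psi> x) = 0" for i j
    by (rule integral_C1_dir_zero[OF test_fun_C1_dir[OF assms] B])
  moreover have "integrable lborel (iter_pd js \<psi>)" for js
    by (rule integrable_continuous_bounded_support[OF c B])
  ultimately show "(LINT x|lborel. lap (lap \<psi>) x) = 0"
    unfolding lap_lap_eq[OF assms] by (simp add: Bochner_Integration.integral_sum)
qed

text \<open>The Laplacian formula is applied twice, starting from \<open>W powr (1 / 2)\<close>. The
  multiples of \<open>W powr (-5 / 2)\<close> cancel and only
  \<open>-15 \<epsilon>^4 W powr (-7 / 2)\<close> is left. Under \<open>x = y + \<epsilon> z\<close>
  the factor \<open>\<epsilon>^4\<close>, the Jacobian \<open>\<epsilon>^3\<close> and the
  \<open>\<epsilon>^(-7)\<close> from \<open>W\<close> balance.\<close>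

lemma integral_regularised_bilaplacian:
  assumes \<psi>: "test_fun \<psi>" and eps: "0 < \<epsilon>"
  shows "(LINT x|lborel. ((norm (x - y))\<^sup>2 + \<epsilon>\<^sup>2) powr (1 / 2) * lap (lap \<psi>) x)
    = - 15 * (LINT z|lborel. (1 + (norm z)\<^sup>2) powr (- 7 / 2) * \<psi> (y + \<epsilon> *\<^sub>R z))"
proof -
  define W where "W = (\<lambda>x. (norm (x - y))\<^sup>2 + \<epsilon>\<^sup>2)"
  define I where "I b js = (LINT x|lborel. W x powr b * iter_pd js \<psi> x)" for b js
  obtain B where B: "\<And>js x. norm x > B \<Longrightarrow> iter_pd js \<psi> x = 0" using test_fun_support[OF \<psi>] by blast
  have c: "continuous_on UNIV (iter_pd js \<psi>)" for js using \<psi> unfolding test_fun_def by blast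
  have Wp: "0 < W x" for x unfolding W_def using eps by (simp add: add_nonneg_pos)
  have cW: "continuous_on UNIV W" unfolding W_def by (intro continuous_intros)
  have int: "integrable lborel (\<lambda>x. W x powr b * iter_pd js \<psi> x)" for b js
    by (rule integrable_continuous_bounded_support[of _ B])
      (use c cW less_imp_neq[OF Wp] B in \<open>auto intro!: continuous_intros\<close>)
  have step: "(\<Sum>i\<in>UNIV. I b (i # i # js)) = 2 * b * (2 * b + 1) * I (b - 1) js
      - 4 * b * (b - 1) * \<epsilon>\<^sup>2 * I (b - 2) js" for b js
    unfolding I_def W_def
    by (rule integral_W_laplacian[OF eps test_fun_C1_dir[OF \<psi>] test_fun_C1_dir[OF \<psi>] B B B])
  have s1: "(\<Sum>i\<in>UNIV. I (1/2) (i # i # js)) = 2 * I (-1/2) js + \<epsilon>\<^sup>2 * I (-3/2) js" for js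
    using step[of "1/2" js] by simp
  have s2: "(\<Sum>i\<in>UNIV. I (-1/2) (i # i # js)) = - 3 * \<epsilon>\<^sup>2 * I (-5/2) js" for js
    using step[of "-1/2" js] by simp
  have s3: "(\<Sum>i\<in>UNIV. I (-3/2) (i # i # js)) = 6 * I (-5/2) js - 15 * \<epsilon>\<^sup>2 * I (-7/2) js" for js
    using step[of "-3/2" js] by simp
  have "(LINT x|lborel. W x powr (1/2) * lap (lap \<psi>) x) = (\<Sum>i\<in>UNIV. \<Sum>j\<in>UNIV. I (1/2) [i, i, j, j])"
    unfolding lap_lap_eq[OF \<psi>] I_def using int
    by (simp add: sum_distrib_left Bochner_Integration.integral_sum)
  \<comment> \<open>The Laplacian formula peels off the outer pair \<open>i, i\<close>, so the sum
    over \<open>i\<close> has to be innermost.\<close>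
  also have "\<dots> = (\<Sum>j\<in>UNIV. \<Sum>i\<in>UNIV. I (1/2) [i, i, j, j])" by (rule sum.swap)
  also have "\<dots> = 2 * (\<Sum>j\<in>UNIV. I (-1/2) [j, j]) + \<epsilon>\<^sup>2 * (\<Sum>j\<in>UNIV. I (-3/2) [j, j])"
    unfolding s1 by (simp add: sum.distrib sum_distrib_left)
  also have "\<dots> = - 15 * (\<epsilon> ^ 4 * I (-7/2) [])"
    unfolding s2 s3 by (simp add: algebra_simps)
  also have "\<epsilon> ^ 4 * I (-7/2) [] = (LINT z|lborel. (1 + (norm z)\<^sup>2) powr (- 7 / 2) * \<psi> (y + \<epsilon> *\<^sub>R z))"
  proof -
    have "I (-7/2) [] = \<epsilon> ^ 3 * (LINT z|lborel. W (y + \<epsilon> *\<^sub>R z) powr (-7/2) * iter_pd [] \<psi> (y + \<epsilon> *\<^sub>R z))"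
      unfolding I_def by (rule integral_affine[OF _ eps]) (use int[THEN borel_measurable_integrable] in simp)
    also have "(\<lambda>z. W (y + \<epsilon> *\<^sub>R z) powr (-7/2) * iter_pd [] \<psi> (y + \<epsilon> *\<^sub>R z))
        = (\<lambda>z. \<epsilon> powr (-7) * ((1 + (norm z)\<^sup>2) powr (- 7 / 2) * \<psi> (y + \<epsilon> *\<^sub>R z)))"
    proof
      fix z
      have "W (y + \<epsilon> *\<^sub>R z) = \<epsilon>\<^sup>2 * (1 + (norm z)\<^sup>2)"
        unfolding W_def using eps by (simp add: power_mult_distrib algebra_simps)
      moreover have "\<epsilon>\<^sup>2 powr (-7/2) = \<epsilon> powr (-7)"
      proof -
        have "\<epsilon>\<^sup>2 = \<epsilon> powr 2" using eps by (simp add: powr_numeral)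
        then show ?thesis unfolding powr_powr by (simp only: powr_powr) simp
      qed
      ultimately show "W (y + \<epsilon> *\<^sub>R z) powr (-7/2) * iter_pd [] \<psi> (y + \<epsilon> *\<^sub>R z)
          = \<epsilon> powr (-7) * ((1 + (norm z)\<^sup>2) powr (- 7 / 2) * \<psi> (y + \<epsilon> *\<^sub>R z))"
        by (simp add: powr_mult iter_pd_def)
    qed
    also have "\<epsilon> ^ 3 * (LINT z|lborel. \<epsilon> powr (-7) * ((1 + (norm z)\<^sup>2) powr (- 7 / 2) * \<psi> (y + \<epsilon> *\<^sub>R z)))
        = (\<epsilon> ^ 3 * \<epsilon> powr (-7)) * (LINT z|lborel. (1 + (norm z)\<^sup>2) powr (- 7 / 2) * \<psi> (y + \<epsilon> *\<^sub>R z))"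
      by simp
    finally have "\<epsilon> ^ 4 * I (-7/2) [] = (\<epsilon> ^ 7 * \<epsilon> powr (-7)) *
        (LINT z|lborel. (1 + (norm z)\<^sup>2) powr (- 7 / 2) * \<psi> (y + \<epsilon> *\<^sub>R z))"
      by (simp add: power_add[symmetric] mult.assoc[symmetric])
    moreover have "\<epsilon> ^ 7 * \<epsilon> powr (-7) = 1"
      using eps by (simp add: powr_minus powr_numeral)
    ultimately show ?thesis by simp
  qed
  finally show ?thesis unfolding W_def by simp
qed

text \<open>Both sides of the regularised identity converge as \<open>\<epsilon>\<close> runs
  through \<open>1 / (n + 1)\<close>: on the left
  \<open>sqrt (|x - y|^2 + \<epsilon>^2) \<le> |x - y| + 1\<close> gives the dominating function, on
  the right \<open>\<psi>\<close> is bounded and the kernel has mass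
  \<open>8 * pi / 15\<close>.\<close>

theorem bilaplacian_fundamental_solution:
  assumes \<psi>: "test_fun \<psi>"
  shows "(LINT x|lborel. dist x y * lap (lap \<psi>) x) = - 8 * pi * \<psi> y"
proof -
  define h where "h n = 1 / real (Suc n)" for n
  have h: "0 < h n" "h n \<le> 1" for n unfolding h_def by auto
  have h0: "h \<longlonglongrightarrow> 0" unfolding h_def by (rule lim_1_over_n[THEN LIMSEQ_Suc])
  obtain B where B: "\<And>x. norm x > B \<Longrightarrow> lap (lap \<psi>) x = 0" using test_fun_lap_lap(2)[OF \<psi>] by blast
  obtain B' where B': "\<And>js x. norm x > B' \<Longrightarrow> iter_pd js \<psi> x = 0" using test_fun_support[OF \<psi>] by blast
  note cL = test_fun_lap_lap(1)[OF \<psi>]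
  have "continuous_on UNIV (iter_pd [] \<psi>)" using \<psi> unfolding test_fun_def by blast
  then have c\<psi>: "continuous_on UNIV \<psi>" by (simp add: iter_pd_def)
  note [measurable] = borel_measurable_continuous_onI[OF cL] borel_measurable_continuous_onI[OF c\<psi>]
  have "bounded (\<psi> ` cball 0 B')"
    by (intro compact_imp_bounded compact_continuous_image continuous_on_subset[OF c\<psi>]) auto
  then obtain M where M: "\<forall>y\<in>\<psi> ` cball 0 B'. norm y \<le> M" unfolding bounded_iff by blast
  have M: "\<bar>\<psi> x\<bar> \<le> \<bar>M\<bar>" for x
  proof (cases "norm x \<le> B'")
    case True
    then have "norm (\<psi> x) \<le> M" using M by auto
    then show ?thesis by simp
  next
    case False
    then show ?thesis using B'[of x "[]"] by (simp add: iter_pd_def)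
  qed
  have "(\<lambda>n. LINT x|lborel. ((norm (x - y))\<^sup>2 + (h n)\<^sup>2) powr (1 / 2) * lap (lap \<psi>) x)
      \<longlonglongrightarrow> (LINT x|lborel. dist x y * lap (lap \<psi>) x)"
  proof (rule integral_dominated_convergence)
    show "integrable lborel (\<lambda>x. (dist x y + 1) * \<bar>lap (lap \<psi>) x\<bar>)"
      by (rule integrable_continuous_bounded_support[of _ B]) (use cL B in \<open>auto intro!: continuous_intros\<close>)
    show "AE x in lborel. (\<lambda>n. ((norm (x - y))\<^sup>2 + (h n)\<^sup>2) powr (1 / 2) * lap (lap \<psi>) x)
        \<longlonglongrightarrow> dist x y * lap (lap \<psi>) x"
    proof (intro AE_I2)
      fix x
      have "(\<lambda>n. sqrt ((norm (x - y))\<^sup>2 + (h n)\<^sup>2) * lap (lap \<psi>) x)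
          \<longlonglongrightarrow> sqrt ((norm (x - y))\<^sup>2 + 0\<^sup>2) * lap (lap \<psi>) x"
        by (intro tendsto_intros h0)
      then show "(\<lambda>n. ((norm (x - y))\<^sup>2 + (h n)\<^sup>2) powr (1 / 2) * lap (lap \<psi>) x)
          \<longlonglongrightarrow> dist x y * lap (lap \<psi>) x"
        by (simp add: powr_half_sqrt dist_norm)
    qed
    show "AE x in lborel. norm (((norm (x - y))\<^sup>2 + (h n)\<^sup>2) powr (1 / 2) * lap (lap \<psi>) x)
        \<le> (dist x y + 1) * \<bar>lap (lap \<psi>) x\<bar>" for n
    proof (intro AE_I2)
      fix x
      have "sqrt ((norm (x - y))\<^sup>2 + (h n)\<^sup>2) \<le> norm (x - y) + h n"
        using sqrt_sum_squares_le_sum[of "norm (x - y)" "h n"] h(1)[of n] by simp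
      then have "sqrt ((norm (x - y))\<^sup>2 + (h n)\<^sup>2) \<le> dist x y + 1" using h(2)[of n] by (simp add: dist_norm)
      then show "norm (((norm (x - y))\<^sup>2 + (h n)\<^sup>2) powr (1 / 2) * lap (lap \<psi>) x)
        \<le> (dist x y + 1) * \<bar>lap (lap \<psi>) x\<bar>"
        by (simp add: abs_mult powr_half_sqrt mult_right_mono)
    qed
  qed auto
  moreover have "(\<lambda>n. - 15 * (LINT z|lborel. (1 + (norm z)\<^sup>2) powr (- 7 / 2) * \<psi> (y + h n *\<^sub>R z)))
      \<longlonglongrightarrow> - 15 * (LINT z::real^3|lborel. (1 + (norm z)\<^sup>2) powr (- 7 / 2) * \<psi> (y + 0 *\<^sub>R z))"
  proof (intro tendsto_intros integral_dominated_convergence)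
    show "integrable lborel (\<lambda>z::real^3. (1 + (norm z)\<^sup>2) powr (- 7 / 2) * \<bar>M\<bar>)"
      using integral_norm_powr_seven_halves(1) by simp
    show "AE z in lborel. (\<lambda>n. (1 + (norm z)\<^sup>2) powr (- 7 / 2) * \<psi> (y + h n *\<^sub>R z))
        \<longlonglongrightarrow> (1 + (norm z)\<^sup>2) powr (- 7 / 2) * \<psi> (y + 0 *\<^sub>R z)"
    proof (intro AE_I2 tendsto_intros)
      fix z
      have "(\<lambda>n. y + h n *\<^sub>R z) \<longlonglongrightarrow> y + 0 *\<^sub>R z" by (intro tendsto_intros h0)
      then show "(\<lambda>n. \<psi> (y + h n *\<^sub>R z)) \<longlonglongrightarrow> \<psi> (y + 0 *\<^sub>R z)"
        by (rule continuous_on_tendsto_compose[OF c\<psi>]) auto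
    qed
    show "AE z in lborel. norm ((1 + (norm z)\<^sup>2) powr (- 7 / 2) * \<psi> (y + h n *\<^sub>R z))
        \<le> (1 + (norm z)\<^sup>2) powr (- 7 / 2) * \<bar>M\<bar>" for n
      using M by (auto simp: abs_mult intro!: mult_left_mono)
  qed auto
  ultimately have "(LINT x|lborel. dist x y * lap (lap \<psi>) x)
      = - 15 * (LINT z::real^3|lborel. (1 + (norm z)\<^sup>2) powr (- 7 / 2) * \<psi> (y + 0 *\<^sub>R z))"
    unfolding integral_regularised_bilaplacian[OF \<psi> h(1)] by (rule LIMSEQ_unique)
  also have "\<dots> = - 8 * pi * \<psi> y"
    using integral_norm_powr_seven_halves(2) by simp
  finally show ?thesis .
qed

section \<open>Expansion of the kernel at infinity\<close>

lemma dist_square_expand: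
  fixes x y :: "'a::real_inner"
  shows "(dist x y)\<^sup>2 = (norm x)\<^sup>2 + (norm y)\<^sup>2 - 2 * (x \<bullet> y)"
  unfolding dist_norm power2_norm_eq_inner by (simp add: inner_simps inner_commute)

lemma dist_expand1: "\<bar>dist x y - norm x\<bar> \<le> norm (y::'a::real_normed_vector)"
  using norm_triangle_ineq3[of x "x - y"] by (simp add: dist_norm abs_minus_commute)

text \<open>With \<open>d = dist x y - norm x\<close> the law of cosines is the quadratic equation
  \<open>2 |x| d + d^2 = |y|^2 - 2 (x \<bullet> y)\<close>. Solving for its linear term lets each
  bound on \<open>d\<close> produce the next one, with a further factor
  \<open>1 / |x|\<close>.\<close>

lemma dist_expand_exact:
  fixes x y :: "'a::real_inner"
  assumes "x \<noteq> 0"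
  shows "dist x y - norm x + (x \<bullet> y) / norm x = ((norm y)\<^sup>2 - (dist x y - norm x)\<^sup>2) / (2 * norm x)"
proof -
  have a: "norm x > 0" using assms by simp
  have "(x \<bullet> y) = ((norm x)\<^sup>2 + (norm y)\<^sup>2 - (dist x y)\<^sup>2) / 2"
    using dist_square_expand[of x y] by simp
  then have "dist x y - norm x + (x \<bullet> y) / norm x
      = dist x y - norm x + ((norm x)\<^sup>2 + (norm y)\<^sup>2 - (dist x y)\<^sup>2) / 2 / norm x" by (simp only:)
  also have "\<dots> = ((norm y)\<^sup>2 - (dist x y - norm x)\<^sup>2) / (2 * norm x)"
    using a by (simp add: field_simps power2_eq_square)
  finally show ?thesis .
qed

lemma dist_expand2:
  fixes x y :: "'a::real_inner"
  assumes "x \<noteq> 0"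
  shows "\<bar>dist x y - norm x + (x \<bullet> y) / norm x\<bar> \<le> (norm y)\<^sup>2 / (2 * norm x)"
proof -
  have "(dist x y - norm x)\<^sup>2 \<le> (norm y)\<^sup>2"
    using dist_expand1[of x y] by (rule power2_le_iff_abs_le[THEN iffD2, rotated]) simp
  then have "\<bar>(norm y)\<^sup>2 - (dist x y - norm x)\<^sup>2\<bar> \<le> (norm y)\<^sup>2"
    using zero_le_power2[of "dist x y - norm x"] by linarith
  then show ?thesis unfolding dist_expand_exact[OF assms]
    by (simp add: abs_divide divide_right_mono)
qed

text \<open>In the exact identity \<open>d^2\<close> is replaced by \<open>q^2\<close> with
  \<open>q = (x \<bullet> y) / |x|\<close>. The error \<open>(d + q) (q - d) / (2 |x|)\<close> is
  small because \<open>d + q\<close> is already known to be of order \<open>1 / |x|\<close>.\<close>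

lemma dist_expand3:
  fixes x y :: "'a::real_inner"
  assumes "x \<noteq> 0"
  shows "\<bar>dist x y - norm x + (x \<bullet> y) / norm x
      - ((norm y)\<^sup>2 - (x \<bullet> y)\<^sup>2 / (norm x)\<^sup>2) / (2 * norm x)\<bar> \<le> (norm y) ^ 3 / (2 * (norm x)\<^sup>2)"
proof -
  define a where "a = norm x"
  define d where "d = dist x y - a"
  define q where "q = (x \<bullet> y) / a"
  have a: "a > 0" using assms unfolding a_def by simp
  have q: "\<bar>q\<bar> \<le> norm y"
    using Cauchy_Schwarz_ineq2[of x y] a unfolding q_def a_def by (simp add: abs_divide field_simps)
  have d: "\<bar>d\<bar> \<le> norm y" using dist_expand1[of x y] unfolding d_def a_def by simp
  have dq: "\<bar>d + q\<bar> \<le> (norm y)\<^sup>2 / (2 * a)"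
    using dist_expand2[OF assms, of y] unfolding d_def q_def a_def by simp
  have "d + q - ((norm y)\<^sup>2 - q\<^sup>2) / (2 * a) = ((norm y)\<^sup>2 - d\<^sup>2) / (2 * a) - ((norm y)\<^sup>2 - q\<^sup>2) / (2 * a)"
    using dist_expand_exact[OF assms, of y] unfolding d_def q_def a_def by simp
  also have "\<dots> = (d + q) * (q - d) / (2 * a)"
    by (simp add: diff_divide_distrib[symmetric] power2_eq_square algebra_simps)
  finally have "\<bar>d + q - ((norm y)\<^sup>2 - q\<^sup>2) / (2 * a)\<bar> = \<bar>d + q\<bar> * \<bar>q - d\<bar> / (2 * a)"
    using a by (simp add: abs_mult abs_divide)
  also have "\<dots> \<le> ((norm y)\<^sup>2 / (2 * a)) * (2 * norm y) / (2 * a)"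
    using dq d q a by (intro divide_right_mono mult_mono) auto
  also have "\<dots> = (norm y) ^ 3 / (2 * a\<^sup>2)"
    using a by (simp add: field_simps power2_eq_square power3_eq_cube)
  finally show ?thesis unfolding d_def q_def a_def by (simp add: power_divide)
qed

text \<open>On the ball of radius \<open>\<delta> * R\<close> around \<open>R *\<^sub>R e\<close> the weighted function has modulus at least
  a constant times \<open>1 / R\<close>, while the ball has volume of order \<open>R ^ 3\<close>.\<close>

lemma leading_coefficient_zero:
  fixes L :: "real^3 \<Rightarrow> complex"
  assumes k: "k \<ge> -1"
    and sq: "sq_int (\<lambda>x. complex_of_real ((1 + (norm x)\<^sup>2) powr (- (k + 1) / 2)) * \<phi> x)"
    and cont: "continuous_on (UNIV - {0}) L"
    and hom: "\<And>t x. t > 0 \<Longrightarrow> L (t *\<^sub>R x) = L x"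
    and lead: "\<And>x. norm x \<ge> 1 \<Longrightarrow> cmod (\<phi> x - complex_of_real (norm x powr k) * L x) \<le> C * norm x powr (k - 1)"
    and x0: "x0 \<noteq> 0"
  shows "L x0 = 0"
proof (rule ccontr)
  assume "L x0 \<noteq> 0"
  define e where "e = (1 / norm x0) *\<^sub>R x0"
  have e1: "norm e = 1" unfolding e_def using x0 by simp
  have Le: "L e = L x0" unfolding e_def using hom x0 by simp
  define c where "c = cmod (L e) / 2"
  have c: "c > 0" unfolding c_def Le using \<open>L x0 \<noteq> 0\<close> by simp
  have "isCont L e"
    using cont e1 by (subst (asm) continuous_on_eq_continuous_at) (auto intro: open_delete)
  then obtain d where d: "d > 0" "\<And>x. dist x e < d \<Longrightarrow> dist (L x) (L e) < c"
    using c unfolding continuous_at_eps_delta by blast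
  define \<delta> where "\<delta> = min d (1 / 2)"
  have \<delta>: "\<delta> > 0" "\<delta> \<le> 1 / 2" "\<delta> \<le> d" unfolding \<delta>_def using d by auto
  define h where "h x = (cmod (complex_of_real ((1 + (norm x)\<^sup>2) powr (- (k + 1) / 2)) * \<phi> x))\<^sup>2" for x
  have ih: "integrable lborel h" unfolding h_def using sq_intD(2)[OF sq] .
  \<comment> \<open>The power of 2 is the loss in \<open>1 + |x|^2 \<le> 2 |x|^2\<close> inside the
    weight. The \<open>c / 3\<close> is \<open>(c / 2) / (3 / 2)\<close>: half of \<open>c\<close>
    survives the remainder, and \<open>|x| \<le> 3 R / 2\<close> on the ball.\<close>
  define b where "b = 2 powr (- (k + 1) / 2) * (c / 3)"
  have b: "b > 0" unfolding b_def using c by simp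
  \<comment> \<open>\<open>R \<ge> 2\<close> forces \<open>norm x \<ge> 1\<close> on the ball; the
    second entry keeps the remainder below half of the lower bound \<open>c\<close> for
    \<open>cmod (L x)\<close>.\<close>
  define R0 where "R0 = max 2 (4 * \<bar>C\<bar> / c)"
  have low: "h x \<ge> (b / R)\<^sup>2" if R: "R \<ge> R0" and x: "x \<in> ball (R *\<^sub>R e) (\<delta> * R)" for R x
  proof -
    have R2: "R \<ge> 2" "R > 0" using R unfolding R0_def by auto
    have dx: "norm (x - R *\<^sub>R e) < \<delta> * R" using x by (simp add: dist_norm norm_minus_commute)
    have "\<delta> * R \<le> 1 / 2 * R" using \<delta> R2 by (intro mult_right_mono) auto
    then have dx': "norm (x - R *\<^sub>R e) \<le> R / 2" using dx by simp
    have nRe: "norm (R *\<^sub>R e) = R" using R2 e1 by simp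
    have up: "norm x \<le> 3 * R / 2" using norm_triangle_sub[of x "R *\<^sub>R e"] dx' nRe by simp
    have lo: "norm x \<ge> R / 2" using norm_triangle_sub[of "R *\<^sub>R e" x] dx' nRe
      by (simp add: norm_minus_commute)
    define a where "a = norm x"
    have a: "a \<ge> 1" "a > 0" "a \<le> 3 * R / 2" "a \<ge> R / 2" using lo up R2 unfolding a_def by auto
    have "dist ((1 / R) *\<^sub>R x) e < d"
    proof -
      have "(1 / R) *\<^sub>R x - e = (1 / R) *\<^sub>R (x - R *\<^sub>R e)" using R2 by (simp add: scaleR_diff_right)
      then have "dist ((1 / R) *\<^sub>R x) e = norm (x - R *\<^sub>R e) / R" using R2 by (simp add: dist_norm)
      also have "\<dots> < \<delta>" using dx R2 by (simp add: divide_less_eq)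
      finally show ?thesis using \<delta> by simp
    qed
    then have "dist (L x) (L e) < c" using d(2) hom[of "1 / R" x] R2 by fastforce
    then have Lx: "cmod (L x) \<ge> c"
      using norm_triangle_sub[of "L e" "L x"] unfolding c_def by (simp add: dist_norm norm_minus_commute)
    have Ca: "C / a \<le> c / 2"
    proof -
      have "4 * \<bar>C\<bar> / c \<le> R" using R unfolding R0_def by simp
      then have "4 * \<bar>C\<bar> \<le> R * c" using c by (simp add: divide_le_eq)
      also have "\<dots> \<le> 2 * a * c" using a c by simp
      finally have "2 * C \<le> a * c" by simp
      then show ?thesis using a by (simp add: divide_le_eq algebra_simps)
    qed
    have "a powr k * c \<le> cmod (complex_of_real (a powr k) * L x)"
      using Lx by (simp add: norm_mult mult_left_mono)
    also have "\<dots> \<le> cmod (\<phi> x) + C * a powr (k - 1)"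
      using lead[of x] a norm_triangle_sub[of "complex_of_real (a powr k) * L x" "\<phi> x"]
      unfolding a_def by (simp add: norm_minus_commute)
    also have "C * a powr (k - 1) = a powr k * (C / a)" using a by (simp add: powr_diff)
    also have "\<dots> \<le> a powr k * (c / 2)" using Ca by (intro mult_left_mono) auto
    finally have ph: "a powr k * (c / 2) \<le> cmod (\<phi> x)" by simp
    have "2 powr (- (k + 1) / 2) * a powr (- (k + 1)) = (2 * a\<^sup>2) powr (- (k + 1) / 2)"
    proof -
      have "a\<^sup>2 = a powr 2" using a by (simp add: powr_numeral)
      then have "(a\<^sup>2) powr (- (k + 1) / 2) = a powr (2 * (- (k + 1) / 2))" by (simp only: powr_powr)
      then have "(a\<^sup>2) powr (- (k + 1) / 2) = a powr (- (k + 1))"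
        by (simp only: times_divide_eq_right nonzero_mult_div_cancel_left zero_neq_numeral[symmetric] not_False_eq_True)
      then show ?thesis by (simp add: powr_mult)
    qed
    also have "\<dots> \<le> (1 + a\<^sup>2) powr (- (k + 1) / 2)"
      using a k power_mono[of 1 a 2] by (intro powr_mono2') (auto simp: add_pos_nonneg)
    finally have wt: "2 powr (- (k + 1) / 2) * a powr (- (k + 1)) \<le> (1 + a\<^sup>2) powr (- (k + 1) / 2)" .
    have "b / R \<le> 2 powr (- (k + 1) / 2) * (c / 2) / a"
    proof -
      have "b / R = 2 powr (- (k + 1) / 2) * (c / 2) / (3 * R / 2)" unfolding b_def by simp
      also have "\<dots> \<le> 2 powr (- (k + 1) / 2) * (c / 2) / a"
        using a c by (intro divide_left_mono) auto
      finally show ?thesis .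
    qed
    also have "\<dots> = (2 powr (- (k + 1) / 2) * a powr (- (k + 1))) * (a powr k * (c / 2))"
    proof -
      have "a powr (- (k + 1)) * a powr k = 1 / a"
        using a by (simp add: powr_add[symmetric] powr_minus_divide)
      then have "2 powr (- (k + 1) / 2) * (c / 2) / a
          = 2 powr (- (k + 1) / 2) * (c / 2) * (a powr (- (k + 1)) * a powr k)" by simp
      then show ?thesis by (simp only: mult_ac)
    qed
    also have "\<dots> \<le> (1 + a\<^sup>2) powr (- (k + 1) / 2) * cmod (\<phi> x)"
      using wt ph c by (intro mult_mono) auto
    finally have "(b / R)\<^sup>2 \<le> ((1 + a\<^sup>2) powr (- (k + 1) / 2) * cmod (\<phi> x))\<^sup>2"
      using b R2 by (intro power_mono) auto
    then show ?thesis unfolding h_def a_def by (simp add: norm_mult)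
  qed
  define B where "B = b\<^sup>2 * (4 / 3 * pi * \<delta> ^ 3)"
  have B: "B > 0" unfolding B_def using b \<delta> by simp
  have "B * R \<le> (LINT x|lborel. h x)" if R: "R \<ge> R0" for R
  proof -
    have R2: "R > 0" using R unfolding R0_def by auto
    have "B * R = (b / R)\<^sup>2 * measure lborel (ball (R *\<^sub>R e) (\<delta> * R))"
      using R2 \<delta> unfolding B_def
      by (subst sphere_volume) (auto simp: power_mult_distrib power_divide power2_eq_square power3_eq_cube)
    also have "\<dots> = (LINT x|lborel. indicator (ball (R *\<^sub>R e) (\<delta> * R)) x * (b / R)\<^sup>2)" by simp
    also have "\<dots> \<le> (LINT x|lborel. h x)"
    proof (rule integral_mono[OF _ ih])
      show "integrable lborel (\<lambda>x. indicator (ball (R *\<^sub>R e) (\<delta> * R)) x * (b / R)\<^sup>2)"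
        by (intro integrable_mult_left integrable_real_indicator)
          (auto intro: emeasure_bounded_finite[unfolded infinity_ennreal_def])
      show "indicator (ball (R *\<^sub>R e) (\<delta> * R)) x * (b / R)\<^sup>2 \<le> h x" for x
        using low[OF R, of x] by (auto simp: indicator_def h_def)
    qed
    finally show ?thesis .
  qed
  \<comment> \<open>The lower bound grows linearly in \<open>R\<close>, and this radius makes it
    exceed the finite integral by at least \<open>B\<close>.\<close>
  from this[of "max R0 ((LINT x|lborel. h x) / B + 1)"]
  have "B * max R0 ((LINT x|lborel. h x) / B + 1) \<le> (LINT x|lborel. h x)" by simp
  moreover have "B * ((LINT x|lborel. h x) / B + 1) \<le> B * max R0 ((LINT x|lborel. h x) / B + 1)"
    using B by (intro mult_left_mono) auto
  moreover have "B * ((LINT x|lborel. h x) / B + 1) = (LINT x|lborel. h x) + B"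
    using B by (simp add: field_simps)
  ultimately show False using B by simp
qed

text \<open>Up to a constant the squared weighted function is at most
  \<open>(1 + |x|)^(-2 (s + k))\<close>, and \<open>2 (s + k) > 3\<close> is integrability in
  dimension 3.\<close>

lemma wL2_if_bounded_powr:
  assumes [measurable]: "\<phi> \<in> borel_measurable borel"
    and bd: "\<And>x. cmod (\<phi> x) \<le> C * (1 + norm x) powr (- k)"
    and s: "s + k > 3 / 2" "s \<ge> 0"
  shows "wL2 s \<phi>"
  unfolding wL2_def
proof (rule sq_int_bound)
  show "integrable lborel (\<lambda>x::real^3. (2 powr (s / 2) * C)\<^sup>2 * (1 + norm x) powr (- (2 * (s + k))))"
    by (intro integrable_mult_right integrable_one_plus_norm_powr) (use s in auto)
  show "AE x in lborel. (cmod (complex_of_real ((1 + (norm x)\<^sup>2) powr (- s / 2)) * \<phi> x))\<^sup>2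
      \<le> (2 powr (s / 2) * C)\<^sup>2 * (1 + norm x) powr (- (2 * (s + k)))"
  proof (intro AE_I2)
    fix x :: "real^3"
    define a where "a = 1 + norm x"
    have a: "a > 0" unfolding a_def by (simp add: add_pos_nonneg)
    have "a\<^sup>2 / 2 \<le> 1 + (norm x)\<^sup>2"
      using sum_squares_bound[of 1 "norm x"] unfolding a_def by (simp add: power2_sum)
    then have "(1 + (norm x)\<^sup>2) powr (- s / 2) \<le> (a\<^sup>2 / 2) powr (- s / 2)"
      using a s by (intro powr_mono2') auto
    also have "\<dots> = 2 powr (s / 2) * a powr (- s)"
    proof -
      have "a\<^sup>2 = a powr 2" using a by (simp add: powr_numeral)
      then have "(a\<^sup>2) powr (- s / 2) = a powr (- s)" by (simp only: powr_powr) simp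
      then show ?thesis by (simp add: powr_divide powr_minus_divide)
    qed
    finally have w: "(1 + (norm x)\<^sup>2) powr (- s / 2) \<le> 2 powr (s / 2) * a powr (- s)" .
    have "cmod (complex_of_real ((1 + (norm x)\<^sup>2) powr (- s / 2)) * \<phi> x)
        \<le> (2 powr (s / 2) * a powr (- s)) * (C * a powr (- k))"
      unfolding norm_mult using w bd[of x] by (intro mult_mono) (auto simp: a_def)
    also have "\<dots> = 2 powr (s / 2) * C * a powr (- (s + k))"
      using powr_add[of a "- s" "- k"] by simp
    finally have "(cmod (complex_of_real ((1 + (norm x)\<^sup>2) powr (- s / 2)) * \<phi> x))\<^sup>2
        \<le> (2 powr (s / 2) * C * a powr (- (s + k)))\<^sup>2"
      by (intro power_mono) auto
    also have "\<dots> = (2 powr (s / 2) * C)\<^sup>2 * a powr (- (2 * (s + k)))"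
    proof -
      have "(a powr (- (s + k)))\<^sup>2 = a powr (- (2 * (s + k)))"
        unfolding power2_eq_square by (simp add: powr_add[symmetric])
      then show ?thesis by (simp add: power_mult_distrib)
    qed
    finally show "(cmod (complex_of_real ((1 + (norm x)\<^sup>2) powr (- s / 2)) * \<phi> x))\<^sup>2
      \<le> (2 powr (s / 2) * C)\<^sup>2 * (1 + norm x) powr (- (2 * (s + k)))" unfolding a_def .
  qed
qed auto

section \<open>Operators attached to a decaying potential\<close>

lemma integrable_pair_bound:
  fixes H :: "(real^3) \<times> (real^3) \<Rightarrow> complex" and F G :: "real^3 \<Rightarrow> real"
  assumes H: "H \<in> borel_measurable (lborel \<Otimes>\<^sub>M lborel)"
    and F: "integrable lborel F" and G: "integrable lborel G"
    and bd: "\<And>x y. cmod (H (x, y)) \<le> F x * G y"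
  shows "integrable (lborel \<Otimes>\<^sub>M lborel) H"
proof (rule Bochner_Integration.integrable_bound)
  have [measurable]: "F \<in> borel_measurable borel" "G \<in> borel_measurable borel"
    using F G by (auto dest: borel_measurable_integrable)
  show "integrable (lborel \<Otimes>\<^sub>M lborel) (\<lambda>(x, y). F x * G y)"
  proof (rule lborel_pair.Fubini_integrable)
    show "(\<lambda>(x, y). F x * G y) \<in> borel_measurable (lborel \<Otimes>\<^sub>M lborel)" by measurable
    show "integrable lborel (\<lambda>x. LINT y|lborel. norm (case (x, y) of (x, y) \<Rightarrow> F x * G y))"
      using F G by (auto simp: abs_mult)
    show "AE x in lborel. integrable lborel (\<lambda>y. case (x, y) of (x, y) \<Rightarrow> F x * G y)"
      using G by auto
  qed
  show "AE z in lborel \<Otimes>\<^sub>M lborel. norm (H z) \<le> norm (case z of (x, y) \<Rightarrow> F x * G y)"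
    using bd by (auto intro!: AE_I2 order_trans[OF bd])
qed (rule H)

text \<open>Degree 4 is that of \<open>G3k\<close>, the fastest growing kernel, so one class covers
  all moments that occur.\<close>

definition poly_bdd :: "(real^3 \<Rightarrow> real) \<Rightarrow> bool" where
  "poly_bdd p \<longleftrightarrow> p \<in> borel_measurable borel \<and> (\<exists>c. \<forall>y. \<bar>p y\<bar> \<le> c * (1 + norm y) ^ 4)"

lemma one_le_weight: "1 \<le> (1 + norm y) ^ n"
  by (simp add: one_le_power)

lemma norm_power_le_weight: "n \<le> m \<Longrightarrow> norm y ^ n \<le> (1 + norm y) ^ m"
proof -
  assume "n \<le> m"
  have "norm y ^ n \<le> (1 + norm y) ^ n" by (intro power_mono) auto
  also have "\<dots> \<le> (1 + norm y) ^ m" using \<open>n \<le> m\<close> by (intro power_increasing) auto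
  finally show ?thesis .
qed

lemma poly_bddI:
  assumes "p \<in> borel_measurable borel" "\<And>y. \<bar>p y\<bar> \<le> c * norm y ^ n" "n \<le> 4" "c \<ge> 0"
  shows "poly_bdd p"
  unfolding poly_bdd_def
proof (intro conjI exI allI)
  fix y
  show "\<bar>p y\<bar> \<le> c * (1 + norm y) ^ 4"
    using order_trans[OF assms(2) mult_left_mono[OF norm_power_le_weight[OF assms(3)] assms(4)]] .
qed (rule assms(1))

lemma poly_bdd_intros:
  "poly_bdd (\<lambda>_. c)" "poly_bdd (\<lambda>y. y $ i)" "poly_bdd (\<lambda>y. y $ i * y $ j)"
  "poly_bdd (\<lambda>y. (norm y)\<^sup>2)" "poly_bdd (\<lambda>y. (norm y)\<^sup>2 * y $ j)" "poly_bdd (\<lambda>y. (norm y) ^ 4)"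
  "poly_bdd (dist x)"
proof -
  show "poly_bdd (\<lambda>_. c)" by (rule poly_bddI[of _ "\<bar>c\<bar>" 0]) auto
  show "poly_bdd (\<lambda>y. y $ i)" by (rule poly_bddI[of _ 1 1]) (auto simp: component_le_norm_cart)
  show "poly_bdd (\<lambda>y. y $ i * y $ j)"
    by (rule poly_bddI[of _ 1 2])
      (auto simp: abs_mult power2_eq_square component_le_norm_cart intro!: mult_mono)
  show "poly_bdd (\<lambda>y. (norm y)\<^sup>2)" by (rule poly_bddI[of _ 1 2]) auto
  show "poly_bdd (\<lambda>y. (norm y)\<^sup>2 * y $ j)"
    by (rule poly_bddI[of _ 1 3])
      (auto simp: abs_mult power3_eq_cube power2_eq_square component_le_norm_cart intro!: mult_mono)
  show "poly_bdd (\<lambda>y. (norm y) ^ 4)" by (rule poly_bddI[of _ 1 4]) auto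
  show "poly_bdd (dist x)"
    unfolding poly_bdd_def
  proof (intro conjI exI allI)
    fix y
    have "dist x y \<le> norm x + norm y" using norm_triangle_ineq4[of x y] by (simp add: dist_norm)
    also have "\<dots> \<le> norm x * (1 + norm y) ^ 4 + 1 * (1 + norm y) ^ 4"
      using norm_power_le_weight[of 1 4 y] one_le_weight[of y 4]
      by (intro add_mono) (auto intro: mult_left_mono[of 1 _ "norm x", simplified])
    finally show "\<bar>dist x y\<bar> \<le> (norm x + 1) * (1 + norm y) ^ 4" by (simp add: algebra_simps)
  qed measurable
qed

lemma poly_bdd_add: "poly_bdd p \<Longrightarrow> poly_bdd q \<Longrightarrow> poly_bdd (\<lambda>y. p y + q y)"
  unfolding poly_bdd_def
proof (elim conjE exE, intro conjI)
  fix c d assume c: "\<forall>y. \<bar>p y\<bar> \<le> c * (1 + norm y) ^ 4" and d: "\<forall>y. \<bar>q y\<bar> \<le> d * (1 + norm y) ^ 4"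
  have "\<bar>p y + q y\<bar> \<le> (c + d) * (1 + norm y) ^ 4" for y
    using abs_triangle_ineq[of "p y" "q y"] c[rule_format, of y] d[rule_format, of y]
    by (simp add: distrib_right)
  then show "\<exists>c. \<forall>y. \<bar>p y + q y\<bar> \<le> c * (1 + norm y) ^ 4" by blast
qed auto

lemma poly_bdd_cmult: "poly_bdd p \<Longrightarrow> poly_bdd (\<lambda>y. c * p y)"
  unfolding poly_bdd_def
proof (elim conjE exE, intro conjI)
  fix d assume d: "\<forall>y. \<bar>p y\<bar> \<le> d * (1 + norm y) ^ 4"
  have "\<bar>c * p y\<bar> \<le> (\<bar>c\<bar> * d) * (1 + norm y) ^ 4" for y
    using mult_left_mono[OF d[rule_format, of y], of "\<bar>c\<bar>"] by (simp add: abs_mult mult.assoc)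
  then show "\<exists>d. \<forall>y. \<bar>c * p y\<bar> \<le> d * (1 + norm y) ^ 4" by blast
qed auto

lemma poly_bdd_sum: "finite I \<Longrightarrow> (\<And>i. i \<in> I \<Longrightarrow> poly_bdd (p i)) \<Longrightarrow> poly_bdd (\<lambda>y. \<Sum>i\<in>I. p i y)"
  by (induction I rule: finite_induct) (auto intro: poly_bdd_intros poly_bdd_add)

text \<open>A bound in product form separates the variables: with \<open>v\<close> on both sides
  every \<open>vGv\<close> has a square-integrable kernel, and the later exchanges of integrals are
  justified.\<close>

definition kernel_bdd :: "real \<Rightarrow> (real^3 \<Rightarrow> real^3 \<Rightarrow> real) \<Rightarrow> bool" where
  "kernel_bdd c K \<longleftrightarrow> (\<lambda>(x, y). K x y) \<in> borel_measurable (borel \<Otimes>\<^sub>M borel) \<and>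
     (\<forall>x y. \<bar>K x y\<bar> \<le> c * (1 + norm x) ^ 4 * (1 + norm y) ^ 4)"

lemma kernel_bdd_poly_bdd:
  assumes "kernel_bdd c K"
  shows "poly_bdd (K x)"
  unfolding poly_bdd_def
proof (intro conjI exI[of _ "c * (1 + norm x) ^ 4"])
  have "(\<lambda>(x, y). K x y) \<in> borel_measurable (borel \<Otimes>\<^sub>M borel)" using assms unfolding kernel_bdd_def by blast
  from measurable_compose[OF measurable_Pair1' this, of x] show "K x \<in> borel_measurable borel" by simp
  show "\<forall>y. \<bar>K x y\<bar> \<le> c * (1 + norm x) ^ 4 * (1 + norm y) ^ 4"
    using assms unfolding kernel_bdd_def by blast
qed

lemma dist_power_le_weight:
  assumes "n \<le> 4"
  shows "dist x y ^ n \<le> (1 + norm x) ^ 4 * (1 + norm y) ^ 4"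
proof -
  have "dist x y \<le> norm x + norm y" using norm_triangle_ineq4[of x y] by (simp add: dist_norm)
  also have "\<dots> \<le> (1 + norm x) * (1 + norm y)" by (simp add: algebra_simps)
  finally have "dist x y ^ n \<le> ((1 + norm x) * (1 + norm y)) ^ n" by (intro power_mono) auto
  also have "\<dots> \<le> ((1 + norm x) * (1 + norm y)) ^ 4"
    using assms mult_mono[of 1 "1 + norm x" 1 "1 + norm y"] by (intro power_increasing) auto
  finally show ?thesis by (simp add: power_mult_distrib)
qed

lemma kernel_bdd_G: "kernel_bdd 1 G0k" "kernel_bdd 1 G1k" "kernel_bdd 1 G3k"
proof -
  have "\<bar>G0k x y\<bar> \<le> 1 * (1 + norm x) ^ 4 * (1 + norm y) ^ 4" for x y
  proof -
    have "\<bar>G0k x y\<bar> = dist x y / (8 * pi)" unfolding G0k_def by simp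
    also have "\<dots> \<le> dist x y / 1" using pi_gt3 by (intro divide_left_mono) auto
    finally show ?thesis using dist_power_le_weight[of 1 x y] by simp
  qed
  moreover have "(\<lambda>(x, y). G0k x y) \<in> borel_measurable (borel \<Otimes>\<^sub>M borel)" unfolding G0k_def by measurable
  ultimately show "kernel_bdd 1 G0k" unfolding kernel_bdd_def by blast
  have "(\<lambda>(x, y). G1k x y) \<in> borel_measurable (borel \<Otimes>\<^sub>M borel)"
    "(\<lambda>(x, y). G3k x y) \<in> borel_measurable (borel \<Otimes>\<^sub>M borel)"
    unfolding G1k_def G3k_def by measurable
  moreover have "\<bar>G1k x y\<bar> \<le> 1 * (1 + norm x) ^ 4 * (1 + norm y) ^ 4"
    "\<bar>G3k x y\<bar> \<le> 1 * (1 + norm x) ^ 4 * (1 + norm y) ^ 4" for x y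
    using dist_power_le_weight[of 2 x y] dist_power_le_weight[of 4 x y] by (simp_all add: G1k_def G3k_def)
  ultimately show "kernel_bdd 1 G1k" "kernel_bdd 1 G3k" unfolding kernel_bdd_def by blast+
qed

lemma axis_nth_eq: "axis j a $ i = (if i = j then a else 0)"
  by (simp add: axis_def)

lemma sum_delta2:
  fixes F :: "3 \<Rightarrow> 3 \<Rightarrow> complex"
  shows "(\<Sum>k\<in>UNIV. \<Sum>l\<in>UNIV. if k = a then (if l = b then F k l else 0) else 0) = F a b"
proof -
  have "(\<Sum>l\<in>UNIV. if k = a then (if l = b then F k l else 0) else 0) = (if k = a then F k b else 0)" for k
    by (cases "k = a") simp_all
  then show ?thesis by simp
qed

lemma inner_vec3: "(x::real^3) \<bullet> y = (\<Sum>j\<in>UNIV. x $ j * y $ j)"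
  by (simp add: inner_vec_def)

lemma le_two_div: "0 \<le> a \<Longrightarrow> (1::real) \<le> r \<Longrightarrow> a / r ^ n \<le> a * 2 ^ n * (1 + r) powr (- real n)"
proof -
  assume a: "0 \<le> a" and r: "1 \<le> r"
  have "(1 + r) ^ n \<le> (2 * r) ^ n" using r by (intro power_mono) auto
  then have "1 / r ^ n \<le> 2 ^ n / (1 + r) ^ n" using r by (simp add: divide_simps power_mult_distrib)
  from mult_left_mono[OF this a] show ?thesis
    using r by (simp add: powr_minus_divide powr_realpow)
qed

lemma cmod_div_8pi: "cmod z \<le> a \<Longrightarrow> cmod (z / complex_of_real (8 * pi)) \<le> a"
proof -
  assume a: "cmod z \<le> a"
  have "cmod (z / complex_of_real (8 * pi)) = cmod z / (8 * pi)" by (simp add: norm_divide norm_mult)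
  also have "\<dots> \<le> cmod z / 1" using pi_gt3 by (intro divide_left_mono) auto
  finally show ?thesis using a by simp
qed

lemma G_symmetric: "G0k x y = G0k y x" "G1k x y = G1k y x" "G3k x y = G3k y x"
  unfolding G0k_def G1k_def G3k_def by (simp_all add: dist_commute)

locale decaying_potential =
  fixes V :: "real^3 \<Rightarrow> real" and \<beta> :: real
  assumes V_measurable: "V \<in> borel_measurable lborel"
    and V_decay: "\<exists>C. \<forall>x. \<bar>V x\<bar> \<le> C * (1 + norm x) powr (- \<beta>)"
    and V_nonzero: "L1norm V \<noteq> 0"
    and beta: "\<beta> > 11"
begin

abbreviation v where "v \<equiv> vfun V"
abbreviation U where "U \<equiv> sgnU V"
abbreviation vc :: fn where "vc \<equiv> \<lambda>x. complex_of_real (v x)"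

lemma V_borel [measurable]: "V \<in> borel_measurable borel"
  using V_measurable by simp

lemma v_measurable [measurable]: "v \<in> borel_measurable borel"
  unfolding vfun_def by measurable

lemma U_measurable [measurable]: "U \<in> borel_measurable borel"
  unfolding sgnU_def by measurable

lemma v_nonneg [simp]: "0 \<le> v x"
  unfolding vfun_def by simp

lemma v_square: "(v x)\<^sup>2 = \<bar>V x\<bar>"
  unfolding vfun_def by simp

lemma U_U [simp]: "complex_of_real (U x) * (complex_of_real (U x) * z) = z"
  unfolding sgnU_def by auto

lemma U_abs [simp]: "\<bar>U x\<bar> = 1"
  unfolding sgnU_def by auto

lemma V_eq: "V x = v x * (U x * v x)"
  using v_square[of x] unfolding sgnU_def by (auto simp: power2_eq_square abs_if split: if_splits)

definition wt :: fn where "wt x = complex_of_real ((1 + norm x) ^ 4 * v x)"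

lemma cmod_wt: "cmod (wt x) = (1 + norm x) ^ 4 * v x"
  unfolding wt_def norm_of_real by simp

text \<open>Here the decay threshold enters: \<open>(cmod (wt x))^2\<close> is at most a multiple of
  \<open>(1 + |x|)^(8 - \<beta>)\<close>, a function integrable in dimension 3 exactly when
  \<open>\<beta> > 11\<close>.\<close>

lemma sq_int_wt: "sq_int wt"
proof -
  obtain C where C: "\<And>x. \<bar>V x\<bar> \<le> C * (1 + norm x) powr (- \<beta>)" using V_decay by blast
  show ?thesis
  proof (rule sq_int_bound)
    show "wt \<in> borel_measurable borel" unfolding wt_def by measurable
    show "integrable lborel (\<lambda>x::real^3. C * (1 + norm x) powr (- (\<beta> - 8)))"
      by (intro integrable_mult_right integrable_one_plus_norm_powr) (use beta in auto)
    show "AE x in lborel. (cmod (wt x))\<^sup>2 \<le> C * (1 + norm x) powr (- (\<beta> - 8))"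
    proof (intro AE_I2)
      fix x :: "real^3"
      have "(cmod (wt x))\<^sup>2 = (1 + norm x) ^ 8 * \<bar>V x\<bar>"
        unfolding wt_def norm_of_real power2_abs power_mult_distrib v_square
        by (simp add: power_mult[symmetric])
      also have "\<dots> \<le> (1 + norm x) ^ 8 * (C * (1 + norm x) powr (- \<beta>))"
        by (intro mult_left_mono C) auto
      also have "\<dots> = C * ((1 + norm x) powr 8 * (1 + norm x) powr (- \<beta>))"
        by (simp add: powr_numeral add_pos_nonneg)
      also have "\<dots> = C * (1 + norm x) powr (- (\<beta> - 8))"
        using powr_add[of "1 + norm x" 8 "- \<beta>"] by simp
      finally show "(cmod (wt x))\<^sup>2 \<le> C * (1 + norm x) powr (- (\<beta> - 8))" .
    qed
  qed
qed

lemma sq_int_poly_v: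
  assumes "poly_bdd p"
  shows "sq_int (\<lambda>x. complex_of_real (p x * v x))"
proof -
  obtain c where c: "\<And>y. \<bar>p y\<bar> \<le> c * (1 + norm y) ^ 4" and [measurable]: "p \<in> borel_measurable borel"
    using assms unfolding poly_bdd_def by blast
  show ?thesis
  proof (rule sq_int_domin[OF _ sq_int_wt, of _ c])
    show "cmod (complex_of_real (p x * v x)) \<le> c * cmod (wt x)" for x
      using mult_right_mono[OF c[of x] v_nonneg[of x]]
      unfolding norm_of_real cmod_wt by (simp add: abs_mult mult.assoc)
  qed measurable
qed

lemma sq_int_vc: "sq_int vc"
  using sq_int_poly_v[OF poly_bdd_intros(1)[of 1]] by simp

lemma L1norm_eq: "L1norm V = (L2norm vc)\<^sup>2"
  unfolding L1norm_def L2norm_square by (simp add: v_square)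

lemma L1norm_pos: "0 < L1norm V"
  using V_nonzero L1norm_eq zero_le_power2[of "L2norm vc"] by linarith

lemma vc_nonzero:
  assumes "AE x in lborel. vc x * c = 0"
  shows "c = 0"
proof (rule ccontr)
  assume "c \<noteq> 0"
  then have "AE x in lborel. \<bar>V x\<bar> = 0"
    using assms by (auto simp: v_square[symmetric] elim: AE_mp)
  then have "L1norm V = 0" unfolding L1norm_def by (rule integral_eq_zero_AE)
  then show False using V_nonzero by simp
qed

text \<open>Each kernel operator is pointwise a moment (\<open>vGv_eq\<close>), so expanding a
  kernel in \<open>y\<close> turns operator identities into finite sums of moments.\<close>

definition mom :: "(real^3 \<Rightarrow> real) \<Rightarrow> fn \<Rightarrow> complex" where
  "mom p f = (LINT y|lborel. complex_of_real (p y) * mult v f y)"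

lemma vpair_eq_mom: "vpair V f = mom (\<lambda>_. 1) f"
  unfolding vpair_def mom_def mult_def by simp

lemma intop_eq_mom: "intop K (mult v f) x = mom (K x) f"
  unfolding intop_def mom_def ..

lemma mom_eq_inner: "mom p f = L2_inner (\<lambda>x. complex_of_real (p x * v x)) f"
  unfolding mom_def L2_inner_def mult_def by (simp add: mult.assoc)

lemma vpair_eq_inner: "vpair V f = L2_inner vc f"
  unfolding vpair_eq_mom mom_eq_inner by simp

lemma inner_eq_cnj_mom: "L2_inner f (\<lambda>x. complex_of_real (p x * v x)) = cnj (mom p f)"
  unfolding mom_eq_inner by (rule L2_inner_cnj)

lemma mom_integrable:
  assumes "poly_bdd p" "sq_int f"
  shows "integrable lborel (\<lambda>y. complex_of_real (p y) * mult v f y)"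
  using integrable_sq_int_mult[OF sq_int_poly_v[OF assms(1)] assms(2)]
  by (simp add: mult_def mult.assoc)

lemma mom_add:
  "poly_bdd p \<Longrightarrow> poly_bdd q \<Longrightarrow> sq_int f \<Longrightarrow> mom (\<lambda>y. p y + q y) f = mom p f + mom q f"
  unfolding mom_def of_real_add distrib_right
  by (rule Bochner_Integration.integral_add) (auto intro: mom_integrable)

lemma mom_cmult: "mom (\<lambda>y. c * p y) f = complex_of_real c * mom p f"
  unfolding mom_def by (simp add: mult.assoc)

lemma mom_sum:
  "finite I \<Longrightarrow> (\<And>i. i \<in> I \<Longrightarrow> poly_bdd (p i)) \<Longrightarrow> sq_int f \<Longrightarrow>
    mom (\<lambda>y. \<Sum>i\<in>I. p i y) f = (\<Sum>i\<in>I. mom (p i) f)"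
proof (induction I rule: finite_induct)
  case empty
  then show ?case by (simp add: mom_def)
next
  case (insert j I)
  then show ?case using mom_add[of "p j" "\<lambda>y. \<Sum>i\<in>I. p i y" f] poly_bdd_sum[of I p] by simp
qed

lemma mom_f_add: "poly_bdd p \<Longrightarrow> sq_int f \<Longrightarrow> sq_int g \<Longrightarrow> mom p (\<lambda>x. f x + g x) = mom p f + mom p g"
  unfolding mom_eq_inner by (intro L2_inner_add_right sq_int_poly_v)

lemma mom_f_cmult: "mom p (\<lambda>x. c * f x) = c * mom p f"
  unfolding mom_eq_inner by (rule L2_inner_cmult_right)

text \<open>One number that controls all moments of degree up to 4; it is also the constant in the
  remainder estimates at infinity.\<close>

definition absmom :: "fn \<Rightarrow> real" where
  "absmom f = (LINT y|lborel. cmod (wt y) * cmod (f y))"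

lemma absmom_nonneg [simp]: "0 \<le> absmom f"
  unfolding absmom_def by simp

lemma absmom_le: "sq_int f \<Longrightarrow> absmom f \<le> L2norm wt * L2norm f"
  unfolding absmom_def by (rule L2_Cauchy_Schwarz[OF sq_int_wt])

lemma mom_bound:
  assumes "\<And>y. \<bar>p y\<bar> \<le> c * (1 + norm y) ^ 4" "poly_bdd p" "sq_int f"
  shows "cmod (mom p f) \<le> c * absmom f"
proof -
  have "cmod (mom p f) \<le> (LINT y|lborel. norm (complex_of_real (p y) * mult v f y))"
    unfolding mom_def by (rule integral_norm_bound)
  also have "\<dots> \<le> (LINT y|lborel. c * (cmod (wt y) * cmod (f y)))"
  proof (rule integral_mono)
    show "integrable lborel (\<lambda>y. norm (complex_of_real (p y) * mult v f y))"
      by (intro integrable_norm mom_integrable assms)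
    show "integrable lborel (\<lambda>y. c * (cmod (wt y) * cmod (f y)))"
      using integrable_norm[OF integrable_sq_int_mult[OF sq_int_wt assms(3)]]
      by (simp add: norm_mult)
    fix y
    have "\<bar>p y\<bar> * (v y * cmod (f y)) \<le> c * (1 + norm y) ^ 4 * (v y * cmod (f y))"
      by (intro mult_right_mono assms(1)) auto
    then show "norm (complex_of_real (p y) * mult v f y) \<le> c * (cmod (wt y) * cmod (f y))"
      by (simp add: norm_mult mult_def cmod_wt mult.assoc)
  qed
  also have "\<dots> = c * absmom f" unfolding absmom_def by simp
  finally show ?thesis .
qed

lemma vGv_eq: "vGv K V f x = vc x * mom (K x) f"
  unfolding vGv_def mult_def[of v "intop K (mult v f)"] intop_eq_mom ..

lemma mom_kernel_measurable:
  assumes "kernel_bdd c K" "sq_int f"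
  shows "(\<lambda>x. mom (K x) f) \<in> borel_measurable borel"
proof -
  have [measurable]: "(\<lambda>(x, y). K x y) \<in> borel_measurable (borel \<Otimes>\<^sub>M borel)"
    using assms unfolding kernel_bdd_def by blast
  note [measurable] = sq_intD(1)[OF assms(2)]
  have "(\<lambda>x. LINT y|lborel. complex_of_real (K x y) * mult v f y) \<in> borel_measurable lborel"
    unfolding mult_def by measurable
  then show ?thesis unfolding mom_def by simp
qed

lemma vGv_bound:
  assumes "kernel_bdd c K" "sq_int f"
  shows "cmod (vGv K V f x) \<le> c * cmod (wt x) * absmom f"
proof -
  have "cmod (mom (K x) f) \<le> c * (1 + norm x) ^ 4 * absmom f"
    by (rule mom_bound[OF _ kernel_bdd_poly_bdd[OF assms(1)] assms(2)])
      (use assms(1) in \<open>auto simp: kernel_bdd_def\<close>)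
  from mult_left_mono[OF this v_nonneg[of x]] show ?thesis
    unfolding vGv_eq by (simp add: norm_mult cmod_wt mult_ac)
qed

lemma sq_int_vGv:
  assumes "kernel_bdd c K" "sq_int f"
  shows "sq_int (vGv K V f)"
proof (rule sq_int_domin[OF _ sq_int_wt])
  note [measurable] = mom_kernel_measurable[OF assms]
  show "vGv K V f \<in> borel_measurable borel" unfolding vGv_eq[abs_def] by measurable
  show "cmod (vGv K V f x) \<le> c * absmom f * cmod (wt x)" for x
    using vGv_bound[OF assms, of x] by (simp add: mult_ac)
qed

lemma vGv_add:
  "kernel_bdd c K \<Longrightarrow> sq_int f \<Longrightarrow> sq_int g \<Longrightarrow>
    vGv K V (\<lambda>x. f x + g x) = (\<lambda>x. vGv K V f x + vGv K V g x)"
  unfolding vGv_eq by (simp add: mom_f_add kernel_bdd_poly_bdd distrib_left)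

lemma vGv_cmult: "vGv K V (\<lambda>x. c * f x) = (\<lambda>x. c * vGv K V f x)"
  unfolding vGv_eq by (simp add: mom_f_cmult mult.left_commute)

lemma vGv_symmetric:
  assumes K: "kernel_bdd c K" "\<And>x y. K x y = K y x" and f: "sq_int f" and g: "sq_int g"
  shows "L2_inner g (vGv K V f) = L2_inner (vGv K V g) f"
proof -
  have [measurable]: "(\<lambda>(x, y). K x y) \<in> borel_measurable (borel \<Otimes>\<^sub>M borel)"
    using K(1) unfolding kernel_bdd_def by blast
  note [measurable] = sq_intD(1)[OF f] sq_intD(1)[OF g]
  define H where "H = (\<lambda>x y. cnj (mult v g x) * (complex_of_real (K x y) * mult v f y))"
  have [measurable]: "(\<lambda>x. mult v g x) \<in> borel_measurable borel" "(\<lambda>x. mult v f x) \<in> borel_measurable borel"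
    unfolding mult_def by measurable
  have "integrable (lborel \<Otimes>\<^sub>M lborel) (\<lambda>(x, y). H x y)"
  proof (rule integrable_pair_bound)
    show "integrable lborel (\<lambda>x. \<bar>c\<bar> * (cmod (wt x) * cmod (g x)))" "integrable lborel (\<lambda>x. cmod (wt x) * cmod (f x))"
      using integrable_norm[OF integrable_sq_int_mult[OF sq_int_wt f]]
        integrable_norm[OF integrable_sq_int_mult[OF sq_int_wt g]]
      by (simp_all add: norm_mult)
    show "(\<lambda>(x, y). H x y) \<in> borel_measurable (lborel \<Otimes>\<^sub>M lborel)" unfolding H_def by measurable
    fix x y
    have "\<bar>K x y\<bar> \<le> c * (1 + norm x) ^ 4 * (1 + norm y) ^ 4" using K(1) unfolding kernel_bdd_def by blast
    also have "\<dots> \<le> \<bar>c\<bar> * (1 + norm x) ^ 4 * (1 + norm y) ^ 4" by (intro mult_right_mono) auto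
    finally have "\<bar>K x y\<bar> * (v x * cmod (g x) * (v y * cmod (f y)))
        \<le> \<bar>c\<bar> * (1 + norm x) ^ 4 * (1 + norm y) ^ 4 * (v x * cmod (g x) * (v y * cmod (f y)))"
      by (intro mult_right_mono) auto
    then show "cmod (case (x, y) of (x, y) \<Rightarrow> H x y) \<le> \<bar>c\<bar> * (cmod (wt x) * cmod (g x)) * (cmod (wt y) * cmod (f y))"
      by (simp add: H_def mult_def cmod_wt norm_mult mult_ac)
  qed
  from lborel_pair.Fubini_integral[OF this]
  have *: "(LINT y|lborel. LINT x|lborel. H x y) = (LINT x|lborel. LINT y|lborel. H x y)" .
  have "L2_inner g (vGv K V f) = (LINT x|lborel. LINT y|lborel. H x y)"
    unfolding L2_inner_def vGv_eq mom_def H_def mult_def[of v g] by (simp add: mult_ac)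
  also have "\<dots> = (LINT y|lborel. LINT x|lborel. H x y)" using * by simp
  also have "\<dots> = L2_inner (vGv K V g) f"
    unfolding L2_inner_def
  proof (intro Bochner_Integration.integral_cong refl)
    fix y
    have "(LINT x|lborel. H x y) = (LINT x|lborel. mult v f y * cnj (complex_of_real (K y x) * mult v g x))"
      unfolding H_def using K(2) by (intro Bochner_Integration.integral_cong) (auto simp: mult_ac)
    also have "\<dots> = mult v f y * cnj (mom (K y) g)"
      unfolding mom_def by (simp only: integral_mult_right_zero Bochner_Integration.integral_cnj)
    finally show "(LINT x|lborel. H x y) = cnj (vGv K V g y) * f y"
      unfolding vGv_eq mult_def by (simp add: mult_ac)
  qed
  finally show ?thesis .
qed

lemma sq_int_Top: "sq_int f \<Longrightarrow> sq_int (Top V f)"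
proof -
  assume f: "sq_int f"
  note [measurable] = sq_intD(1)[OF f]
  have "sq_int (\<lambda>x. complex_of_real (U x) * f x)"
    by (rule sq_int_domin[OF _ f, of _ 1]) (auto simp: norm_mult)
  then show ?thesis unfolding Top_def by (intro sq_int_add sq_int_vGv[OF kernel_bdd_G(1) f])
qed

lemma Top_add: "sq_int f \<Longrightarrow> sq_int g \<Longrightarrow> Top V (\<lambda>x. f x + g x) = (\<lambda>x. Top V f x + Top V g x)"
  unfolding Top_def by (simp add: vGv_add[OF kernel_bdd_G(1)] algebra_simps)

lemma Top_cmult: "Top V (\<lambda>x. c * f x) = (\<lambda>x. c * Top V f x)"
  unfolding Top_def by (simp add: vGv_cmult algebra_simps)

lemma Top_symmetric:
  assumes f: "sq_int f" and g: "sq_int g"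
  shows "L2_inner g (Top V f) = L2_inner (Top V g) f"
proof -
  note [measurable] = sq_intD(1)[OF f] sq_intD(1)[OF g]
  have Uf: "sq_int (\<lambda>x. complex_of_real (U x) * h x)" if "sq_int h" for h
    using that by (intro sq_int_domin[OF _ that, of _ 1]) (auto simp: norm_mult dest: sq_intD)
  have "L2_inner g (\<lambda>x. complex_of_real (U x) * f x) = L2_inner (\<lambda>x. complex_of_real (U x) * g x) f"
    unfolding L2_inner_def by (simp add: mult_ac)
  then show ?thesis
    unfolding Top_def using f g
    by (simp add: L2_inner_add_right L2_inner_add_left Uf sq_int_vGv[OF kernel_bdd_G(1)]
        vGv_symmetric[OF kernel_bdd_G(1) G_symmetric(1)])
qed

section \<open>The functional \<open>\<tau>\<close> and the space \<open>S1L2\<close>: explicit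
  equation and finite dimension\<close>

definition \<tau> :: "fn \<Rightarrow> complex" where "\<tau> f = vpair V (Top V f)"

text \<open>Moving \<open>T\<close> onto \<open>v\<close> exhibits \<open>\<tau>\<close> as the
  pairing with one fixed square-integrable function, from which linearity and boundedness
  follow.\<close>

lemma \<tau>_eq: "sq_int f \<Longrightarrow> \<tau> f = L2_inner (Top V vc) f"
  unfolding \<tau>_def vpair_eq_inner by (rule Top_symmetric[OF _ sq_int_vc])

lemma \<tau>_add: "sq_int f \<Longrightarrow> sq_int g \<Longrightarrow> \<tau> (\<lambda>x. f x + g x) = \<tau> f + \<tau> g"
  by (simp add: \<tau>_eq sq_int_add L2_inner_add_right sq_int_Top sq_int_vc)

lemma \<tau>_cmult: "sq_int f \<Longrightarrow> \<tau> (\<lambda>x. c * f x) = c * \<tau> f"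
  by (simp add: \<tau>_eq sq_int_cmult L2_inner_cmult_right)

lemma vpair_add: "sq_int f \<Longrightarrow> sq_int g \<Longrightarrow> vpair V (\<lambda>x. f x + g x) = vpair V f + vpair V g"
  unfolding vpair_eq_mom by (rule mom_f_add[OF poly_bdd_intros(1)])

lemma vpair_cmult: "vpair V (\<lambda>x. c * f x) = c * vpair V f"
  unfolding vpair_eq_mom by (rule mom_f_cmult)

text \<open>\<open>Q f = f\<close> amounts to mean zero against \<open>v\<close>, because
  \<open>v\<close> is not almost everywhere zero. Then \<open>Q T f = 0\<close> says that
  \<open>T f\<close> equals its own component along \<open>v\<close>, whose coefficient is
  \<open>\<tau> f / L1norm V\<close>.\<close>

lemma S1L2_iff:
  "f \<in> S1L2 V \<longleftrightarrow> sq_int f \<and> vpair V f = 0 \<and>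
     aeq (Top V f) (\<lambda>x. \<tau> f / complex_of_real (L1norm V) * vc x)"
proof -
  have Pop: "Pop V g = (\<lambda>x. vpair V g / complex_of_real (L1norm V) * vc x)" for g
    unfolding Pop_def by (simp add: mult_ac)
  have Q: "aeq (Qop V f) f \<longleftrightarrow> vpair V f = 0"
  proof
    assume "aeq (Qop V f) f"
    then have "AE x in lborel. vc x * (vpair V f / complex_of_real (L1norm V)) = 0"
      unfolding aeq_def Qop_def Pop by eventually_elim auto
    from vc_nonzero[OF this] show "vpair V f = 0" using V_nonzero by simp
  qed (simp add: Qop_def Pop_def)
  have "Qop V f = f" if "vpair V f = 0" using that by (simp add: Qop_def Pop_def)
  moreover have "aeq (Qop V (Top V f)) (\<lambda>_. 0) \<longleftrightarrow>
      aeq (Top V f) (\<lambda>x. \<tau> f / complex_of_real (L1norm V) * vc x)"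
    unfolding aeq_def Qop_def Pop \<tau>_def by simp
  ultimately show ?thesis unfolding S1L2_def QL2_def using Q by auto
qed

lemma S1L2_sq_int: "f \<in> S1L2 V \<Longrightarrow> sq_int f" and S1L2_vpair: "f \<in> S1L2 V \<Longrightarrow> vpair V f = 0"
  unfolding S1L2_iff by blast+

lemma S1L2_subspace: "L2_subspace (S1L2 V)"
  unfolding L2_subspace_def
proof (intro conjI ballI allI)
  show "sq_int f" if "f \<in> S1L2 V" for f using that by (rule S1L2_sq_int)
  show cm: "(\<lambda>x. c * f x) \<in> S1L2 V" if "f \<in> S1L2 V" for f c
    using that unfolding S1L2_iff aeq_def
    by (auto simp: sq_int_cmult vpair_cmult Top_cmult \<tau>_cmult elim: AE_mp)
  show "(\<lambda>x. f x + g x) \<in> S1L2 V" if "f \<in> S1L2 V" "g \<in> S1L2 V" for f g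
  proof -
    have s: "sq_int f" "sq_int g" using that by (auto intro: S1L2_sq_int)
    have "AE x in lborel. Top V f x = \<tau> f / complex_of_real (L1norm V) * vc x"
      "AE x in lborel. Top V g x = \<tau> g / complex_of_real (L1norm V) * vc x"
      using that unfolding S1L2_iff aeq_def by auto
    then have "AE x in lborel. Top V (\<lambda>x. f x + g x) x = \<tau> (\<lambda>x. f x + g x) / complex_of_real (L1norm V) * vc x"
      unfolding Top_add[OF s] \<tau>_add[OF s] by eventually_elim (simp add: add_divide_distrib distrib_right)
    then show ?thesis
      unfolding S1L2_iff aeq_def using s that by (auto simp: sq_int_add vpair_add S1L2_vpair)
  qed
  have "(\<lambda>x. 0 * (0::complex)) \<in> S1L2 V"
    unfolding S1L2_iff aeq_def using Top_cmult[of 0 "\<lambda>_. 0"]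
    by (auto simp: sq_int_zero vpair_eq_mom mom_def mult_def \<tau>_def)
  then show "(\<lambda>_. 0) \<in> S1L2 V" by simp
qed

text \<open>Since \<open>U\<close> squares to 1, the equation of \<open>S1L2_iff\<close> can be
  solved for \<open>f\<close>. This gives \<open>f = R f\<close> almost everywhere, with
  \<open>R f x\<close> bounded at every point by \<open>A * cmod (wt x) * L2norm f\<close>.\<close>

lemma S1L2_dim: "\<exists>N. dim_at_most (S1L2 V) N"
proof (rule dim_at_most_if_pointwise_bounded)
  define R where "R f x = complex_of_real (U x) * (\<tau> f / complex_of_real (L1norm V) * vc x - vGv G0k V f x)" for f x
  define A where "A = L2norm (Top V vc) / L1norm V + L2norm wt"
  show "sq_int f \<and> aeq f (R f)" if "f \<in> S1L2 V" for f
  proof -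
    have "AE x in lborel. Top V f x = \<tau> f / complex_of_real (L1norm V) * vc x"
      using that unfolding S1L2_iff aeq_def by blast
    then have "AE x in lborel. f x = R f x"
    proof eventually_elim
      case (elim x)
      then have "complex_of_real (U x) * f x = \<tau> f / complex_of_real (L1norm V) * vc x - vGv G0k V f x"
        unfolding Top_def by (simp add: algebra_simps)
      then show ?case unfolding R_def using U_U[of x "f x"] by simp
    qed
    then show ?thesis using S1L2_sq_int[OF that] unfolding aeq_def by blast
  qed
  have add: "R (\<lambda>x. f x + g x) x = R f x + R g x" if "sq_int f" "sq_int g" for f g x
    unfolding R_def \<tau>_add[OF that] vGv_add[OF kernel_bdd_G(1) that]
    by (simp add: algebra_simps add_divide_distrib)
  have cm: "R (\<lambda>x. c * f x) x = c * R f x" if "sq_int f" for c f x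
    unfolding R_def \<tau>_cmult[OF that] vGv_cmult by (simp add: algebra_simps)
  show "R (\<lambda>x. \<Sum>i<m. c i * e i x) x = (\<Sum>i<m. c i * R (e i) x)"
    if "\<And>i. i < m \<Longrightarrow> e i \<in> S1L2 V" for m :: nat and c e x
    using that
  proof (induction m)
    case 0
    then show ?case using cm[OF sq_int_zero, of 0 x] by simp
  next
    case (Suc m)
    have e: "sq_int (e i)" if "i < Suc m" for i using Suc.prems[OF that] by (rule S1L2_sq_int)
    have "sq_int (\<lambda>x. \<Sum>i<m. c i * e i x)" by (intro sq_int_sum sq_int_cmult) (auto intro: e)
    then show ?case using Suc e[of m] by (simp add: add cm sq_int_cmult)
  qed
  show "cmod (R f x) \<le> A * cmod (wt x) * L2norm f" if f: "sq_int f" for f x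
  proof -
    have t: "cmod (\<tau> f) \<le> L2norm (Top V vc) * L2norm f"
      unfolding \<tau>_eq[OF f] L2_inner_def
      using cmod_integral_mult_le[OF sq_int_cnj[OF sq_int_Top[OF sq_int_vc]] f] by simp
    have vw: "v x \<le> cmod (wt x)"
      using mult_right_mono[OF one_le_weight[of x 4] v_nonneg[of x]] by (simp add: cmod_wt)
    have "cmod (R f x) \<le> cmod (\<tau> f) / L1norm V * v x + cmod (vGv G0k V f x)"
      using norm_triangle_ineq4[of "\<tau> f / complex_of_real (L1norm V) * vc x" "vGv G0k V f x"] L1norm_pos
      unfolding R_def by (simp add: norm_mult norm_divide)
    also have "\<dots> \<le> L2norm (Top V vc) * L2norm f / L1norm V * cmod (wt x) + cmod (wt x) * (L2norm wt * L2norm f)"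
    proof (rule add_mono)
      show "cmod (\<tau> f) / L1norm V * v x \<le> L2norm (Top V vc) * L2norm f / L1norm V * cmod (wt x)"
        using t vw L1norm_pos by (intro mult_mono divide_right_mono) auto
      have "cmod (vGv G0k V f x) \<le> cmod (wt x) * absmom f"
        using vGv_bound[OF kernel_bdd_G(1) f, of x] by simp
      also have "\<dots> \<le> cmod (wt x) * (L2norm wt * L2norm f)" using absmom_le[OF f] by (intro mult_left_mono) auto
      finally show "cmod (vGv G0k V f x) \<le> cmod (wt x) * (L2norm wt * L2norm f)" .
    qed
    also have "\<dots> = A * cmod (wt x) * L2norm f" unfolding A_def by (simp add: algebra_simps)
    finally show ?thesis .
  qed
  show "integrable lborel (\<lambda>x. (A * cmod (wt x))\<^sup>2)"
    using sq_intD(2)[OF sq_int_wt] by (simp add: power_mult_distrib)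
  show "R f \<in> borel_measurable borel" if "f \<in> S1L2 V" for f
  proof -
    note [measurable] = sq_intD(1)[OF sq_int_vGv[OF kernel_bdd_G(1) S1L2_sq_int[OF that]]]
    show ?thesis unfolding R_def by measurable
  qed
qed

section \<open>Moments of order one and two; the forms of \<open>G1\<close> and \<open>G3\<close> on
  functions with vanishing lower moments\<close>

abbreviation m1 :: "3 \<Rightarrow> fn \<Rightarrow> complex" where "m1 j \<equiv> mom (\<lambda>y. y $ j)"
abbreviation m2 :: "3 \<Rightarrow> 3 \<Rightarrow> fn \<Rightarrow> complex" where "m2 i j \<equiv> mom (\<lambda>y. y $ i * y $ j)"
abbreviation mr :: "fn \<Rightarrow> complex" where "mr \<equiv> mom (\<lambda>y. (norm y)\<^sup>2)"

lemma mr_eq: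
  assumes "sq_int f"
  shows "mr f = (\<Sum>i\<in>UNIV. m2 i i f)"
proof -
  have "mr f = mom (\<lambda>y. \<Sum>i\<in>UNIV. y $ i * y $ i) f"
    by (simp only: vec3_norm_square power2_eq_square[of "_ $ _"])
  also have "\<dots> = (\<Sum>i\<in>UNIV. m2 i i f)" by (rule mom_sum) (auto intro: poly_bdd_intros assms)
  finally show ?thesis .
qed

lemma mom_G1:
  assumes "sq_int f"
  shows "mom (G1k x) f = complex_of_real ((norm x)\<^sup>2) * vpair V f + mr f
    + (\<Sum>j\<in>UNIV. complex_of_real (- 2 * x $ j) * m1 j f)"
proof -
  have "G1k x = (\<lambda>y. ((norm x)\<^sup>2 * 1 + (norm y)\<^sup>2) + (\<Sum>j\<in>UNIV. (- 2 * x $ j) * y $ j))"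
    unfolding G1k_def dist_square_expand inner_vec3 by (simp add: sum_distrib_left sum_negf mult.assoc)
  then show ?thesis
    using assms
    by (simp only: mom_add mom_sum mom_cmult poly_bdd_add poly_bdd_cmult poly_bdd_sum poly_bdd_intros
        vpair_eq_mom finite)
qed

lemma mom_G3:
  assumes "sq_int f"
  shows "mom (G3k x) f = complex_of_real ((norm x) ^ 4) * vpair V f + mom (\<lambda>y. (norm y) ^ 4) f
    + complex_of_real (2 * (norm x)\<^sup>2) * mr f
    + (\<Sum>i\<in>UNIV. \<Sum>j\<in>UNIV. complex_of_real (4 * (x $ i * x $ j)) * m2 i j f)
    + (\<Sum>j\<in>UNIV. complex_of_real (- 4 * (norm x)\<^sup>2 * x $ j) * m1 j f)
    + (\<Sum>j\<in>UNIV. complex_of_real (- 4 * x $ j) * mom (\<lambda>y. (norm y)\<^sup>2 * y $ j) f)"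
proof -
  have "G3k x y = (((((norm x) ^ 4 * 1 + (norm y) ^ 4) + (2 * (norm x)\<^sup>2) * (norm y)\<^sup>2)
      + (\<Sum>i\<in>UNIV. \<Sum>j\<in>UNIV. (4 * (x $ i * x $ j)) * (y $ i * y $ j)))
      + (\<Sum>j\<in>UNIV. (- 4 * (norm x)\<^sup>2 * x $ j) * y $ j))
      + (\<Sum>j\<in>UNIV. (- 4 * x $ j) * ((norm y)\<^sup>2 * y $ j))" for y
  proof -
    have a: "(\<Sum>i\<in>UNIV. \<Sum>j\<in>UNIV. (4 * (x $ i * x $ j)) * (y $ i * y $ j)) = 4 * (x \<bullet> y)\<^sup>2"
      unfolding inner_vec3 power2_eq_square sum_product by (simp add: sum_distrib_left mult_ac)
    have b: "(\<Sum>j\<in>UNIV. (- 4 * (norm x)\<^sup>2 * x $ j) * y $ j) = - 4 * (norm x)\<^sup>2 * (x \<bullet> y)"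
      unfolding inner_vec3 sum_distrib_left by (simp add: mult_ac)
    have c: "(\<Sum>j\<in>UNIV. (- 4 * x $ j) * ((norm y)\<^sup>2 * y $ j)) = - 4 * (norm y)\<^sup>2 * (x \<bullet> y)"
      unfolding inner_vec3 sum_distrib_left by (simp add: mult_ac)
    have "G3k x y = ((norm x)\<^sup>2 + (norm y)\<^sup>2 - 2 * (x \<bullet> y))\<^sup>2"
      unfolding G3k_def dist_square_expand[symmetric] by (simp add: power_mult[symmetric])
    then show ?thesis unfolding a b c by algebra
  qed
  then have "G3k x = (\<lambda>y. (((((norm x) ^ 4 * 1 + (norm y) ^ 4) + (2 * (norm x)\<^sup>2) * (norm y)\<^sup>2)
      + (\<Sum>i\<in>UNIV. \<Sum>j\<in>UNIV. (4 * (x $ i * x $ j)) * (y $ i * y $ j)))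
      + (\<Sum>j\<in>UNIV. (- 4 * (norm x)\<^sup>2 * x $ j) * y $ j))
      + (\<Sum>j\<in>UNIV. (- 4 * x $ j) * ((norm y)\<^sup>2 * y $ j)))" by blast
  then show ?thesis
    using assms
    by (simp only: mom_add mom_sum mom_cmult poly_bdd_add poly_bdd_cmult poly_bdd_sum poly_bdd_intros
        vpair_eq_mom finite)
qed

lemmas poly_v = sq_int_poly_v[OF poly_bdd_intros(1)[of 1]] sq_int_poly_v[OF poly_bdd_intros(2)]
  sq_int_poly_v[OF poly_bdd_intros(3)] sq_int_poly_v[OF poly_bdd_intros(4)]

text \<open>In \<open>|x|^2 + |y|^2 - 2 (x \<bullet> y)\<close> the first two terms are constant in
  one variable and die on mean-zero functions. The surviving sign is negative, and the minus sign in
  \<open>T1\<close> turns it into a non-negative form.\<close>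

lemma inner_vG1v:
  assumes f: "sq_int f" "vpair V f = 0" and k: "sq_int k" "vpair V k = 0"
  shows "L2_inner k (vGv G1k V f) = - 2 * (\<Sum>j\<in>UNIV. cnj (m1 j k) * m1 j f)"
proof -
  have "vGv G1k V f = (\<lambda>x. mr f * complex_of_real (1 * v x)
      + (\<Sum>j\<in>UNIV. (- 2 * m1 j f) * complex_of_real (x $ j * v x)))"
    unfolding vGv_eq mom_G1[OF f(1)] f(2) by (simp add: sum_distrib_left algebra_simps)
  then have "L2_inner k (vGv G1k V f) = mr f * cnj (mom (\<lambda>_. 1) k)
      + (\<Sum>j\<in>UNIV. (- 2 * m1 j f) * cnj (m1 j k))"
    using k(1)
    by (simp only: L2_inner_add_right L2_inner_sum_right L2_inner_cmult_right inner_eq_cnj_mom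
        poly_v sq_int_cmult sq_int_sum finite)
  then show ?thesis using k(2) by (simp add: vpair_eq_mom sum_distrib_left mult_ac)
qed

text \<open>When the same expansion is squared, the terms in \<open>|x|^4\<close>,
  \<open>|y|^4\<close>, \<open>|x|^2 (x \<bullet> y)\<close> and
  \<open>|y|^2 (x \<bullet> y)\<close> have degree at most one in some variable and vanish. There
  remain \<open>2 |x|^2 |y|^2\<close> and \<open>4 (x \<bullet> y)^2\<close>.\<close>

lemma inner_vG3v:
  assumes f: "sq_int f" "vpair V f = 0" "\<And>j. m1 j f = 0" and k: "sq_int k" "vpair V k = 0" "\<And>j. m1 j k = 0"
  shows "L2_inner k (vGv G3k V f) = 2 * (cnj (mr k) * mr f)
    + 4 * (\<Sum>i\<in>UNIV. \<Sum>j\<in>UNIV. cnj (m2 i j k) * m2 i j f)"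
proof -
  have "vGv G3k V f = (\<lambda>x. ((mom (\<lambda>y. (norm y) ^ 4) f * complex_of_real (1 * v x)
      + (2 * mr f) * complex_of_real ((norm x)\<^sup>2 * v x))
      + (\<Sum>i\<in>UNIV. \<Sum>j\<in>UNIV. (4 * m2 i j f) * complex_of_real ((x $ i * x $ j) * v x)))
      + (\<Sum>j\<in>UNIV. (- 4 * mom (\<lambda>y. (norm y)\<^sup>2 * y $ j) f) * complex_of_real (x $ j * v x)))"
    unfolding vGv_eq mom_G3[OF f(1)] f(2,3) by (simp add: sum_distrib_left algebra_simps)
  then have "L2_inner k (vGv G3k V f) = ((mom (\<lambda>y. (norm y) ^ 4) f * cnj (mom (\<lambda>_. 1) k)
      + (2 * mr f) * cnj (mr k))
      + (\<Sum>i\<in>UNIV. \<Sum>j\<in>UNIV. (4 * m2 i j f) * cnj (m2 i j k)))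
      + (\<Sum>j\<in>UNIV. (- 4 * mom (\<lambda>y. (norm y)\<^sup>2 * y $ j) f) * cnj (m1 j k))"
    using k(1)
    by (simp only: L2_inner_add_right L2_inner_sum_right L2_inner_cmult_right inner_eq_cnj_mom
        poly_v sq_int_cmult sq_int_sum sq_int_add finite)
  then show ?thesis using k(2,3) by (simp add: vpair_eq_mom sum_distrib_left mult_ac)
qed

section \<open>The projection \<open>S1\<close>, the form of \<open>T1\<close> and its kernel
  \<open>S2L2\<close>\<close>

lemma S1_proj:
  assumes "sq_int g"
  shows "S1 V g \<in> S1L2 V" and "k \<in> S1L2 V \<Longrightarrow> L2_inner k (S1 V g) = L2_inner k g"
proof -
  obtain N where N: "dim_at_most (S1L2 V) N" using S1L2_dim by blast
  show "S1 V g \<in> S1L2 V" "k \<in> S1L2 V \<Longrightarrow> L2_inner k (S1 V g) = L2_inner k g"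
    unfolding S1_def by (rule orth_proj[OF S1L2_subspace N assms]; assumption)+
qed

definition T1coef :: real where "T1coef = L1norm V / (3 * (8 * pi)\<^sup>2)"

lemma T1coef_pos: "0 < T1coef"
  unfolding T1coef_def using L1norm_pos by simp

text \<open>The sesquilinear form of \<open>T1\<close> on \<open>S1L2\<close>: a rank-one part from
  \<open>P\<close> and a part from \<open>G1\<close>, whose factor \<open>-2\<close> meets the minus
  sign in \<open>T1\<close>.\<close>

definition T1form :: "fn \<Rightarrow> fn \<Rightarrow> complex" where
  "T1form k f = cnj (\<tau> k) * \<tau> f / complex_of_real (L1norm V)
     + complex_of_real (2 * T1coef) * (\<Sum>j\<in>UNIV. cnj (m1 j k) * m1 j f)"

lemma sq_int_Pop: "sq_int (Pop V f)"
  unfolding Pop_def using sq_int_mult_const[OF sq_int_vc, of "vpair V f / complex_of_real (L1norm V)"]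
  by (simp add: mult_ac)

lemma T1_S1L2:
  assumes f: "f \<in> S1L2 V"
  shows "T1 V f \<in> S1L2 V" and "k \<in> S1L2 V \<Longrightarrow> L2_inner k (T1 V f) = T1form k f"
proof -
  note sf = S1L2_sq_int[OF f]
  let ?a = "S1 V (Top V (Pop V (Top V f)))" and ?b = "S1 V (vGv G1k V f)"
  have sP: "sq_int (Pop V (Top V f))" by (rule sq_int_Pop)
  have sG: "sq_int (vGv G1k V f)" by (rule sq_int_vGv[OF kernel_bdd_G(2) sf])
  note a = S1_proj[OF sq_int_Top[OF sP]] and b = S1_proj[OF sG]
  have eq: "T1 V f = (\<lambda>x. ?a x - complex_of_real T1coef * ?b x)"
    unfolding T1_def T1coef_def ..
  have cb: "(\<lambda>x. complex_of_real T1coef * ?b x) \<in> S1L2 V"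
    using b(1) S1L2_subspace unfolding L2_subspace_def by blast
  show "T1 V f \<in> S1L2 V"
    unfolding eq by (rule L2_subspace_diff[OF S1L2_subspace a(1) cb])
  assume k: "k \<in> S1L2 V"
  note sk = S1L2_sq_int[OF k]
  have "L2_inner k (T1 V f) = L2_inner k ?a - complex_of_real T1coef * L2_inner k ?b"
    unfolding eq using L2_inner_diff_right[OF sk S1L2_sq_int[OF a(1)] S1L2_sq_int[OF cb]]
    by (simp add: L2_inner_cmult_right)
  also have "L2_inner k ?a = cnj (\<tau> k) * \<tau> f / complex_of_real (L1norm V)"
  proof -
    have "L2_inner k ?a = L2_inner (Top V k) (Pop V (Top V f))"
      using a(2)[OF k] Top_symmetric[OF sP sk] by simp
    also have "\<dots> = L2_inner (Top V k) (\<lambda>x. (\<tau> f / complex_of_real (L1norm V)) * vc x)"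
      unfolding Pop_def \<tau>_def by (simp add: mult_ac)
    also have "L2_inner (Top V k) (\<lambda>x. (\<tau> f / complex_of_real (L1norm V)) * vc x)
        = \<tau> f / complex_of_real (L1norm V) * cnj (\<tau> k)"
      unfolding L2_inner_cmult_right \<tau>_def[of k] vpair_eq_inner L2_inner_cnj[of "Top V k"] ..
    finally show ?thesis by simp
  qed
  also have "L2_inner k ?b = - 2 * (\<Sum>j\<in>UNIV. cnj (m1 j k) * m1 j f)"
    using b(2)[OF k] inner_vG1v[OF sf S1L2_vpair[OF f] sk S1L2_vpair[OF k]] by simp
  finally show "L2_inner k (T1 V f) = T1form k f" unfolding T1form_def by simp
qed

lemma T1form_self:
  "T1form f f = complex_of_real ((cmod (\<tau> f))\<^sup>2 / L1norm V + 2 * T1coef * (\<Sum>j\<in>UNIV. (cmod (m1 j f))\<^sup>2))"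
  unfolding T1form_def by (simp add: complex_norm_square mult.commute flip: of_real_power)

text \<open>Stated with \<open>\<le> 0\<close> so that it also applies after a further non-negative
  term, the squared norm of \<open>S2 V h\<close>, has been dropped from a vanishing sum.\<close>

lemma T1form_self_eq_0:
  assumes "(cmod (\<tau> f))\<^sup>2 / L1norm V + 2 * T1coef * (\<Sum>j\<in>UNIV. (cmod (m1 j f))\<^sup>2) \<le> 0"
  shows "\<tau> f = 0" "m1 j f = 0"
proof -
  have n: "0 \<le> (cmod (\<tau> f))\<^sup>2 / L1norm V" "0 \<le> (\<Sum>j\<in>UNIV. (cmod (m1 j f))\<^sup>2)"
    using L1norm_pos by (auto intro: sum_nonneg)
  have "0 \<le> 2 * T1coef * (\<Sum>j\<in>UNIV. (cmod (m1 j f))\<^sup>2)" using n T1coef_pos by simp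
  with n assms have "(cmod (\<tau> f))\<^sup>2 / L1norm V = 0" "2 * T1coef * (\<Sum>j\<in>UNIV. (cmod (m1 j f))\<^sup>2) = 0"
    by linarith+
  then show "\<tau> f = 0" "m1 j f = 0"
    using L1norm_pos T1coef_pos by (auto simp: sum_nonneg_eq_0_iff)
qed

lemma S2L2_iff: "f \<in> S2L2 V \<longleftrightarrow> f \<in> S1L2 V \<and> \<tau> f = 0 \<and> (\<forall>j. m1 j f = 0)"
proof
  assume "f \<in> S2L2 V"
  then have f: "f \<in> S1L2 V" and z: "aeq (T1 V f) (\<lambda>_. 0)" unfolding S2L2_def by auto
  have "L2_inner f (T1 V f) = L2_inner f (\<lambda>_. 0)"
    by (rule L2_inner_cong[OF aeq_refl z])
      (use sq_intD(1)[OF S1L2_sq_int[OF f]] sq_intD(1)[OF S1L2_sq_int[OF T1_S1L2(1)[OF f]]] in auto)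
  then have "T1form f f = 0" using T1_S1L2(2)[OF f f] by simp
  then have "(cmod (\<tau> f))\<^sup>2 / L1norm V + 2 * T1coef * (\<Sum>j\<in>UNIV. (cmod (m1 j f))\<^sup>2) = 0"
    unfolding T1form_self of_real_eq_0_iff .
  then show "f \<in> S1L2 V \<and> \<tau> f = 0 \<and> (\<forall>j. m1 j f = 0)" using f T1form_self_eq_0[of f] by auto
next
  assume f: "f \<in> S1L2 V \<and> \<tau> f = 0 \<and> (\<forall>j. m1 j f = 0)"
  have "aeq (T1 V f) (\<lambda>_. 0)"
  proof (rule aeq_if_L2_inner_eq[OF S1L2_subspace])
    show "T1 V f \<in> S1L2 V" using f T1_S1L2(1) by blast
    show "(\<lambda>_. 0) \<in> S1L2 V" using S1L2_subspace unfolding L2_subspace_def by blast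
    show "L2_inner k (T1 V f) = L2_inner k (\<lambda>_. 0)" if "k \<in> S1L2 V" for k
      using f that T1_S1L2(2)[of f k] by (simp add: T1form_def)
  qed
  then show "f \<in> S2L2 V" using f unfolding S2L2_def by blast
qed

lemma S2L2_subset: "S2L2 V \<subseteq> S1L2 V"
  by (auto simp: S2L2_iff)

lemma S2L2_subspace: "L2_subspace (S2L2 V)"
proof -
  have S1: "(\<lambda>_. 0) \<in> S1L2 V" "\<And>f g. f \<in> S1L2 V \<Longrightarrow> g \<in> S1L2 V \<Longrightarrow> (\<lambda>x. f x + g x) \<in> S1L2 V"
    "\<And>f c. f \<in> S1L2 V \<Longrightarrow> (\<lambda>x. c * f x) \<in> S1L2 V"
    using S1L2_subspace unfolding L2_subspace_def by blast+
  have "\<tau> (\<lambda>_. 0) = 0" using \<tau>_cmult[OF sq_int_zero, of 0] by simp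
  moreover have "m1 j (\<lambda>_. 0) = 0" for j using mom_f_cmult[of _ 0 "\<lambda>_. 0"] by simp
  ultimately show ?thesis unfolding L2_subspace_def
    by (auto simp: S2L2_iff S1 S1L2_sq_int \<tau>_add \<tau>_cmult mom_f_add mom_f_cmult poly_bdd_intros)
qed

section \<open>The projection \<open>S2\<close>, the inverse \<open>D1\<close> and the kernel
  \<open>S3L2\<close> of \<open>T2\<close>\<close>

lemma S2_proj:
  assumes "sq_int g"
  shows "S2 V g \<in> S2L2 V" and "k \<in> S2L2 V \<Longrightarrow> L2_inner k (S2 V g) = L2_inner k g"
proof -
  obtain N where "dim_at_most (S1L2 V) N" using S1L2_dim by blast
  then have N: "dim_at_most (S2L2 V) N" by (rule dim_at_most_mono[OF _ S2L2_subset])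
  show "S2 V g \<in> S2L2 V" "k \<in> S2L2 V \<Longrightarrow> L2_inner k (S2 V g) = L2_inner k g"
    unfolding S2_def by (rule orth_proj[OF S2L2_subspace N assms]; assumption)+
qed

lemma S2L2_sq_int: "f \<in> S2L2 V \<Longrightarrow> sq_int f"
  using S2L2_subset S1L2_sq_int by blast

text \<open>Shifts the projection to the test function, so that
  \<open>h \<mapsto> L2_inner k (S2 V h)\<close> is linear despite the chosen
  representatives.\<close>

lemma inner_S2:
  assumes k: "sq_int k" and h: "sq_int h"
  shows "L2_inner k (S2 V h) = L2_inner (S2 V k) h"
proof -
  have "L2_inner (S2 V k) h = L2_inner (S2 V k) (S2 V h)" using S2_proj(2)[OF h S2_proj(1)[OF k]] by simp
  also have "\<dots> = cnj (L2_inner (S2 V h) (S2 V k))" by (rule L2_inner_cnj)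
  also have "\<dots> = cnj (L2_inner (S2 V h) k)" using S2_proj(2)[OF k S2_proj(1)[OF h]] by simp
  also have "\<dots> = L2_inner k (S2 V h)" by (rule L2_inner_cnj[symmetric])
  finally show ?thesis by simp
qed

text \<open>Injectivity of \<open>T1 + S2\<close> is positivity: both forms are non-negative, so a
  null vector \<open>h\<close> has \<open>\<tau> h = 0\<close> and vanishing first moments. Hence it
  lies in \<open>S2L2\<close>, where \<open>S2\<close> acts as the identity, and its norm is zero.
  The equation for \<open>D1\<close> is kept in weak form, ready for testing.\<close>

lemma D1_spec:
  assumes g: "sq_int g"
  shows "D1 V g \<in> S1L2 V"
    and "k \<in> S1L2 V \<Longrightarrow> T1form k (D1 V g) + L2_inner k (S2 V (D1 V g)) = L2_inner k g"
proof -
  define A where "A h = (\<lambda>x. T1 V h x + S2 V h x)" for h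
  note sS1 = S1L2_sq_int
  have S2S1: "S2 V h \<in> S1L2 V" if "sq_int h" for h using S2_proj(1)[OF that] S2L2_subset by blast
  have AS1: "A h \<in> S1L2 V" if "h \<in> S1L2 V" for h
    unfolding A_def using S1L2_subspace T1_S1L2(1)[OF that] S2S1[OF sS1[OF that]]
    unfolding L2_subspace_def by blast
  have form: "L2_inner k (A h) = T1form k h + L2_inner k (S2 V h)" if "k \<in> S1L2 V" "h \<in> S1L2 V" for k h
    unfolding A_def
    using L2_inner_add_right[OF sS1[OF that(1)] sS1[OF T1_S1L2(1)[OF that(2)]] sS1[OF S2S1[OF sS1[OF that(2)]]]]
      T1_S1L2(2)[OF that(2,1)] by simp
  obtain N where N: "dim_at_most (S1L2 V) N" using S1L2_dim by blast
  have "\<exists>h\<in>S1L2 V. \<forall>k\<in>S1L2 V. L2_inner k (A h) = L2_inner k g"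
  proof (rule symmetric_inj_imp_surj[OF S1L2_subspace N g AS1])
    fix k h h' assume k: "k \<in> S1L2 V" and h: "h \<in> S1L2 V" and h': "h' \<in> S1L2 V"
    have hh: "(\<lambda>x. h x + h' x) \<in> S1L2 V" using S1L2_subspace h h' unfolding L2_subspace_def by blast
    show "L2_inner k (A (\<lambda>x. h x + h' x)) = L2_inner k (A h) + L2_inner k (A h')"
      unfolding form[OF k hh] form[OF k h] form[OF k h'] T1form_def
      using sS1[OF k] sS1[OF h] sS1[OF h'] sS1[OF hh]
      by (simp add: inner_S2 L2_inner_add_right sS1[OF S2S1] \<tau>_add mom_f_add poly_bdd_intros
          sum.distrib algebra_simps add_divide_distrib)
  next
    fix k h c assume k: "k \<in> S1L2 V" and h: "h \<in> S1L2 V"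
    have hh: "(\<lambda>x. c * h x) \<in> S1L2 V" using S1L2_subspace h unfolding L2_subspace_def by blast
    show "L2_inner k (A (\<lambda>x. c * h x)) = c * L2_inner k (A h)"
      unfolding form[OF k hh] form[OF k h] T1form_def
      using sS1[OF k] sS1[OF h] sS1[OF hh]
      by (simp add: inner_S2 L2_inner_cmult_right \<tau>_cmult mom_f_cmult sum_distrib_left algebra_simps)
  next
    fix k h assume k: "k \<in> S1L2 V" and h: "h \<in> S1L2 V"
    have "L2_inner k (S2 V h) = cnj (L2_inner h (S2 V k))"
      using inner_S2[OF sS1[OF k] sS1[OF h]] L2_inner_cnj[of "S2 V k" h] by simp
    then show "L2_inner k (A h) = cnj (L2_inner h (A k))"
      unfolding form[OF k h] form[OF h k] T1form_def by (simp add: mult_ac)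
  next
    fix h assume h: "h \<in> S1L2 V" and z: "\<And>k. k \<in> S1L2 V \<Longrightarrow> L2_inner k (A h) = 0"
    have S2h: "L2_inner h (S2 V h) = complex_of_real ((L2norm (S2 V h))\<^sup>2)"
      unfolding inner_S2[OF sS1[OF h] sS1[OF h]] L2_inner_self[symmetric]
      using S2_proj(2)[OF sS1[OF h] S2_proj(1)[OF sS1[OF h]]] by simp
    have "T1form h h + complex_of_real ((L2norm (S2 V h))\<^sup>2) = 0"
      using z[OF h] unfolding form[OF h h] S2h .
    then have r: "((cmod (\<tau> h))\<^sup>2 / L1norm V + 2 * T1coef * (\<Sum>j\<in>UNIV. (cmod (m1 j h))\<^sup>2)) + (L2norm (S2 V h))\<^sup>2 = 0"
      unfolding T1form_self of_real_add[symmetric] of_real_eq_0_iff .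
    then have "(cmod (\<tau> h))\<^sup>2 / L1norm V + 2 * T1coef * (\<Sum>j\<in>UNIV. (cmod (m1 j h))\<^sup>2) \<le> 0"
      using zero_le_power2[of "L2norm (S2 V h)"] by linarith
    from T1form_self_eq_0[OF this] have hS2: "h \<in> S2L2 V" and t: "T1form h h = 0"
      using h unfolding S2L2_iff by (auto simp: T1form_def)
    have "L2_inner h h = L2_inner h (S2 V h)" using S2_proj(2)[OF sS1[OF h] hS2] by simp
    also have "\<dots> = 0" using z[OF h] form[OF h h] t by simp
    finally show "aeq h (\<lambda>_. 0)" by (rule L2_inner_self_eq_0[OF sS1[OF h]])
  qed
  then obtain h where h: "h \<in> S1L2 V" "\<And>k. k \<in> S1L2 V \<Longrightarrow> L2_inner k (A h) = L2_inner k g" by blast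
  have "aeq (A h) (S1 V g)"
    by (rule aeq_if_L2_inner_eq[OF S1L2_subspace AS1[OF h(1)] S1_proj(1)[OF g]])
      (use h(2) S1_proj(2)[OF g] in auto)
  then have "\<exists>h. h \<in> S1L2 V \<and> aeq (\<lambda>x. T1 V h x + S2 V h x) (S1 V g)"
    using h(1) unfolding A_def by blast
  from someI_ex[OF this] have D: "D1 V g \<in> S1L2 V" "aeq (A (D1 V g)) (S1 V g)"
    unfolding D1_def[symmetric] A_def by auto
  show "D1 V g \<in> S1L2 V" by (rule D(1))
  assume k: "k \<in> S1L2 V"
  have "L2_inner k (A (D1 V g)) = L2_inner k (S1 V g)"
    by (rule L2_inner_cong[OF aeq_refl D(2)])
      (use sS1[OF k] sS1[OF AS1[OF D(1)]] sS1[OF S1_proj(1)[OF g]] in \<open>auto dest: sq_intD\<close>)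
  then show "T1form k (D1 V g) + L2_inner k (S2 V (D1 V g)) = L2_inner k g"
    using form[OF k D(1)] S1_proj(2)[OF g k] by simp
qed

text \<open>Of \<open>|x|^2 + |y|^2 - 2 (x \<bullet> y)\<close> only \<open>|y|^2\<close> survives,
  and it does not depend on \<open>x\<close>. Thus \<open>G1\<close> enters \<open>T2\<close>
  through scalars.\<close>

lemma vG1v_S2L2:
  assumes "f \<in> S2L2 V"
  shows "vGv G1k V f = (\<lambda>x. mr f * vc x)"
proof -
  have "sq_int f" "vpair V f = 0" "\<And>j. m1 j f = 0"
    using assms S1L2_vpair S1L2_sq_int unfolding S2L2_iff by blast+
  then show ?thesis unfolding vGv_eq by (simp add: mom_G1 mult.commute)
qed

text \<open>The resolvent term of \<^const>\<open>T2\<close> only sees the number \<open>\<tau> h\<close> with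
  \<open>h = D\<^sub>1 T (v G\<^sub>1 v) f\<close>; testing the equation for \<open>h\<close> against \<open>h\<close> itself bounds it by
  \<open>L1norm V * cmod (mr f)\<close>, so that the last two terms of \<^const>\<open>T2\<close> combine to something
  non-negative.\<close>

lemma T2_inner:
  assumes f: "f \<in> S2L2 V"
  shows "T2 V f \<in> S2L2 V"
    and "\<exists>w \<rho>. (\<forall>k\<in>S2L2 V. L2_inner k (T2 V f) = 2 * (cnj (mr k) * mr f)
        + 4 * (\<Sum>i\<in>UNIV. \<Sum>j\<in>UNIV. cnj (m2 i j k) * m2 i j f)
        + complex_of_real (10 / (3 * L1norm V)) * (cnj (mr k) * (complex_of_real (L1norm V) * mr f - w)))
      \<and> cnj (mr f) * w = complex_of_real \<rho> \<and> \<rho> \<le> L1norm V * (cmod (mr f))\<^sup>2 \<and> (mr f = 0 \<longrightarrow> w = 0)"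
proof -
  let ?n = "L1norm V"
  note fS1 = subsetD[OF S2L2_subset f]
  note sf = S1L2_sq_int[OF fS1]
  define m where "m = mr f"
  define g where "g = Top V (vGv G1k V f)"
  have g_eq: "g = Top V (\<lambda>x. m * vc x)" unfolding g_def vG1v_S2L2[OF f] m_def ..
  have smv: "sq_int (\<lambda>x. m * vc x)" by (rule sq_int_cmult[OF sq_int_vc])
  have sg: "sq_int g" unfolding g_eq by (rule sq_int_Top[OF smv])
  define h where "h = D1 V g"
  have h: "h \<in> S1L2 V" and hk: "\<And>k. k \<in> S1L2 V \<Longrightarrow> T1form k h + L2_inner k (S2 V h) = L2_inner k g"
    unfolding h_def using D1_spec[OF sg] by auto
  note sh = S1L2_sq_int[OF h]
  define E where "E = (\<lambda>x. vGv G3k V f x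
      + complex_of_real (10 / (3 * ?n)) * vGv G1k V (vGv G1k V f) x
      - complex_of_real (10 / (3 * ?n)) * vGv G1k V (Top V h) x)"
  have T2: "T2 V f = S2 V E" unfolding T2_def E_def h_def g_def ..
  have s1: "sq_int (vGv G3k V f)" by (rule sq_int_vGv[OF kernel_bdd_G(3) sf])
  have sG1: "sq_int (vGv G1k V f)" by (rule sq_int_vGv[OF kernel_bdd_G(2) sf])
  have s2: "sq_int (vGv G1k V (vGv G1k V f))" by (rule sq_int_vGv[OF kernel_bdd_G(2) sG1])
  have s3: "sq_int (vGv G1k V (Top V h))" by (rule sq_int_vGv[OF kernel_bdd_G(2) sq_int_Top[OF sh]])
  have sE: "sq_int E" unfolding E_def by (intro sq_int_diff sq_int_add sq_int_cmult s1 s2 s3)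
  show "T2 V f \<in> S2L2 V" unfolding T2 by (rule S2_proj(1)[OF sE])
  define w where "w = \<tau> h"
  \<comment> \<open>Symmetry puts \<open>G1\<close> on \<open>k\<close>, where it gives a multiple
    of \<open>v\<close>; all that remains of \<open>u\<close> is its pairing with
    \<open>v\<close>.\<close>
  have G1: "L2_inner k (vGv G1k V u) = cnj (mr k) * vpair V u" if k: "k \<in> S2L2 V" and u: "sq_int u" for k u
  proof -
    have "L2_inner k (vGv G1k V u) = L2_inner (vGv G1k V k) u"
      by (rule vGv_symmetric[OF kernel_bdd_G(2) G_symmetric(2) u S2L2_sq_int[OF k]])
    also have "\<dots> = cnj (mr k) * vpair V u"
      unfolding vG1v_S2L2[OF k] L2_inner_cmult_left vpair_eq_inner ..
    finally show ?thesis .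
  qed
  have vv: "vpair V (vGv G1k V f) = complex_of_real ?n * m"
    unfolding vG1v_S2L2[OF f] vpair_cmult vpair_eq_inner L2_inner_self L1norm_eq m_def by simp
  have inner: "L2_inner k (T2 V f) = 2 * (cnj (mr k) * m)
        + 4 * (\<Sum>i\<in>UNIV. \<Sum>j\<in>UNIV. cnj (m2 i j k) * m2 i j f)
        + complex_of_real (10 / (3 * ?n)) * (cnj (mr k) * (complex_of_real ?n * m - w))"
    if k: "k \<in> S2L2 V" for k
  proof -
    note sk = S2L2_sq_int[OF k]
    have "L2_inner k (T2 V f) = L2_inner k E" unfolding T2 by (rule S2_proj(2)[OF sE k])
    also have "\<dots> = L2_inner k (vGv G3k V f)
        + complex_of_real (10 / (3 * ?n)) * L2_inner k (vGv G1k V (vGv G1k V f))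
        - complex_of_real (10 / (3 * ?n)) * L2_inner k (vGv G1k V (Top V h))"
      unfolding E_def using sk s1 s2 s3
      by (simp only: L2_inner_diff_right L2_inner_add_right L2_inner_cmult_right sq_int_add sq_int_cmult)
    also have "L2_inner k (vGv G1k V (vGv G1k V f)) = cnj (mr k) * (complex_of_real ?n * m)"
      unfolding G1[OF k sG1] vv ..
    also have "L2_inner k (vGv G1k V (Top V h)) = cnj (mr k) * w"
      unfolding G1[OF k sq_int_Top[OF sh]] w_def \<tau>_def ..
    also have "L2_inner k (vGv G3k V f) = 2 * (cnj (mr k) * m)
        + 4 * (\<Sum>i\<in>UNIV. \<Sum>j\<in>UNIV. cnj (m2 i j k) * m2 i j f)"
      unfolding m_def
      by (rule inner_vG3v) (use f k fS1 S2L2_subset S1L2_sq_int S1L2_vpair in \<open>auto simp: S2L2_iff\<close>)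
    finally show ?thesis by (simp add: algebra_simps)
  qed
  \<comment> \<open>The quadratic form of \<open>T1 + S2\<close> at \<open>h\<close>. By the
    equation for \<open>h\<close>, tested with \<open>h\<close>, it equals the inner product of
    \<open>h\<close> with \<open>g\<close>, that is \<open>m * cnj w\<close>.\<close>
  define \<rho> where "\<rho> = (cmod (\<tau> h))\<^sup>2 / ?n + 2 * T1coef * (\<Sum>j\<in>UNIV. (cmod (m1 j h))\<^sup>2) + (L2norm (S2 V h))\<^sup>2"
  have "L2_inner h (S2 V h) = complex_of_real ((L2norm (S2 V h))\<^sup>2)"
    unfolding inner_S2[OF sh sh] L2_inner_self[symmetric]
    using S2_proj(2)[OF sh S2_proj(1)[OF sh]] by simp
  then have "L2_inner h g = complex_of_real \<rho>"
    using hk[OF h] unfolding T1form_self \<rho>_def by simp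
  moreover have "L2_inner h g = m * cnj w"
  proof -
    have "L2_inner h g = L2_inner (Top V h) (\<lambda>x. m * vc x)"
      unfolding g_eq by (rule Top_symmetric[OF smv sh])
    also have "\<dots> = m * cnj w"
      unfolding L2_inner_cmult_right w_def \<tau>_def vpair_eq_inner L2_inner_cnj[of "Top V h"] ..
    finally show ?thesis .
  qed
  ultimately have mw: "m * cnj w = complex_of_real \<rho>" by simp
  have mw': "cnj m * w = complex_of_real \<rho>"
    using arg_cong[OF mw, of cnj] by simp
  have \<rho>w: "(cmod w)\<^sup>2 / ?n \<le> \<rho>"
    unfolding \<rho>_def w_def using T1coef_pos by (simp add: sum_nonneg)
  then have \<rho>0: "0 \<le> \<rho>" using L1norm_pos by (meson divide_nonneg_pos order_trans zero_le_power2)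
  have \<rho>m: "\<rho> = cmod m * cmod w"
    using arg_cong[OF mw', of cmod] \<rho>0 by (simp add: norm_mult)
  \<comment> \<open>The bound \<open>|w|^2 / ?n \<le> \<rho>\<close> meets
    \<open>\<rho> = |m| |w|\<close>, and a nonzero \<open>w\<close> cancels.\<close>
  have wle: "cmod w \<le> ?n * cmod m"
  proof (cases "w = 0")
    case False
    have "cmod w * cmod w \<le> (?n * cmod m) * cmod w"
      using \<rho>w L1norm_pos unfolding \<rho>m by (simp add: divide_le_eq power2_eq_square mult_ac)
    then show ?thesis using False by simp
  qed (use L1norm_pos in auto)
  have "\<rho> \<le> ?n * (cmod m)\<^sup>2"
    unfolding \<rho>m using mult_left_mono[OF wle, of "cmod m"] by (simp add: power2_eq_square mult_ac)
  moreover have "m = 0 \<longrightarrow> w = 0" using wle by auto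
  ultimately show "\<exists>w \<rho>. (\<forall>k\<in>S2L2 V. L2_inner k (T2 V f) = 2 * (cnj (mr k) * mr f)
        + 4 * (\<Sum>i\<in>UNIV. \<Sum>j\<in>UNIV. cnj (m2 i j k) * m2 i j f)
        + complex_of_real (10 / (3 * L1norm V)) * (cnj (mr k) * (complex_of_real (L1norm V) * mr f - w)))
      \<and> cnj (mr f) * w = complex_of_real \<rho> \<and> \<rho> \<le> L1norm V * (cmod (mr f))\<^sup>2 \<and> (mr f = 0 \<longrightarrow> w = 0)"
    using inner mw' unfolding m_def by blast
qed

text \<open>Testing \<open>T2 f = 0\<close> with \<open>f\<close> gives a vanishing sum of three
  non-negative terms, the middle one containing all second moments. Conversely \<open>mr\<close> is
  their trace, so it vanishes with them, and \<open>T2_inner\<close> then gives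
  \<open>w = 0\<close>.\<close>

lemma S3L2_iff: "f \<in> S3L2 V \<longleftrightarrow> f \<in> S2L2 V \<and> (\<forall>i j. m2 i j f = 0)"
proof
  assume "f \<in> S3L2 V"
  then have f: "f \<in> S2L2 V" and z: "aeq (T2 V f) (\<lambda>_. 0)" unfolding S3L2_def by auto
  obtain w \<rho> where w: "\<And>k. k \<in> S2L2 V \<Longrightarrow> L2_inner k (T2 V f) = 2 * (cnj (mr k) * mr f)
        + 4 * (\<Sum>i\<in>UNIV. \<Sum>j\<in>UNIV. cnj (m2 i j k) * m2 i j f)
        + complex_of_real (10 / (3 * L1norm V)) * (cnj (mr k) * (complex_of_real (L1norm V) * mr f - w))"
    and \<rho>: "cnj (mr f) * w = complex_of_real \<rho>" "\<rho> \<le> L1norm V * (cmod (mr f))\<^sup>2"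
    using T2_inner(2)[OF f] by blast
  let ?S = "\<Sum>i\<in>UNIV. \<Sum>j\<in>UNIV. (cmod (m2 i j f))\<^sup>2"
  have "L2_inner f (T2 V f) = L2_inner f (\<lambda>_. 0)"
    by (rule L2_inner_cong[OF aeq_refl z])
      (use sq_intD(1)[OF S2L2_sq_int[OF f]] sq_intD(1)[OF S2L2_sq_int[OF T2_inner(1)[OF f]]] in auto)
  then have "0 = 2 * (cnj (mr f) * mr f) + 4 * (\<Sum>i\<in>UNIV. \<Sum>j\<in>UNIV. cnj (m2 i j f) * m2 i j f)
      + complex_of_real (10 / (3 * L1norm V)) * (complex_of_real (L1norm V) * (cnj (mr f) * mr f) - cnj (mr f) * w)"
    using w[OF f] by (simp add: algebra_simps)
  also have "\<dots> = complex_of_real (2 * (cmod (mr f))\<^sup>2 + 4 * ?S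
      + 10 / (3 * L1norm V) * (L1norm V * (cmod (mr f))\<^sup>2 - \<rho>))"
  proof -
    have c: "cnj z * z = complex_of_real ((cmod z)\<^sup>2)" for z
      by (simp only: complex_norm_square mult.commute)
    show ?thesis unfolding c \<rho>(1) by simp
  qed
  finally have "complex_of_real (2 * (cmod (mr f))\<^sup>2 + 4 * ?S + 10 / (3 * L1norm V) * (L1norm V * (cmod (mr f))\<^sup>2 - \<rho>)) = 0"
    by (rule sym)
  then have "2 * (cmod (mr f))\<^sup>2 + 4 * ?S + 10 / (3 * L1norm V) * (L1norm V * (cmod (mr f))\<^sup>2 - \<rho>) = 0"
    unfolding of_real_eq_0_iff .
  moreover have "0 \<le> 10 / (3 * L1norm V) * (L1norm V * (cmod (mr f))\<^sup>2 - \<rho>)"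
    using \<rho>(2) L1norm_pos by (intro mult_nonneg_nonneg) auto
  moreover have S0: "0 \<le> ?S" by (intro sum_nonneg) auto
  ultimately have "?S = 0" using zero_le_power2[of "cmod (mr f)"] by linarith
  then show "f \<in> S2L2 V \<and> (\<forall>i j. m2 i j f = 0)"
    using f by (simp add: sum_nonneg_eq_0_iff sum_nonneg)
next
  assume f: "f \<in> S2L2 V \<and> (\<forall>i j. m2 i j f = 0)"
  then have mr: "mr f = 0" using mr_eq[OF S2L2_sq_int] by simp
  obtain w where w: "\<And>k. k \<in> S2L2 V \<Longrightarrow> L2_inner k (T2 V f) = 2 * (cnj (mr k) * mr f)
        + 4 * (\<Sum>i\<in>UNIV. \<Sum>j\<in>UNIV. cnj (m2 i j k) * m2 i j f)
        + complex_of_real (10 / (3 * L1norm V)) * (cnj (mr k) * (complex_of_real (L1norm V) * mr f - w))"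
    and w0: "w = 0"
    using T2_inner(2)[of f] f mr by blast
  have "aeq (T2 V f) (\<lambda>_. 0)"
  proof (rule aeq_if_L2_inner_eq[OF S2L2_subspace])
    show "T2 V f \<in> S2L2 V" using f T2_inner(1) by blast
    show "(\<lambda>_. 0) \<in> S2L2 V" using S2L2_subspace unfolding L2_subspace_def by blast
    show "L2_inner k (T2 V f) = L2_inner k (\<lambda>_. 0)" if "k \<in> S2L2 V" for k
      using w[OF that] w0 mr f by simp
  qed
  then show "f \<in> S3L2 V" using f unfolding S3L2_def by blast
qed

end

lemma sq_int_imp_wL2:
  assumes "sq_int f" "s \<ge> 0"
  shows "wL2 s f"
proof -
  note [measurable] = sq_intD(1)[OF assms(1)]
  have "(1 + (norm x)\<^sup>2) powr (- s / 2) \<le> 1" for x :: "real^3"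
    using assms(2) powr_mono2'[of "- s / 2" 1 "1 + (norm x)\<^sup>2"] by simp
  then have "cmod (complex_of_real ((1 + (norm x)\<^sup>2) powr (- s / 2)) * f x) \<le> 1 * cmod (f x)" for x
    unfolding norm_mult by (intro mult_right_mono) auto
  then show ?thesis unfolding wL2_def by (intro sq_int_domin[OF _ assms(1), of _ 1]) auto
qed

lemma wL2_aeq:
  assumes "wL2 s f" "aeq f g" and [measurable]: "g \<in> borel_measurable borel"
  shows "wL2 s g"
  unfolding wL2_def
  by (rule sq_int_aeq[OF assms(1)[unfolded wL2_def]]) (use assms(2) in \<open>auto simp: aeq_def elim: AE_mp\<close>)

context decaying_potential
begin

section \<open>The potential of a density\<close>

definition pot :: "fn \<Rightarrow> fn" where
  "pot f x = - intop G0k (mult v f) x"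

lemma pot_eq: "pot f x = mom (dist x) f / complex_of_real (8 * pi)"
proof -
  have "G0k x = (\<lambda>y. (- 1 / (8 * pi)) * dist x y)" unfolding G0k_def by auto
  then show ?thesis unfolding pot_def intop_eq_mom by (simp only: mom_cmult) simp
qed

lemma pot_measurable: "sq_int f \<Longrightarrow> pot f \<in> borel_measurable borel"
  unfolding pot_def[abs_def] intop_eq_mom using mom_kernel_measurable[OF kernel_bdd_G(1)] by simp

text \<open>Multiplication by \<open>U\<close>, which squares to 1, exchanges the two equations at
  every point.\<close>

lemma aeq_pot_iff:
  "aeq f (mult U (mult v (\<lambda>x. pot f x + c))) \<longleftrightarrow> aeq (Top V f) (\<lambda>x. c * vc x)"
proof -
  have "f x = complex_of_real (U x) * (vc x * (pot f x + c)) \<longleftrightarrow> Top V f x = c * vc x" for x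
  proof -
    have "f x = complex_of_real (U x) * (vc x * (pot f x + c))
        \<longleftrightarrow> complex_of_real (U x) * f x = vc x * (pot f x + c)"
      by (metis U_U)
    also have "\<dots> \<longleftrightarrow> Top V f x = c * vc x"
      unfolding Top_def vGv_eq pot_def intop_eq_mom by (auto simp: algebra_simps)
    finally show ?thesis .
  qed
  then show ?thesis unfolding aeq_def mult_def by simp
qed

text \<open>After Fubini the fundamental solution leaves minus the integral of
  \<open>\<psi> v f\<close>. The equation \<open>f = U v \<phi>\<close> rewrites \<open>v f\<close>
  as \<open>V \<phi>\<close>, and the constant contributes nothing because the bilaplacian of a test
  function has integral zero.\<close>

lemma dist_H_zero_pot:
  assumes f: "sq_int f" and eq: "aeq f (mult U (mult v (\<lambda>x. pot f x + c)))"
  shows "dist_H_zero V (\<lambda>x. pot f x + c)"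
  unfolding dist_H_zero_def
proof (intro allI impI)
  fix \<psi> assume \<psi>: "test_fun \<psi>"
  define L where "L = lap (lap \<psi>)"
  obtain B where B: "\<And>x. norm x > B \<Longrightarrow> L x = 0" using test_fun_lap_lap(2)[OF \<psi>] unfolding L_def by blast
  have cL: "continuous_on UNIV L" using test_fun_lap_lap(1)[OF \<psi>] unfolding L_def .
  have "continuous_on UNIV (iter_pd [] \<psi>)" using \<psi> unfolding test_fun_def by blast
  then have c\<psi>: "continuous_on UNIV \<psi>" by (simp add: iter_pd_def)
  note [measurable] = borel_measurable_continuous_onI[OF cL] borel_measurable_continuous_onI[OF c\<psi>]
    pot_measurable[OF f] sq_intD(1)[OF f]
  have [measurable]: "mult v f \<in> borel_measurable borel" unfolding mult_def by measurable
  have iL: "integrable lborel L" by (rule integrable_continuous_bounded_support[OF cL B])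
  have iF: "integrable lborel (\<lambda>x. (1 + norm x) ^ 4 * \<bar>L x\<bar>)"
    by (rule integrable_continuous_bounded_support[of _ B]) (use cL B in \<open>auto intro!: continuous_intros\<close>)
  define H where "H x y = complex_of_real (dist x y * L x / (8 * pi)) * mult v f y" for x y
  have iH: "integrable (lborel \<Otimes>\<^sub>M lborel) (\<lambda>(x, y). H x y)"
  proof (rule integrable_pair_bound[OF _ iF])
    show "integrable lborel (\<lambda>y. cmod (wt y) * cmod (f y))"
      using integrable_norm[OF integrable_sq_int_mult[OF sq_int_wt f]] by (simp add: norm_mult)
    show "(\<lambda>(x, y). H x y) \<in> borel_measurable (lborel \<Otimes>\<^sub>M lborel)" unfolding H_def by measurable
    fix x y :: "real^3"
    have "dist x y / (8 * pi) \<le> (1 + norm x) ^ 4 * (1 + norm y) ^ 4"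
      using kernel_bdd_G(1) unfolding kernel_bdd_def G0k_def by simp
    then have "dist x y / (8 * pi) * (\<bar>L x\<bar> * (v y * cmod (f y)))
        \<le> (1 + norm x) ^ 4 * (1 + norm y) ^ 4 * (\<bar>L x\<bar> * (v y * cmod (f y)))"
      by (intro mult_right_mono) auto
    then show "cmod (case (x, y) of (x, y) \<Rightarrow> H x y) \<le> (1 + norm x) ^ 4 * \<bar>L x\<bar> * (cmod (wt y) * cmod (f y))"
      by (simp add: H_def mult_def cmod_wt norm_mult norm_divide abs_mult mult_ac)
  qed
  have potH: "(LINT y|lborel. H x y) = pot f x * complex_of_real (L x)" for x
  proof -
    have "(LINT y|lborel. H x y)
        = (LINT y|lborel. complex_of_real (L x / (8 * pi)) * (complex_of_real (dist x y) * mult v f y))"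
      unfolding H_def by (intro Bochner_Integration.integral_cong) (auto simp: mult_ac)
    also have "\<dots> = pot f x * complex_of_real (L x)"
      unfolding pot_eq mom_def by (simp add: mult_ac)
    finally show ?thesis .
  qed
  have ipL: "integrable lborel (\<lambda>x. pot f x * complex_of_real (L x))"
    using lborel_pair.integrable_fst[OF iH] unfolding potH .
  have "(LINT x|lborel. (pot f x + c) * complex_of_real (L x))
      = (LINT x|lborel. pot f x * complex_of_real (L x)) + c * complex_of_real (LINT x|lborel. L x)"
    using ipL iL by (simp add: distrib_right)
  also have "(LINT x|lborel. L x) = 0" using test_fun_lap_lap(3)[OF \<psi>] unfolding L_def .
  also have "(LINT x|lborel. pot f x * complex_of_real (L x)) = (LINT x|lborel. LINT y|lborel. H x y)"
    unfolding potH ..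
  also have "\<dots> = (LINT y|lborel. LINT x|lborel. H x y)"
    using lborel_pair.Fubini_integral[OF iH] by simp
  also have "\<dots> = (LINT y|lborel. - (complex_of_real (\<psi> y) * mult v f y))"
  proof (intro Bochner_Integration.integral_cong refl)
    fix y
    have "(LINT x|lborel. H x y) = complex_of_real (LINT x|lborel. dist x y * L x / (8 * pi)) * mult v f y"
      unfolding H_def by (simp only: integral_mult_left_zero integral_complex_of_real)
    also have "(LINT x|lborel. dist x y * L x / (8 * pi)) = - \<psi> y"
      using bilaplacian_fundamental_solution[OF \<psi>, of y] unfolding L_def by simp
    finally show "(LINT x|lborel. H x y) = - (complex_of_real (\<psi> y) * mult v f y)" by simp
  qed
  also have "\<dots> = - (LINT y|lborel. complex_of_real (V y * \<psi> y) * (pot f y + c))"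
  proof -
    have "AE y in lborel. complex_of_real (\<psi> y) * mult v f y = complex_of_real (V y * \<psi> y) * (pot f y + c)"
      using eq unfolding aeq_def
    proof eventually_elim
      case (elim y)
      then show ?case unfolding V_eq[of y] mult_def by (simp add: mult_ac)
    qed
    then have "(LINT y|lborel. complex_of_real (\<psi> y) * mult v f y)
        = (LINT y|lborel. complex_of_real (V y * \<psi> y) * (pot f y + c))"
      by (intro integral_cong_AE) auto
    then show ?thesis by simp
  qed
  finally show "(LINT x|lborel. (pot f x + c) * complex_of_real (lap (lap \<psi>) x))
      + (LINT x|lborel. complex_of_real (V x * \<psi> x) * (pot f x + c)) = 0"
    unfolding L_def by simp
qed

section \<open>Expansion of \<open>pot f\<close> at infinity, and the moments forced to vanish by
  weighted integrability\<close>

lemma pot_expand1: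
  assumes f: "sq_int f"
  shows "cmod (pot f x - complex_of_real (norm x) * (vpair V f / complex_of_real (8 * pi))) \<le> absmom f"
proof -
  let ?p = "\<lambda>y. dist x y + (- norm x) * 1"
  have pb: "poly_bdd ?p" by (intro poly_bdd_add poly_bdd_cmult poly_bdd_intros)
  have e: "mom ?p f = mom (dist x) f - complex_of_real (norm x) * vpair V f"
    using f by (simp only: mom_add mom_cmult poly_bdd_cmult poly_bdd_intros vpair_eq_mom) simp
  have "cmod (mom ?p f) \<le> 1 * absmom f"
    by (rule mom_bound[OF _ pb f])
      (use dist_expand1[of x] norm_power_le_weight[of 1 4] in \<open>fastforce intro: order_trans\<close>)
  from cmod_div_8pi[OF this] show ?thesis unfolding e pot_eq by (simp add: diff_divide_distrib)
qed

text \<open>The distance minus its expansion is a single polynomially bounded function of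
  \<open>y\<close>. \<open>mom_bound\<close> turns its pointwise bound into the remainder, and the
  term \<open>|x|\<close> drops out with the mean.\<close>

lemma pot_expand2:
  assumes f: "sq_int f" "vpair V f = 0" and x: "x \<noteq> 0"
  shows "cmod (pot f x - - (\<Sum>j\<in>UNIV. complex_of_real (x $ j / norm x) * m1 j f) / complex_of_real (8 * pi))
    \<le> absmom f / norm x"
proof -
  let ?p = "\<lambda>y. (dist x y + (- norm x) * 1) + (\<Sum>j\<in>UNIV. (x $ j / norm x) * y $ j)"
  have pb: "poly_bdd ?p" by (intro poly_bdd_add poly_bdd_cmult poly_bdd_intros poly_bdd_sum) auto
  have e: "mom ?p f = mom (dist x) f + (\<Sum>j\<in>UNIV. complex_of_real (x $ j / norm x) * m1 j f)"
    using f(1) f(2)[unfolded vpair_eq_mom]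
    by (simp only: mom_add mom_sum mom_cmult poly_bdd_add poly_bdd_sum poly_bdd_cmult poly_bdd_intros finite) simp
  have "cmod (mom ?p f) \<le> (1 / norm x) * absmom f"
  proof (rule mom_bound[OF _ pb f(1)])
    fix y
    have "?p y = dist x y - norm x + (x \<bullet> y) / norm x"
      unfolding inner_vec3 by (simp add: sum_divide_distrib)
    then have "\<bar>?p y\<bar> \<le> (norm y)\<^sup>2 / (2 * norm x)" using dist_expand2[OF x, of y] by simp
    also have "\<dots> \<le> (norm y)\<^sup>2 / norm x" using x by (intro divide_left_mono) auto
    also have "\<dots> \<le> (1 + norm y) ^ 4 / norm x" using norm_power_le_weight[of 2 4 y] by (intro divide_right_mono) auto
    finally show "\<bar>?p y\<bar> \<le> (1 / norm x) * (1 + norm y) ^ 4" by simp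
  qed
  from cmod_div_8pi[OF this] show ?thesis unfolding e pot_eq by (simp add: add_divide_distrib)
qed

text \<open>The \<open>16 * pi\<close> is \<open>8 * pi\<close> times the 2 in the denominator of
  the second-order term of the distance.\<close>

lemma pot_expand3:
  assumes f: "sq_int f" "vpair V f = 0" "\<And>j. m1 j f = 0" and x: "x \<noteq> 0"
  shows "cmod (pot f x - complex_of_real (1 / norm x) * ((mr f
      - (\<Sum>i\<in>UNIV. \<Sum>j\<in>UNIV. complex_of_real (x $ i * x $ j / (norm x)\<^sup>2) * m2 i j f)) / complex_of_real (16 * pi)))
    \<le> absmom f / (norm x)\<^sup>2"
proof -
  let ?c = "- 1 / (2 * norm x)"
  let ?d = "1 / (2 * norm x)"
  let ?p = "\<lambda>y. (((dist x y + (- norm x) * 1) + (\<Sum>j\<in>UNIV. (x $ j / norm x) * y $ j))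
    + ?c * (norm y)\<^sup>2) + ?d * (\<Sum>i\<in>UNIV. \<Sum>j\<in>UNIV. (x $ i * x $ j / (norm x)\<^sup>2) * (y $ i * y $ j))"
  have pb: "poly_bdd ?p" by (intro poly_bdd_add poly_bdd_cmult poly_bdd_intros poly_bdd_sum) auto
  have e: "mom ?p f = mom (dist x) f - complex_of_real ?d * (mr f
      - (\<Sum>i\<in>UNIV. \<Sum>j\<in>UNIV. complex_of_real (x $ i * x $ j / (norm x)\<^sup>2) * m2 i j f))"
    using f(1) f(2)[unfolded vpair_eq_mom] f(3)
    by (simp only: mom_add mom_sum mom_cmult poly_bdd_add poly_bdd_sum poly_bdd_cmult poly_bdd_intros finite)
      (simp add: algebra_simps)
  have "cmod (mom ?p f) \<le> (1 / (norm x)\<^sup>2) * absmom f"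
  proof (rule mom_bound[OF _ pb f(1)])
    fix y
    have "(\<Sum>j\<in>UNIV. (x $ j / norm x) * y $ j) = (x \<bullet> y) / norm x"
      unfolding inner_vec3 by (simp add: sum_divide_distrib)
    moreover have "(\<Sum>i\<in>UNIV. \<Sum>j\<in>UNIV. (x $ i * x $ j / (norm x)\<^sup>2) * (y $ i * y $ j)) = (x \<bullet> y)\<^sup>2 / (norm x)\<^sup>2"
      unfolding inner_vec3 power2_eq_square[of "sum _ _"] sum_product
      by (simp add: sum_divide_distrib mult_ac)
    ultimately have "?p y = dist x y - norm x + (x \<bullet> y) / norm x
        - ((norm y)\<^sup>2 - (x \<bullet> y)\<^sup>2 / (norm x)\<^sup>2) / (2 * norm x)"
      by (simp add: diff_divide_distrib)
    then have "\<bar>?p y\<bar> \<le> (norm y) ^ 3 / (2 * (norm x)\<^sup>2)" using dist_expand3[OF x, of y] by simp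
    also have "\<dots> \<le> (norm y) ^ 3 / (norm x)\<^sup>2" using x by (intro divide_left_mono) auto
    also have "\<dots> \<le> (1 + norm y) ^ 4 / (norm x)\<^sup>2"
      using norm_power_le_weight[of 3 4 y] by (intro divide_right_mono) auto
    finally show "\<bar>?p y\<bar> \<le> (1 / (norm x)\<^sup>2) * (1 + norm y) ^ 4" by simp
  qed
  from cmod_div_8pi[OF this]
  have "cmod ((mom (dist x) f - complex_of_real ?d * (mr f
      - (\<Sum>i\<in>UNIV. \<Sum>j\<in>UNIV. complex_of_real (x $ i * x $ j / (norm x)\<^sup>2) * m2 i j f))) / complex_of_real (8 * pi))
    \<le> absmom f / (norm x)\<^sup>2" unfolding e by simp
  moreover have "(mom (dist x) f - complex_of_real ?d * z) / complex_of_real (8 * pi)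
      = pot f x - complex_of_real (1 / norm x) * (z / complex_of_real (16 * pi))" for z
    unfolding pot_eq by (simp add: diff_divide_distrib)
  ultimately show ?thesis by (simp only:)
qed

text \<open>Weight 2 is available in \<open>Wsp (3/2)\<close>, whereas the leading term
  \<open>|x|\<close> would need a weight above 5/2; the constant \<open>c\<close> is absorbed in the
  remainder.\<close>

lemma vpair_zero_if_wL2:
  assumes f: "sq_int f" and w: "wL2 2 (\<lambda>x. pot f x + c)"
  shows "vpair V f = 0"
proof -
  have "vpair V f / complex_of_real (8 * pi) = 0"
  proof (rule leading_coefficient_zero[where k = 1 and \<phi> = "\<lambda>x. pot f x + c"
        and L = "\<lambda>_. vpair V f / complex_of_real (8 * pi)" and C = "absmom f + cmod c" and ?x0.0 = "axis 1 1"])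
    show "sq_int (\<lambda>x. complex_of_real ((1 + (norm x)\<^sup>2) powr (- (1 + 1) / 2)) * (pot f x + c))"
      using w unfolding wL2_def by simp
    fix x :: "real^3" assume x: "1 \<le> norm x"
    let ?z = "complex_of_real (norm x) * (vpair V f / complex_of_real (8 * pi))"
    have "cmod (pot f x + c - ?z) = cmod ((pot f x - ?z) + c)" by (simp add: algebra_simps)
    also have "\<dots> \<le> cmod (pot f x - ?z) + cmod c" by (rule norm_triangle_ineq)
    also have "\<dots> \<le> absmom f + cmod c" using pot_expand1[OF f, of x] by simp
    finally show "cmod (pot f x + c - complex_of_real (norm x powr 1) * (vpair V f / complex_of_real (8 * pi)))
        \<le> (absmom f + cmod c) * norm x powr (1 - 1)"
      using x by (auto simp: powr_one)
  qed (auto simp: axis_eq_0_iff)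
  then show ?thesis by simp
qed

text \<open>The leading profile is homogeneous of degree 0 and would need a weight above 3/2, so
  weight 1 rules it out. At \<open>axis j 1\<close> it is \<open>m1 j f\<close> up to a nonzero
  factor.\<close>

lemma m1_zero_if_wL2:
  assumes f: "sq_int f" "vpair V f = 0" and w: "wL2 1 (pot f)"
  shows "m1 j f = 0"
proof -
  define L where "L x = - (\<Sum>j\<in>UNIV. complex_of_real (x $ j / norm x) * m1 j f) / complex_of_real (8 * pi)"
    for x :: "real^3"
  have "L (axis j 1) = 0"
  proof (rule leading_coefficient_zero[where k = 0 and \<phi> = "pot f" and C = "absmom f"])
    show "sq_int (\<lambda>x. complex_of_real ((1 + (norm x)\<^sup>2) powr (- (0 + 1) / 2)) * pot f x)"
      using w unfolding wL2_def by simp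
    show "continuous_on (UNIV - {0}) L" unfolding L_def by (auto intro!: continuous_intros)
    show "L (t *\<^sub>R x) = L x" if "t > 0" for t x unfolding L_def using that by simp
    show "cmod (pot f x - complex_of_real (norm x powr 0) * L x) \<le> absmom f * norm x powr (0 - 1)"
      if "1 \<le> norm x" for x
    proof -
      have "x \<noteq> 0" using that by auto
      then show ?thesis using pot_expand2[OF f, of x] unfolding L_def by (simp add: powr_minus_divide)
    qed
  qed (auto simp: axis_eq_0_iff)
  moreover have "(\<Sum>i\<in>UNIV. complex_of_real (axis j 1 $ i / norm (axis j (1::real))) * m1 i f)
      = (\<Sum>i\<in>UNIV. if i = j then m1 i f else 0)"
    by (intro sum.cong) (auto simp: axis_nth_eq norm_axis_1)
  ultimately show ?thesis unfolding L_def by simp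
qed

text \<open>Decay like \<open>1 / |x|\<close> is not square-integrable in dimension 3, so the
  angular profile vanishes identically. Hence the normalised quadratic form \<open>q\<close> of the
  second moments is constant off the origin, and trace and polarisation do the rest.\<close>

lemma m2_zero_if_sq_int:
  assumes f: "sq_int f" "vpair V f = 0" "\<And>j. m1 j f = 0" and w: "sq_int (pot f)"
  shows "m2 i j f = 0"
proof -
  define q where "q x = (\<Sum>i\<in>UNIV. \<Sum>j\<in>UNIV. complex_of_real (x $ i * x $ j / (norm x)\<^sup>2) * m2 i j f)"
    for x :: "real^3"
  define L where "L x = (mr f - q x) / complex_of_real (16 * pi)" for x
  have "L x = 0" if "x \<noteq> 0" for x
  proof (rule leading_coefficient_zero[where k = "-1" and \<phi> = "pot f" and C = "absmom f"])
    show "x \<noteq> 0" by fact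
    show "sq_int (\<lambda>x. complex_of_real ((1 + (norm x)\<^sup>2) powr (- (- 1 + 1) / 2)) * pot f x)"
      using w by (simp add: add_nonneg_eq_0_iff)
    show "continuous_on (UNIV - {0}) L" unfolding L_def q_def by (auto intro!: continuous_intros)
    show "L (t *\<^sub>R x) = L x" if "t > 0" for t x
      unfolding L_def q_def using that by (simp add: power_mult_distrib power2_eq_square[of t])
    show "cmod (pot f x - complex_of_real (norm x powr - 1) * L x) \<le> absmom f * norm x powr (- 1 - 1)"
      if "1 \<le> norm x" for x
    proof -
      have "x \<noteq> 0" using that by auto
      moreover have "norm x powr (- 1 - 1) = 1 / (norm x)\<^sup>2"
        using \<open>x \<noteq> 0\<close> by (simp add: powr_minus_divide powr_numeral)
      ultimately show ?thesis using pot_expand3[OF f, of x] unfolding L_def q_def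
        by (simp add: powr_minus_divide)
    qed
  qed auto
  then have q: "q x = mr f" if "x \<noteq> 0" for x using that unfolding L_def by auto
  have diag': "m2 i i f = mr f" for i
  proof -
    have "q (axis i 1) = (\<Sum>k\<in>UNIV. \<Sum>l\<in>UNIV. if k = i then (if l = i then m2 k l f else 0) else 0)"
      unfolding q_def by (intro sum.cong) (auto simp: axis_nth_eq norm_axis_1)
    also have "\<dots> = m2 i i f" by (rule sum_delta2)
    finally show ?thesis using q[of "axis i 1"] by (simp add: axis_eq_0_iff)
  qed
  \<comment> \<open>All three diagonal moments equal their own sum \<open>mr f\<close>, so
    \<open>mr f = 3 * mr f\<close>.\<close>
  have "mr f = (\<Sum>i\<in>(UNIV::3 set). mr f)" using mr_eq[OF f(1)] unfolding diag' .
  then have mr: "mr f = 0" by simp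
  have diag: "m2 i i f = 0" for i using diag' mr by simp
  show "m2 i j f = 0"
  proof (cases "i = j")
    case False
    \<comment> \<open>Polarisation: at the sum of two axes \<open>|x|^2 q\<close> is a sum of four
      entries, of which the two diagonal ones are known to vanish.\<close>
    let ?x = "axis i 1 + axis j 1 :: real^3"
    have x0: "?x \<noteq> 0" using False by (auto simp: vec_eq_iff axis_def intro!: exI[of _ i])
    have "(norm ?x)\<^sup>2 * q ?x = (\<Sum>k\<in>UNIV. \<Sum>l\<in>UNIV. complex_of_real (?x $ k * ?x $ l) * m2 k l f)"
      unfolding q_def sum_distrib_left using x0 by (intro sum.cong) auto
    also have "\<dots> = (\<Sum>k\<in>UNIV. \<Sum>l\<in>UNIV.
        (if k = i then (if l = i then m2 k l f else 0) else 0) + (if k = i then (if l = j then m2 k l f else 0) else 0)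
        + (if k = j then (if l = i then m2 k l f else 0) else 0) + (if k = j then (if l = j then m2 k l f else 0) else 0))"
      using False by (intro sum.cong) (auto simp: axis_def)
    also have "\<dots> = m2 i i f + m2 i j f + m2 j i f + m2 j j f"
      by (simp only: sum.distrib sum_delta2)
    finally have "m2 i j f + m2 j i f = 0" using q[OF x0] mr diag by simp
    moreover have "m2 j i f = m2 i j f" by (simp add: mult.commute)
    ultimately show ?thesis by simp
  qed (use diag in simp)
qed

section \<open>Characterisation of the three kernels\<close>

text \<open>Inside the unit ball mean zero gives the bound \<open>absmom f\<close>, and there
  \<open>2 ^ n\<close> makes the remaining factor at least 1.\<close>

lemma pot_decay:
  assumes f: "sq_int f" "vpair V f = 0"
    and far: "\<And>x. 1 \<le> norm x \<Longrightarrow> cmod (pot f x) \<le> absmom f / norm x ^ n"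
  shows "cmod (pot f x) \<le> absmom f * 2 ^ n * (1 + norm x) powr (- real n)"
proof (cases "1 \<le> norm x")
  case True
  then show ?thesis using order_trans[OF far[OF True] le_two_div[of "absmom f" "norm x" n]] by simp
next
  case False
  have "cmod (pot f x) \<le> absmom f * 1" using pot_expand1[OF f(1), of x] f(2) by simp
  also have "\<dots> \<le> absmom f * (2 ^ n / (1 + norm x) ^ n)"
    using False power_mono[of "1 + norm x" 2 n] zero_less_power[of "1 + norm x" n]
    by (intro mult_left_mono) (auto simp: le_divide_eq add_pos_nonneg)
  also have "\<dots> = absmom f * 2 ^ n * (1 + norm x) powr (- real n)"
    by (simp add: powr_minus_divide powr_realpow add_pos_nonneg)
  finally show ?thesis .
qed

lemma S1L2_characterisation:
  assumes f: "sq_int f"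
  shows "f \<in> S1L2 V \<longleftrightarrow>
    (\<exists>\<phi>. \<phi> \<in> Wsp (3/2) \<and> dist_H_zero V \<phi> \<and> aeq f (mult U (mult v \<phi>))
      \<and> aeq \<phi> (\<lambda>x. - intop G0k (mult v f) x + vpair V (Top V f) / complex_of_real (L1norm V)))"
    (is "_ \<longleftrightarrow> (\<exists>\<phi>. ?P \<phi>)")
proof -
  define c where "c = \<tau> f / complex_of_real (L1norm V)"
  define \<phi>0 where "\<phi>0 = (\<lambda>x. pot f x + c)"
  have \<phi>0: "(\<lambda>x. - intop G0k (mult v f) x + vpair V (Top V f) / complex_of_real (L1norm V)) = \<phi>0"
    unfolding \<phi>0_def c_def pot_def \<tau>_def ..
  note [measurable] = pot_measurable[OF f]
  have m[measurable]: "\<phi>0 \<in> borel_measurable borel" unfolding \<phi>0_def by measurable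
  show ?thesis unfolding \<phi>0
  proof
    assume fS: "f \<in> S1L2 V"
    have vp: "vpair V f = 0" by (rule S1L2_vpair[OF fS])
    have eq: "aeq f (mult U (mult v \<phi>0))"
      using fS unfolding \<phi>0_def aeq_pot_iff S1L2_iff c_def by blast
    \<comment> \<open>Without its linear term \<open>pot f\<close> is bounded. This is decay
      exponent 0, good for every weight above 3/2.\<close>
    have "cmod (\<phi>0 x) \<le> (absmom f + cmod c) * (1 + norm x) powr (- 0)" for x
    proof -
      have "cmod (pot f x) \<le> absmom f" using pot_expand1[OF f, of x] vp by simp
      then have "cmod (\<phi>0 x) \<le> absmom f + cmod c"
        unfolding \<phi>0_def using norm_triangle_ineq[of "pot f x" c] by linarith
      \<comment> \<open>\<open>powr\<close> with exponent 0 is 1 only for a nonzero base.\<close>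
      moreover have "1 + norm x \<noteq> 0" by (metis add_nonneg_eq_0_iff norm_ge_zero zero_le_one zero_neq_one)
      ultimately show ?thesis by simp
    qed
    then have "wL2 s \<phi>0" if "s > 3 / 2" for s
      by (rule wL2_if_bounded_powr[OF m]) (use that in auto)
    then have "\<phi>0 \<in> Wsp (3/2)" unfolding Wsp_def by blast
    moreover have "dist_H_zero V \<phi>0" using dist_H_zero_pot[OF f] eq unfolding \<phi>0_def by blast
    ultimately show "\<exists>\<phi>. \<phi> \<in> Wsp (3/2) \<and> dist_H_zero V \<phi> \<and> aeq f (mult U (mult v \<phi>)) \<and> aeq \<phi> \<phi>0"
      using eq by auto
  next
    assume "\<exists>\<phi>. \<phi> \<in> Wsp (3/2) \<and> dist_H_zero V \<phi> \<and> aeq f (mult U (mult v \<phi>)) \<and> aeq \<phi> \<phi>0"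
    then obtain \<phi> where \<phi>: "\<phi> \<in> Wsp (3/2)" "aeq f (mult U (mult v \<phi>))" "aeq \<phi> \<phi>0" by blast
    have "wL2 2 \<phi>" using \<phi>(1) unfolding Wsp_def by auto
    then have "wL2 2 \<phi>0" by (rule wL2_aeq[OF _ \<phi>(3) m])
    then have vp: "vpair V f = 0" unfolding \<phi>0_def by (rule vpair_zero_if_wL2[OF f])
    have "aeq (mult U (mult v \<phi>)) (mult U (mult v \<phi>0))"
      using \<phi>(3) unfolding aeq_def mult_def by (auto elim: AE_mp)
    then have "aeq f (mult U (mult v \<phi>0))" by (rule aeq_trans[OF \<phi>(2)])
    then have "aeq (Top V f) (\<lambda>x. c * vc x)" unfolding \<phi>0_def aeq_pot_iff .
    then show "f \<in> S1L2 V" unfolding S1L2_iff c_def using f vp by blast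
  qed
qed

text \<open>Pairing \<open>T f = 0\<close> with \<open>v\<close> yields \<open>\<tau> f = 0\<close>,
  so the condition on \<open>\<tau>\<close> and the equation of \<open>S1L2_iff\<close> merge into
  \<open>T f = 0\<close>, which is \<open>f = U v (pot f)\<close>.\<close>

lemma S2L2_iff_pot:
  assumes f: "sq_int f"
  shows "f \<in> S2L2 V \<longleftrightarrow> aeq f (mult U (mult v (pot f))) \<and> vpair V f = 0 \<and> (\<forall>j. m1 j f = 0)"
proof -
  have "aeq f (mult U (mult v (pot f))) \<longleftrightarrow> aeq (Top V f) (\<lambda>x. 0)"
    using aeq_pot_iff[of f 0] by simp
  moreover have "\<tau> f = 0" if "aeq (Top V f) (\<lambda>x. 0)"
  proof -
    have "L2_inner vc (Top V f) = L2_inner vc (\<lambda>_. 0)"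
      by (rule L2_inner_cong[OF aeq_refl that]) (use sq_intD(1)[OF sq_int_Top[OF f]] in auto)
    then show ?thesis unfolding \<tau>_def vpair_eq_inner by simp
  qed
  ultimately show ?thesis unfolding S2L2_iff S1L2_iff using f by auto
qed

lemma S2L2_characterisation:
  assumes f: "sq_int f"
  shows "f \<in> S2L2 V \<longleftrightarrow>
    (\<exists>\<phi>. \<phi> \<in> Wsp (1/2) \<and> dist_H_zero V \<phi> \<and> aeq f (mult U (mult v \<phi>))
      \<and> aeq \<phi> (\<lambda>x. - intop G0k (mult v f) x))"
  unfolding pot_def[symmetric]
proof
  note m = pot_measurable[OF f]
  assume "f \<in> S2L2 V"
  then have eq: "aeq f (mult U (mult v (pot f)))" and vp: "vpair V f = 0" and m1: "\<And>j. m1 j f = 0"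
    unfolding S2L2_iff_pot[OF f] by auto
  have "cmod (pot f x) \<le> absmom f * 2 ^ 1 * (1 + norm x) powr (- real 1)" for x
  proof (rule pot_decay[OF f vp])
    show "cmod (pot f x) \<le> absmom f / norm x ^ 1" if "1 \<le> norm x" for x
      using pot_expand2[OF f vp, of x] that m1 by fastforce
  qed
  then have "wL2 s (pot f)" if "s > 1 / 2" for s
    by (rule wL2_if_bounded_powr[OF m]) (use that in auto)
  then have "pot f \<in> Wsp (1/2)" unfolding Wsp_def by blast
  moreover have "dist_H_zero V (pot f)" using dist_H_zero_pot[OF f, of 0] eq by simp
  ultimately show "\<exists>\<phi>. \<phi> \<in> Wsp (1/2) \<and> dist_H_zero V \<phi> \<and> aeq f (mult U (mult v \<phi>)) \<and> aeq \<phi> (\<lambda>x. pot f x)"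
    using eq by auto
next
  note m = pot_measurable[OF f]
  assume "\<exists>\<phi>. \<phi> \<in> Wsp (1/2) \<and> dist_H_zero V \<phi> \<and> aeq f (mult U (mult v \<phi>)) \<and> aeq \<phi> (\<lambda>x. pot f x)"
  then obtain \<phi> where \<phi>: "\<phi> \<in> Wsp (1/2)" "aeq f (mult U (mult v \<phi>))" "aeq \<phi> (pot f)" by auto
  \<comment> \<open>Weight 2 removes the mean; only then does weight 1 reach the first
    moments.\<close>
  have "wL2 1 \<phi>" "wL2 2 \<phi>" using \<phi>(1) unfolding Wsp_def by auto
  then have w: "wL2 1 (pot f)" "wL2 2 (pot f)" using wL2_aeq[OF _ \<phi>(3) m] by auto
  have vp: "vpair V f = 0" using vpair_zero_if_wL2[OF f, of 0] w(2) by simp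
  have "aeq (mult U (mult v \<phi>)) (mult U (mult v (pot f)))"
    using \<phi>(3) unfolding aeq_def mult_def by (auto elim: AE_mp)
  then have "aeq f (mult U (mult v (pot f)))" by (rule aeq_trans[OF \<phi>(2)])
  then show "f \<in> S2L2 V" unfolding S2L2_iff_pot[OF f] using vp m1_zero_if_wL2[OF f vp w(1)] by blast
qed

lemma S3L2_characterisation:
  assumes f: "sq_int f"
  shows "f \<in> S3L2 V \<longleftrightarrow>
    (\<exists>\<phi>. sq_int \<phi> \<and> dist_H_zero V \<phi> \<and> aeq f (mult U (mult v \<phi>))
      \<and> aeq \<phi> (\<lambda>x. - intop G0k (mult v f) x))"
  unfolding pot_def[symmetric]
proof
  note m = pot_measurable[OF f]
  assume fS: "f \<in> S3L2 V"
  then have eq: "aeq f (mult U (mult v (pot f)))" and vp: "vpair V f = 0" and m1: "\<And>j. m1 j f = 0"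
    and m2: "\<And>i j. m2 i j f = 0"
    unfolding S3L2_iff S2L2_iff_pot[OF f] by auto
  have mr: "mr f = 0" using mr_eq[OF f] m2 by simp
  have "cmod (pot f x) \<le> absmom f * 2 ^ 2 * (1 + norm x) powr (- real 2)" for x
  proof (rule pot_decay[OF f vp])
    show "cmod (pot f x) \<le> absmom f / norm x ^ 2" if "1 \<le> norm x" for x
      using pot_expand3[OF f vp m1, of x] that m2 mr by fastforce
  qed
  then have "wL2 0 (pot f)" by (rule wL2_if_bounded_powr[OF m]) auto
  then have "sq_int (pot f)" unfolding wL2_def by (simp add: add_nonneg_eq_0_iff)
  moreover have "dist_H_zero V (pot f)" using dist_H_zero_pot[OF f, of 0] eq by simp
  ultimately show "\<exists>\<phi>. sq_int \<phi> \<and> dist_H_zero V \<phi> \<and> aeq f (mult U (mult v \<phi>)) \<and> aeq \<phi> (\<lambda>x. pot f x)"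
    using eq by auto
next
  note m = pot_measurable[OF f]
  assume "\<exists>\<phi>. sq_int \<phi> \<and> dist_H_zero V \<phi> \<and> aeq f (mult U (mult v \<phi>)) \<and> aeq \<phi> (\<lambda>x. pot f x)"
  then obtain \<phi> where \<phi>: "sq_int \<phi>" "dist_H_zero V \<phi>" "aeq f (mult U (mult v \<phi>))" "aeq \<phi> (pot f)" by auto
  \<comment> \<open>\<open>L^2\<close> is contained in this space, so the preceding characterisation
    already gives mean zero and vanishing first moments.\<close>
  have "\<phi> \<in> Wsp (1/2)" unfolding Wsp_def using sq_int_imp_wL2[OF \<phi>(1)] by auto
  then have fS2: "f \<in> S2L2 V" unfolding S2L2_characterisation[OF f] pot_def[symmetric] using \<phi> by auto
  have "sq_int (pot f)" by (rule sq_int_aeq[OF \<phi>(1,4) m])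
  then show "f \<in> S3L2 V"
    unfolding S3L2_iff using fS2 m2_zero_if_sq_int[OF f] unfolding S2L2_iff_pot[OF f] by blast
qed

end

theorem theorem5p2:
  fixes V :: "real^3 \<Rightarrow> real" and \<beta> :: real
  assumes "V \<in> borel_measurable lborel"
    and "\<exists>C. \<forall>x. \<bar>V x\<bar> \<le> C * (1 + norm x) powr (- \<beta>)"
    and "L1norm V \<noteq> 0"
  shows "(\<beta> > 11 \<longrightarrow> (\<forall>f. sq_int f \<and> \<not> aeq f (\<lambda>_. 0) \<longrightarrow>
            (f \<in> S1L2 V \<longleftrightarrow>
              (\<exists>\<phi>. \<phi> \<in> Wsp (3/2) \<and> dist_H_zero V \<phi>
                  \<and> aeq f (mult (sgnU V) (mult (vfun V) \<phi>))
                  \<and> aeq \<phi> (\<lambda>x. - intop G0k (mult (vfun V) f) x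
                                 + vpair V (Top V f) / complex_of_real (L1norm V))))))
       \<and> (\<beta> > 19 \<longrightarrow> (\<forall>f. sq_int f \<and> \<not> aeq f (\<lambda>_. 0) \<longrightarrow>
            (f \<in> S2L2 V \<longleftrightarrow>
              (\<exists>\<phi>. \<phi> \<in> Wsp (1/2) \<and> dist_H_zero V \<phi>
                  \<and> aeq f (mult (sgnU V) (mult (vfun V) \<phi>))
                  \<and> aeq \<phi> (\<lambda>x. - intop G0k (mult (vfun V) f) x)))))
       \<and> (\<beta> > 23 \<longrightarrow> (\<forall>f. sq_int f \<and> \<not> aeq f (\<lambda>_. 0) \<longrightarrow>
            (f \<in> S3L2 V \<longleftrightarrow>
              (\<exists>\<phi>. sq_int \<phi> \<and> dist_H_zero V \<phi>
                  \<and> aeq f (mult (sgnU V) (mult (vfun V) \<phi>))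
                  \<and> aeq \<phi> (\<lambda>x. - intop G0k (mult (vfun V) f) x)))))"
proof -
  have pot: "decaying_potential V \<beta>" if "\<beta> > 11"
    by unfold_locales (use assms that in auto)
  show ?thesis
    using decaying_potential.S1L2_characterisation[OF pot]
      decaying_potential.S2L2_characterisation[OF pot]
      decaying_potential.S3L2_characterisation[OF pot] by auto
qed

end
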